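(* Let $K$ be a field, $Q$ a connected quiver, $\beta\le\alpha$ dimension vectors for $Q$, and $\phi\in\operatorname{rep}(Q,\alpha)$. Then every rank locus in the quiver Grassmannian $\operatorname{Gr}(\phi,\beta)$ of $\beta$-dimensional subrepresentations of $\phi$ is constructible.
   Context: $K$ is an arbitrary field. A quiver is a finite directed graph (loops and parallel arrows allowed); all quivers are assumed connected. For an arrow $a$, $ta$ and $ha$ denote its tail and head. A representation $\phi=(V_x,\phi_a)$ of $Q$ assigns a finite-dimensional $K$-vector space $V_x$ to each vertex $x$ and a linear map $\phi_a\colon V_{ta}\to V_{ha}$ to each arrow $a$; with the usual morphisms these form a category $\operatorname{rep}(Q)$. A dimension vector $\alpha$ assigns a nonnegative integer $\alpha(x)$ to each vertex $x$; $\beta\le\alpha$ means $\beta(x)\le\alpha(x)$ for all $x$. The representation space is the affine space $\operatorname{rep}(\alpha)=\operatorname{rep}(Q,\alpha)=\bigoplus_{a}\operatorname{Hom}_K(K^{\alpha(ta)},K^{\alpha(ha)})$. Let $\operatorname{Gr}(\alpha,\beta)=\prod_x \operatorname{Gr}(\alpha(x),\beta(x))$ be the product over vertices of Grassmannians of $\beta(x)$-dimensional subspaces of $K^{\alpha(x)}$; a point is a collection of subspaces $W=(W_x\subseteq K^{\alpha(x)})$. The bundle of $\beta$-dimensional subrepresentations is $$\operatorname{rep}(\beta\subset\alpha)=\{(W,\phi)\in\operatorname{Gr}(\alpha,\beta)\times\operatorname{rep}(\alpha)\mid \phi_a(W_{ta})\subseteq W_{ha}\text{ for all arrows }a\},$$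 with projection $p\colon\operatorname{rep}(\beta\subset\alpha)\to\operatorname{rep}(\alpha)$. The quiver Grassmannian $\operatorname{Gr}(\phi,\beta)$ is the fiber $p^{-1}(\phi)$, a projective variety (with the Zariski topology) parametrizing $\beta$-dimensional subrepresentations of $\phi$. A subset of a variety is constructible if it can be obtained from finitely many subsets, each open or closed, via unions and intersections. Global rank function: a representation $\phi$ has a unique largest subrepresentation $\mathcal{E}(\phi)$ in which the map over every arrow is surjective, and a unique largest quotient representation $\mathcal{M}(\phi)$ in which the map over every arrow is injective. The image of the composition $\mathcal{E}(\phi)\hookrightarrow\phi\twoheadrightarrow\mathcal{M}(\phi)$ has an isomorphism over every arrow, so (as $Q$ is connected) its vector spaces at all vertices have a common dimension; this number is $\operatorname{rank}_Q(\phi)$. Rank functions: a morphism of quivers $f\colon Q'\to Q$ sends vertices to vertices and arrows to arrows compatibly with heads and tails. It induces a pullback $f^*\colon\operatorname{rep}(Q)\to\operatorname{rep}(Q')$, $f^*(W_x,\psi_a)=(W_{f(x)},\psi_{f(a)})$, and a pushforward $f_*\colon\operatorname{rep}(Q')\to\operatorname{rep}(Q)$, $f_*(V_x,\phi_a)=\left(\bigoplus_{y\in f^{-1}(x)}V_y,\ \sum_{b\in f^{-1}(a)}\phi_b\right)$, where each $\phi_b$ is extended by zero to the summands $V_y$ with $y\neq tb$. A rank function on $Q$ is any function $\operatorname{rep}(Q)\to\mathbb{Z}_{\ge 0}$ of the form $\phi\mapsto \operatorname{rank}_{Q_m}(F_{m-1}\cdots F_1\phi)$, where $Q=Q_1,Q_2,\dots,Q_m$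 is a finite sequence of quivers and each $F_i\colon\operatorname{rep}(Q_i)\to\operatorname{rep}(Q_{i+1})$ is either the pushforward along a morphism $Q_i\to Q_{i+1}$ or the pullback along a morphism $Q_{i+1}\to Q_i$. Rank loci: a point $(W,\phi)\in\operatorname{rep}(\beta\subset\alpha)$ gives the subrepresentation $\phi|_W=(W_x,\phi_a|_{W_{ta}})$ of $\phi$ and the quotient representation $\phi/\phi|_W$. Each rank function $r$ on $Q$ induces functions $(W,\phi)\mapsto r(\phi|_W)$ and $(W,\phi)\mapsto r(\phi/\phi|_W)$. A rank locus in $\operatorname{rep}(\beta\subset\alpha)$ is the set of points satisfying some finite list of linear inequalities in the values of such functions, and a rank locus in $\operatorname{Gr}(\phi,\beta)$ is the intersection of a rank locus in $\operatorname{rep}(\beta\subset\alpha)$ with the fiber $p^{-1}(\phi)$. *)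

theory Defs
  imports
    "HOL-Library.Function_Algebras"
    "HOL-Library.Nat_Bijection"
    "HOL-Library.Poly_Mapping"
    "HOL-Analysis.Abstract_Topology"
    "Graph_Theory.Digraph_Component"
    "Jordan_Normal_Form.Determinant"
begin

text \<open>
  Every finite-dimensional vector space used below is carried by a finite-dimensional subspace of
  the ambient space of all functions \<open>nat \<Rightarrow> 'k\<close>. Up to isomorphism this is no restriction, and it
  gives all representations, of all quivers, one common type of vectors.
\<close>

definition vscale :: "'k::field \<Rightarrow> (nat \<Rightarrow> 'k) \<Rightarrow> nat \<Rightarrow> 'k" where
  "vscale c u = (\<lambda>i. c * u i)"

interpretation VS: vector_space "vscale :: 'k::field \<Rightarrow> (nat \<Rightarrow> 'k) \<Rightarrow> nat \<Rightarrow> 'k"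
  by unfold_locales (auto simp: vscale_def fun_eq_iff algebra_simps)

definition fin_dim :: "(nat \<Rightarrow> 'k::field) set \<Rightarrow> bool" where
  "fin_dim V \<longleftrightarrow> (\<exists>B. finite B \<and> VS.span B = V)"

definition std_space :: "nat \<Rightarrow> (nat \<Rightarrow> 'k::field) set" where
  "std_space n = {u. \<forall>i\<ge>n. u i = 0}"

text \<open>Linear maps are only constrained on their domain \<open>V\<close>; values elsewhere are irrelevant.\<close>

definition linear_between ::
  "(nat \<Rightarrow> 'k::field) set \<Rightarrow> (nat \<Rightarrow> 'k) set \<Rightarrow> ((nat \<Rightarrow> 'k) \<Rightarrow> nat \<Rightarrow> 'k) \<Rightarrow> bool" where
  "linear_between V U f \<longleftrightarrow> f ` V \<subseteq> U \<and> (\<forall>u\<in>V. \<forall>v\<in>V. f (u + v) = f u + f v) \<and>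
     (\<forall>c. \<forall>u\<in>V. f (vscale c u) = vscale c (f u))"


section \<open>Quivers and their representations\<close>

text \<open>Connectedness refers to the underlying undirected graph and includes nonemptiness.\<close>

definition quiver :: "('v,'e) pre_digraph \<Rightarrow> bool" where
  "quiver Q \<longleftrightarrow> fin_digraph Q \<and> Digraph_Component.connected Q"

record ('v,'e,'k) qrep =
  vs_at :: "'v \<Rightarrow> (nat \<Rightarrow> 'k) set"
  map_at :: "'e \<Rightarrow> (nat \<Rightarrow> 'k) \<Rightarrow> nat \<Rightarrow> 'k"

definition representation :: "('v,'e) pre_digraph \<Rightarrow> ('v,'e,'k::field) qrep \<Rightarrow> bool" where
  "representation Q \<phi> \<longleftrightarrow> (\<forall>x\<in>verts Q. fin_dim (vs_at \<phi> x)) \<and>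
     (\<forall>a\<in>arcs Q. linear_between (vs_at \<phi> (tail Q a)) (vs_at \<phi> (head Q a)) (map_at \<phi> a))"

text \<open>
  Families of subspaces are normalised to be zero off the vertex set, so that a family indexed by
  the vertices corresponds to exactly one function and families can be compared by \<open>\<le>\<close>.
\<close>

definition subrep ::
  "('v,'e) pre_digraph \<Rightarrow> ('v,'e,'k::field) qrep \<Rightarrow> ('v \<Rightarrow> (nat \<Rightarrow> 'k) set) \<Rightarrow> bool" where
  "subrep Q \<phi> W \<longleftrightarrow> (\<forall>x\<in>verts Q. VS.subspace (W x) \<and> W x \<subseteq> vs_at \<phi> x) \<and>
     (\<forall>x. x \<notin> verts Q \<longrightarrow> W x = {0}) \<and>
     (\<forall>a\<in>arcs Q. map_at \<phi> a ` W (tail Q a) \<subseteq> W (head Q a))"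

definition restrict_rep ::
  "('v,'e,'k) qrep \<Rightarrow> ('v \<Rightarrow> (nat \<Rightarrow> 'k) set) \<Rightarrow> ('v,'e,'k) qrep" where
  "restrict_rep \<phi> W = \<phi>\<lparr>vs_at := W\<rparr>"

text \<open>
  Cosets do not live in the ambient space, so the quotient is a chosen representation \<open>\<psi>\<close> together
  with a surjective morphism \<open>\<pi>\<close> from \<open>\<phi>\<close> to \<open>\<psi>\<close> with kernel \<open>W\<close>; such a pair exists and is
  unique up to unique isomorphism.
\<close>

definition is_quotient ::
  "('v,'e) pre_digraph \<Rightarrow> ('v,'e,'k::field) qrep \<Rightarrow> ('v \<Rightarrow> (nat \<Rightarrow> 'k) set) \<Rightarrow>
   ('v,'e,'k) qrep \<times> ('v \<Rightarrow> (nat \<Rightarrow> 'k) \<Rightarrow> nat \<Rightarrow> 'k) \<Rightarrow> bool" where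
  "is_quotient Q \<phi> W = (\<lambda>(\<psi>, \<pi>). representation Q \<psi> \<and>
     (\<forall>x\<in>verts Q. linear_between (vs_at \<phi> x) (vs_at \<psi> x) (\<pi> x) \<and>
        \<pi> x ` vs_at \<phi> x = vs_at \<psi> x \<and> {v \<in> vs_at \<phi> x. \<pi> x v = 0} = W x) \<and>
     (\<forall>a\<in>arcs Q. \<forall>v\<in>vs_at \<phi> (tail Q a).
        \<pi> (head Q a) (map_at \<phi> a v) = map_at \<psi> a (\<pi> (tail Q a) v)))"

definition quotient_rep ::
  "('v,'e) pre_digraph \<Rightarrow> ('v,'e,'k::field) qrep \<Rightarrow> ('v \<Rightarrow> (nat \<Rightarrow> 'k) set) \<Rightarrow> ('v,'e,'k) qrep" where
  "quotient_rep Q \<phi> W = fst (SOME q. is_quotient Q \<phi> W q)"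

definition quotient_proj ::
  "('v,'e) pre_digraph \<Rightarrow> ('v,'e,'k::field) qrep \<Rightarrow> ('v \<Rightarrow> (nat \<Rightarrow> 'k) set) \<Rightarrow>
   'v \<Rightarrow> (nat \<Rightarrow> 'k) \<Rightarrow> nat \<Rightarrow> 'k" where
  "quotient_proj Q \<phi> W = snd (SOME q. is_quotient Q \<phi> W q)"


section \<open>Rank functions\<close>

definition epi_part ::
  "('v,'e) pre_digraph \<Rightarrow> ('v,'e,'k::field) qrep \<Rightarrow> 'v \<Rightarrow> (nat \<Rightarrow> 'k) set" where
  "epi_part Q \<phi> = (GREATEST W. subrep Q \<phi> W \<and>
     (\<forall>a\<in>arcs Q. map_at \<phi> a ` W (tail Q a) = W (head Q a)))"

text \<open>The largest quotient with injective maps is the one with the least kernel.\<close>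

definition mono_kernel ::
  "('v,'e) pre_digraph \<Rightarrow> ('v,'e,'k::field) qrep \<Rightarrow> 'v \<Rightarrow> (nat \<Rightarrow> 'k) set" where
  "mono_kernel Q \<phi> = (LEAST N. subrep Q \<phi> N \<and>
     (\<forall>a\<in>arcs Q. inj_on (map_at (quotient_rep Q \<phi> N) a) (vs_at (quotient_rep Q \<phi> N) (tail Q a))))"

definition global_rank :: "('v,'e) pre_digraph \<Rightarrow> ('v,'e,'k::field) qrep \<Rightarrow> nat" where
  "global_rank Q \<phi> = (THE n. \<forall>x\<in>verts Q.
     VS.dim (quotient_proj Q \<phi> (mono_kernel Q \<phi>) x ` epi_part Q \<phi> x) = n)"

definition quiver_hom ::
  "('w,'d) pre_digraph \<Rightarrow> ('v,'e) pre_digraph \<Rightarrow> ('w \<Rightarrow> 'v) \<Rightarrow> ('d \<Rightarrow> 'e) \<Rightarrow> bool" where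
  "quiver_hom Q' Q f g \<longleftrightarrow> f ` verts Q' \<subseteq> verts Q \<and> g ` arcs Q' \<subseteq> arcs Q \<and>
     (\<forall>b\<in>arcs Q'. tail Q (g b) = f (tail Q' b) \<and> head Q (g b) = f (head Q' b))"

definition pullback ::
  "('w \<Rightarrow> 'v) \<Rightarrow> ('d \<Rightarrow> 'e) \<Rightarrow> ('v,'e,'k) qrep \<Rightarrow> ('w,'d,'k) qrep" where
  "pullback f g \<psi> = \<lparr>vs_at = (\<lambda>y. vs_at \<psi> (f y)), map_at = (\<lambda>b. map_at \<psi> (g b))\<rparr>"

text \<open>
  The bijection \<open>prod_encode\<close> identifies the ambient space with families, indexed by \<open>y :: nat\<close>, of
  elements of the ambient space (namely families of \<open>summand_proj y\<close>). This realises external direct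
  sums indexed by a finite set of natural numbers inside the ambient space.
\<close>

definition summand_proj :: "nat \<Rightarrow> (nat \<Rightarrow> 'k) \<Rightarrow> nat \<Rightarrow> 'k" where
  "summand_proj y u = (\<lambda>i. u (prod_encode (y, i)))"

definition summand_inj :: "nat \<Rightarrow> (nat \<Rightarrow> 'k::zero) \<Rightarrow> nat \<Rightarrow> 'k" where
  "summand_inj y v = (\<lambda>j. case prod_decode j of (z, i) \<Rightarrow> if z = y then v i else 0)"

definition direct_sum :: "nat set \<Rightarrow> (nat \<Rightarrow> (nat \<Rightarrow> 'k::zero) set) \<Rightarrow> (nat \<Rightarrow> 'k) set" where
  "direct_sum I V = {u. (\<forall>y\<in>I. summand_proj y u \<in> V y) \<and>
     (\<forall>y. y \<notin> I \<longrightarrow> summand_proj y u = (\<lambda>_. 0))}"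

definition pushforward ::
  "(nat,nat) pre_digraph \<Rightarrow> (nat \<Rightarrow> 'v) \<Rightarrow> (nat \<Rightarrow> 'e) \<Rightarrow>
   (nat,nat,'k::field) qrep \<Rightarrow> ('v,'e,'k) qrep" where
  "pushforward Q' f g \<phi> =
     \<lparr>vs_at = (\<lambda>x. direct_sum {y \<in> verts Q'. f y = x} (vs_at \<phi>)),
      map_at = (\<lambda>a u. \<Sum>b | b \<in> arcs Q' \<and> g b = a.
        summand_inj (head Q' b) (map_at \<phi> b (summand_proj (tail Q' b) u)))\<rparr>"

text \<open>
  Rank functions are first defined for quivers whose vertices and arrows are natural numbers, which
  allows one inductive definition to pass through a sequence of different quivers. Since every
  quiver is isomorphic to one of these, the general case is obtained by relabelling.
\<close>

inductive nat_rank_function ::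
  "(nat,nat) pre_digraph \<Rightarrow> ((nat,nat,'k::field) qrep \<Rightarrow> nat) \<Rightarrow> bool" where
  global: "quiver Q \<Longrightarrow> nat_rank_function Q (global_rank Q)"
| push: "\<lbrakk>quiver Q; quiver Q'; quiver_hom Q Q' f g; nat_rank_function Q' r\<rbrakk>
    \<Longrightarrow> nat_rank_function Q (\<lambda>\<phi>. r (pushforward Q f g \<phi>))"
| pull: "\<lbrakk>quiver Q; quiver Q'; quiver_hom Q' Q f g; nat_rank_function Q' r\<rbrakk>
    \<Longrightarrow> nat_rank_function Q (\<lambda>\<phi>. r (pullback f g \<phi>))"

definition rank_function ::
  "('v,'e) pre_digraph \<Rightarrow> (('v,'e,'k::field) qrep \<Rightarrow> nat) \<Rightarrow> bool" where
  "rank_function Q r \<longleftrightarrow> (\<exists>Q' f g r'. quiver Q' \<and> quiver_hom Q' Q f g \<and>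
     bij_betw f (verts Q') (verts Q) \<and> bij_betw g (arcs Q') (arcs Q) \<and>
     nat_rank_function Q' r' \<and> r = (\<lambda>\<phi>. r' (pullback f g \<phi>)))"


section \<open>Quiver Grassmannians and rank loci\<close>

definition rep_space ::
  "('v,'e) pre_digraph \<Rightarrow> ('v \<Rightarrow> nat) \<Rightarrow> ('v,'e,'k::field) qrep set" where
  "rep_space Q \<alpha> = {\<phi>. representation Q \<phi> \<and> (\<forall>x\<in>verts Q. vs_at \<phi> x = std_space (\<alpha> x))}"

definition grassmannian ::
  "('v,'e) pre_digraph \<Rightarrow> ('v \<Rightarrow> nat) \<Rightarrow> ('v \<Rightarrow> nat) \<Rightarrow> ('v \<Rightarrow> (nat \<Rightarrow> 'k::field) set) set" where
  "grassmannian Q \<alpha> \<beta> =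
     {W. (\<forall>x\<in>verts Q. VS.subspace (W x) \<and> W x \<subseteq> std_space (\<alpha> x) \<and> VS.dim (W x) = \<beta> x) \<and>
         (\<forall>x. x \<notin> verts Q \<longrightarrow> W x = {0})}"

definition subrep_bundle ::
  "('v,'e) pre_digraph \<Rightarrow> ('v \<Rightarrow> nat) \<Rightarrow> ('v \<Rightarrow> nat) \<Rightarrow>
   (('v \<Rightarrow> (nat \<Rightarrow> 'k::field) set) \<times> ('v,'e,'k) qrep) set" where
  "subrep_bundle Q \<alpha> \<beta> = {(W, \<phi>). W \<in> grassmannian Q \<alpha> \<beta> \<and> \<phi> \<in> rep_space Q \<alpha> \<and>
     (\<forall>a\<in>arcs Q. map_at \<phi> a ` W (tail Q a) \<subseteq> W (head Q a))}"

definition quiver_grassmannian ::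
  "('v,'e) pre_digraph \<Rightarrow> ('v \<Rightarrow> nat) \<Rightarrow> ('v \<Rightarrow> nat) \<Rightarrow> ('v,'e,'k::field) qrep \<Rightarrow>
   ('v \<Rightarrow> (nat \<Rightarrow> 'k) set) set" where
  "quiver_grassmannian Q \<alpha> \<beta> \<phi> = {W. (W, \<phi>) \<in> subrep_bundle Q \<alpha> \<beta>}"

text \<open>
  The left-hand side of a linear inequality is given by two lists of pairs of a real coefficient and
  a rank function: one to be evaluated on the subrepresentation, one on the quotient.
\<close>

definition rank_form ::
  "('v,'e) pre_digraph \<Rightarrow> (real \<times> (('v,'e,'k::field) qrep \<Rightarrow> nat)) list \<Rightarrow>
   (real \<times> (('v,'e,'k) qrep \<Rightarrow> nat)) list \<Rightarrow>
   ('v \<Rightarrow> (nat \<Rightarrow> 'k) set) \<times> ('v,'e,'k) qrep \<Rightarrow> real" where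
  "rank_form Q S T = (\<lambda>(W, \<phi>).
     (\<Sum>(c, r)\<leftarrow>S. c * real (r (restrict_rep \<phi> W))) +
     (\<Sum>(c, r)\<leftarrow>T. c * real (r (quotient_rep Q \<phi> W))))"

definition rank_halfspace ::
  "('v,'e) pre_digraph \<Rightarrow> ('v \<Rightarrow> nat) \<Rightarrow> ('v \<Rightarrow> nat) \<Rightarrow>
   (('v \<Rightarrow> (nat \<Rightarrow> 'k::field) set) \<times> ('v,'e,'k) qrep) set \<Rightarrow> bool" where
  "rank_halfspace Q \<alpha> \<beta> H \<longleftrightarrow>
     (\<exists>S T d. (\<forall>(c, r)\<in>set S \<union> set T. rank_function Q r) \<and>
        (H = {p \<in> subrep_bundle Q \<alpha> \<beta>. rank_form Q S T p \<le> d} \<or>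
         H = {p \<in> subrep_bundle Q \<alpha> \<beta>. rank_form Q S T p < d}))"

definition bundle_rank_locus ::
  "('v,'e) pre_digraph \<Rightarrow> ('v \<Rightarrow> nat) \<Rightarrow> ('v \<Rightarrow> nat) \<Rightarrow>
   (('v \<Rightarrow> (nat \<Rightarrow> 'k::field) set) \<times> ('v,'e,'k) qrep) set \<Rightarrow> bool" where
  "bundle_rank_locus Q \<alpha> \<beta> Z \<longleftrightarrow>
     (\<exists>\<H>. finite \<H> \<and> (\<forall>H\<in>\<H>. rank_halfspace Q \<alpha> \<beta> H) \<and> Z = subrep_bundle Q \<alpha> \<beta> \<inter> \<Inter>\<H>)"

definition rank_locus ::
  "('v,'e) pre_digraph \<Rightarrow> ('v \<Rightarrow> nat) \<Rightarrow> ('v \<Rightarrow> nat) \<Rightarrow> ('v,'e,'k::field) qrep \<Rightarrow>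
   ('v \<Rightarrow> (nat \<Rightarrow> 'k) set) set \<Rightarrow> bool" where
  "rank_locus Q \<alpha> \<beta> \<phi> Y \<longleftrightarrow>
     (\<exists>Z. bundle_rank_locus Q \<alpha> \<beta> Z \<and> Y = {W \<in> quiver_grassmannian Q \<alpha> \<beta> \<phi>. (W, \<phi>) \<in> Z})"


section \<open>The Zariski topology\<close>

text \<open>
  The product of Grassmannians carries the topology of its Pluecker embedding into a product of
  projective spaces, one for each vertex. Points are families of subspaces, that is, \<open>K\<close>-rational
  points, also when \<open>K\<close> is not algebraically closed. The variable \<open>(x, I)\<close> stands for the Pluecker coordinate
  at the vertex \<open>x\<close> with row set \<open>I\<close>. The coordinates at \<open>x\<close> depend on the chosen basis of \<open>W x\<close>
  only up to a common nonzero factor, hence the vanishing of a multihomogeneous polynomial at them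
  does not depend on the choice.
\<close>

definition chosen_basis :: "(nat \<Rightarrow> 'k::field) set \<Rightarrow> (nat \<Rightarrow> 'k) list" where
  "chosen_basis V = (SOME bs. distinct bs \<and> VS.independent (set bs) \<and> VS.span (set bs) = V)"

definition pluecker :: "('v \<Rightarrow> (nat \<Rightarrow> 'k::field) set) \<Rightarrow> 'v \<times> nat set \<Rightarrow> 'k" where
  "pluecker W = (\<lambda>(x, I). det (mat (card I) (card I)
     (\<lambda>(i, j). (chosen_basis (W x) ! j) (sorted_list_of_set I ! i))))"

text \<open>Polynomials are finitely supported maps from monomials (i.e. exponent maps) to coefficients.\<close>

type_synonym ('x,'k) mpoly = "('x \<Rightarrow>\<^sub>0 nat) \<Rightarrow>\<^sub>0 'k"

definition mpoly_eval :: "('x \<Rightarrow> 'k::field) \<Rightarrow> ('x,'k) mpoly \<Rightarrow> 'k" where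
  "mpoly_eval c F = (\<Sum>m\<in>Poly_Mapping.keys F. Poly_Mapping.lookup F m *
     (\<Prod>v\<in>Poly_Mapping.keys m. c v ^ Poly_Mapping.lookup m v))"

definition multihomogeneous ::
  "('v,'e) pre_digraph \<Rightarrow> ('v \<Rightarrow> nat) \<Rightarrow> ('v \<Rightarrow> nat) \<Rightarrow> ('v \<times> nat set, 'k::field) mpoly \<Rightarrow> bool" where
  "multihomogeneous Q \<alpha> \<beta> F \<longleftrightarrow> (\<exists>d :: 'v \<Rightarrow> nat. \<forall>m\<in>Poly_Mapping.keys F.
     (\<forall>(x, I)\<in>Poly_Mapping.keys m. x \<in> verts Q \<and> I \<subseteq> {..<\<alpha> x} \<and> card I = \<beta> x) \<and>
     (\<forall>x\<in>verts Q. (\<Sum>v | v \<in> Poly_Mapping.keys m \<and> fst v = x. Poly_Mapping.lookup m v) = d x))"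

definition zariski ::
  "('v,'e) pre_digraph \<Rightarrow> ('v \<Rightarrow> nat) \<Rightarrow> ('v \<Rightarrow> nat) \<Rightarrow> ('v \<Rightarrow> (nat \<Rightarrow> 'k::field) set) topology" where
  "zariski Q \<alpha> \<beta> = topology_generated_by
     {{W \<in> grassmannian Q \<alpha> \<beta>. mpoly_eval (pluecker W) F \<noteq> 0} | F. multihomogeneous Q \<alpha> \<beta> F}"

inductive constructible :: "'p topology \<Rightarrow> 'p set \<Rightarrow> bool" for X where
  opn: "openin X S \<Longrightarrow> constructible X S"
| cls: "closedin X S \<Longrightarrow> constructible X S"
| un: "constructible X S \<Longrightarrow> constructible X T \<Longrightarrow> constructible X (S \<union> T)"
| int: "constructible X S \<Longrightarrow> constructible X T \<Longrightarrow> constructible X (S \<inter> T)"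

end

(*
  On the chart of the Grassmannian where the Pluecker coordinate with row set I x is nonzero at every
  vertex x, the projection to the coordinates in I x identifies W x with K^(I x), and the quotient of
  K^(alpha x) by W x is identified with the remaining coordinates.  Laplace expansion expresses the
  inverse of the projection by quotients of Pluecker coordinates.  Hence on each of these finitely
  many charts the subrepresentation and the quotient representation are isomorphic to
  representations on fixed coordinate spaces whose matrix entries are regular functions.

  Pushforward and pullback preserve such families.  For the global rank, the largest subrepresentation
  with surjective maps and the least kernel with injective quotient maps are reached after a number of
  iteration steps that is bounded on the chart, where each step only uses sums, intersections, images
  and preimages of subspaces.  The resulting dimensions are differences of dimensions of solution
  spaces of linear systems with regular coefficients, and Gaussian elimination shows that their level
  sets are constructible.
*)
theory Submission
  imports Defs "HOL-Analysis.Sigma_Algebra"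
begin

section \<open>Finite-dimensional subspaces of the ambient space\<close>

text \<open>The dimensions of the subspaces involved jump within a chart, so bases cannot be chosen
  regularly in the point. Subspaces are therefore carried as images of solution spaces of linear
  systems of fixed shape. Sums, images and preimages keep this form without any case distinction;
  cases are split only when a dimension is read off. All of this takes place over an abstract ring
  of functions on a set with a Boolean algebra of subsets (\<open>function_ring\<close>); Pluecker
  coordinates and the topology enter only when a chart is shown to be an instance. The second
  obstacle is that \<open>quotient_rep\<close> is an arbitrary choice made separately at every
  point, so nothing in it varies regularly. This is why isomorphisms are carried through all
  constructions of rank functions: at each point the chosen quotient is compared with a model on
  fixed coordinates. Everything stays within linear algebra, so no projection of constructible sets
  has to be formed and the field may be finite or infinite.\<close>

interpretation VP: vector_space_pair "vscale :: 'k::field \<Rightarrow> (nat \<Rightarrow> 'k) \<Rightarrow> nat \<Rightarrow> 'k" vscale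
  by unfold_locales

abbreviation lin :: "((nat \<Rightarrow> 'k::field) \<Rightarrow> nat \<Rightarrow> 'k) \<Rightarrow> bool" where
  "lin f \<equiv> Vector_Spaces.linear vscale vscale f"

lemma lin_iff:
  "lin f \<longleftrightarrow> (\<forall>x y. f (x + y) = f x + f y) \<and> (\<forall>c x. f (vscale c x) = vscale c (f x))"
  using VS.vector_space_axioms by (subst Vector_Spaces.linear_iff) auto

lemma linD:
  assumes "lin f"
  shows "f (x + y) = f x + f y" "f (vscale c x) = vscale c (f x)" "f 0 = 0" "f (x - y) = f x - f y"
  using assms VP.linear_add VP.linear_scale VP.linear_0 VP.linear_diff by blast+

text \<open>Prescribing the values of f on a basis of V gives a globally linear map. Arrow maps of a
  representation are constrained only on their domain, and this replacement makes the theory of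
  linear maps applicable to them.\<close>

lemma linear_between_extend:
  assumes V: "VS.subspace V" and f: "linear_between V U f"
  obtains g where "lin g" "\<forall>v\<in>V. g v = f v"
proof -
  obtain B where B: "B \<subseteq> V" "VS.independent B" "V \<subseteq> VS.span B"
    using VS.maximal_independent_subset .
  obtain g where g: "lin g" "\<forall>x\<in>B. g x = f x"
    using VP.linear_independent_extend[OF B(2)] by blast
  have f0: "f 0 = 0"
  proof -
    have "f (vscale 0 0) = vscale 0 (f 0)"
      using f VS.subspace_0[OF V] unfolding linear_between_def by blast
    then show ?thesis by simp
  qed
  have "VS.subspace {v \<in> V. g v = f v}"
    unfolding VS.subspace_def
    using VS.subspace_0[OF V] VS.subspace_add[OF V] VS.subspace_scale[OF V] f linD[OF g(1)] f0
    unfolding linear_between_def by auto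
  then have "VS.span B \<subseteq> {v \<in> V. g v = f v}"
    using B g by (intro VS.span_minimal) auto
  then show ?thesis using that g(1) B(3) by blast
qed

lemma fin_dim_subspace: "fin_dim V \<Longrightarrow> VS.subspace V"
  unfolding fin_dim_def using VS.subspace_span by blast

text \<open>The ambient space is infinite-dimensional, so the finiteness of a basis of S comes from
  the finite spanning set of V.\<close>

lemma fin_dim_basis:
  assumes "fin_dim V" "VS.subspace S" "S \<subseteq> V"
  obtains B where "B \<subseteq> S" "VS.independent B" "VS.span B = S" "finite B" "card B = VS.dim S"
proof -
  obtain C where C: "finite C" "VS.span C = V" using assms unfolding fin_dim_def by auto
  obtain B where B: "B \<subseteq> S" "VS.independent B" "S \<subseteq> VS.span B" "card B = VS.dim S"
    using VS.basis_exists .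
  moreover have "finite B" using VS.independent_span_bound[OF C(1) B(2)] B C assms by auto
  moreover have "VS.span B = S" using B VS.span_minimal[OF B(1) assms(2)] by auto
  ultimately show ?thesis using that by blast
qed

lemma fin_dim_mono: "fin_dim V \<Longrightarrow> VS.subspace S \<Longrightarrow> S \<subseteq> V \<Longrightarrow> fin_dim S"
  by (metis fin_dim_basis fin_dim_def)

lemma fin_dim_image:
  assumes "fin_dim V" "lin f" shows "fin_dim (f ` V)"
  using assms unfolding fin_dim_def
  by (metis VP.linear_span_image finite_imageI)

lemma dim_mono:
  assumes "fin_dim T" "S \<subseteq> T" shows "VS.dim S \<le> VS.dim T"
proof -
  obtain B where "VS.span B = T" "finite B" "card B = VS.dim T"
    using fin_dim_basis[OF assms(1) fin_dim_subspace[OF assms(1)]] by auto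
  then show ?thesis using VS.dim_le_card[of S B] assms by auto
qed

text \<open>A basis of S extends to a basis of T, and equal cardinalities leave nothing to
  add.\<close>

lemma dim_eq_imp_eq:
  assumes "fin_dim T" "VS.subspace S" "S \<subseteq> T" "VS.dim S = VS.dim T" shows "S = T"
proof -
  obtain B where B: "B \<subseteq> S" "VS.independent B" "VS.span B = S" "finite B" "card B = VS.dim S"
    using fin_dim_basis[OF assms(1-3)] .
  obtain C where C: "B \<subseteq> C" "C \<subseteq> T" "VS.independent C" "T \<subseteq> VS.span C"
    using VS.maximal_independent_subset_extend[of B T] B assms by blast
  have "card C = VS.dim T" using VS.basis_card_eq_dim C by blast
  moreover have "finite C"
    using C assms(1) unfolding fin_dim_def by (metis VS.independent_span_bound)
  ultimately have "B = C" using B C assms(4) by (metis card_subset_eq)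
  then show ?thesis using B C assms(3) by auto
qed

lemma dim_zero: "VS.dim {0} = 0"
  by (rule VS.dim_unique[of "{}"]) (auto simp: VS.independent_empty)

lemma subspace_kernel:
  "VS.subspace S \<Longrightarrow> lin f \<Longrightarrow> VS.subspace {v \<in> S. f v = 0}"
  unfolding VS.subspace_def by (auto simp: linD)

text \<open>A basis B of the kernel is extended to a basis C of S; f is injective on the span of C -
  B, so the image of C - B is a basis of the image of S.\<close>

lemma rank_nullity:
  assumes S: "fin_dim S" and f: "lin f"
  shows "VS.dim S = VS.dim (f ` S) + VS.dim {v \<in> S. f v = 0}"
proof -
  have sS: "VS.subspace S" by (rule fin_dim_subspace[OF S])
  let ?N = "{v \<in> S. f v = 0}"
  have N: "VS.subspace ?N" by (rule subspace_kernel[OF sS f])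
  obtain B where B: "B \<subseteq> ?N" "VS.independent B" "VS.span B = ?N" "finite B" "card B = VS.dim ?N"
    using fin_dim_basis[OF S N] by auto
  obtain C where C: "B \<subseteq> C" "C \<subseteq> S" "VS.independent C" "S \<subseteq> VS.span C"
    using VS.maximal_independent_subset_extend[of B S] B by blast
  have fC: "finite C" using C S unfolding fin_dim_def by (metis VS.independent_span_bound)
  have cC: "card C = VS.dim S" using VS.basis_card_eq_dim C by blast
  have spC: "VS.span C = S" using C VS.span_minimal[OF C(2) sS] by auto
  let ?D = "C - B"
  have indD: "VS.independent ?D" using C(3) VS.independent_mono by blast
  have inj: "inj_on f (VS.span ?D)"
  proof -
    have "v = 0" if v: "v \<in> VS.span ?D" "f v = 0" for v
    proof -
      have "v \<in> VS.span B" using v B(3) spC VS.span_mono[of ?D C] by auto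
      moreover have "VS.span ?D \<inter> VS.span B = {0}"
      proof -
        have "VS.span (C - (B)) \<inter> VS.span B \<subseteq> {0}"
        proof
          fix u assume u: "u \<in> VS.span (C - B) \<inter> VS.span B"
          \<comment> \<open>Coordinates with respect to C are unique: the support of u lies in C - B
            and in B, hence is empty.\<close>
          have r1: "{b. VS.representation C u b \<noteq> 0} \<subseteq> C - B"
            using VS.representation_extend[OF C(3), of u "C - B"] u
              VS.representation_ne_zero[of "C - B" u] by (auto)
          have r2: "{b. VS.representation C u b \<noteq> 0} \<subseteq> B"
            using VS.representation_extend[OF C(3), of u B] u C(1)
              VS.representation_ne_zero[of B u] by (auto)
          have z: "{b. VS.representation C u b \<noteq> 0} = {}" using r1 r2 by auto
          have uC: "u \<in> VS.span C" using u VS.span_mono[OF C(1)] by auto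
          show "u \<in> {0}"
            using VS.sum_nonzero_representation_eq[OF C(3) uC] z by simp
        qed
        then show ?thesis using VS.span_zero by auto
      qed
      ultimately show ?thesis using v(1) by auto
    qed
    then show ?thesis
      using VP.linear_inj_on_iff_eq_0[OF f VS.subspace_span] by auto
  qed
  have "VS.independent (f ` ?D)" by (rule VP.linear_independent_injective_image[OF f indD inj])
  moreover have "f ` ?D \<subseteq> f ` S" using C by auto
  moreover have "f ` S \<subseteq> VS.span (f ` ?D)"
  proof -
    have "f ` S = VS.span (f ` C)" using spC VP.linear_span_image[OF f] by metis
    also have "\<dots> \<subseteq> VS.span (f ` ?D)"
    proof (rule VS.span_minimal[OF _ VS.subspace_span], rule)
      fix y assume "y \<in> f ` C"
      then obtain c where c: "c \<in> C" "y = f c" by auto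
      show "y \<in> VS.span (f ` ?D)"
        proof (cases "c \<in> B")
        case True
        then have "y = 0" using c B(1) by auto
        then show ?thesis by (simp add: VS.span_zero)
      next
        case False
        then show ?thesis using c by (auto intro!: VS.span_base)
      qed
    qed
    finally show ?thesis .
  qed
  moreover have "card (f ` ?D) = card ?D"
    using inj_on_subset[OF inj VS.span_superset] by (rule card_image)
  ultimately have "VS.dim (f ` S) = card ?D" by (metis VS.dim_unique)
  moreover have "card ?D + card B = card C"
    using fC C(1) by (metis add.commute card_Diff_subset card_mono le_add_diff_inverse rev_finite_subset)
  ultimately show ?thesis using B(5) cC by simp
qed

lemma dim_image_inj:
  assumes "fin_dim S" "lin f" "inj_on f S" shows "VS.dim (f ` S) = VS.dim S"
proof -
  have "{v \<in> S. f v = 0} = {0}"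
    using assms VS.subspace_0[OF fin_dim_subspace[OF assms(1)]] linD(3)[OF assms(2)]
    by (auto simp: inj_on_def)
  then show ?thesis using rank_nullity[OF assms(1,2)] dim_zero by simp
qed

text \<open>Projection along N: f kills a basis of N and fixes the remaining vectors of a basis of
  V. This realises the quotient of V by N inside the ambient space.\<close>

lemma exists_lin_with_kernel:
  assumes V: "VS.subspace V" and N: "VS.subspace N" "N \<subseteq> V"
  obtains f where "lin f" "{v \<in> V. f v = 0} = N"
proof -
  obtain B where B: "B \<subseteq> N" "VS.independent B" "N \<subseteq> VS.span B"
    using VS.maximal_independent_subset .
  obtain C where C: "B \<subseteq> C" "C \<subseteq> V" "VS.independent C" "V \<subseteq> VS.span C"
    using VS.maximal_independent_subset_extend[of B V] B N(2) by blast
  obtain f where f: "lin f" "\<forall>x\<in>C. f x = (if x \<in> B then 0 else x)"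
    using VP.linear_independent_extend[OF C(3), of "\<lambda>x. if x \<in> B then 0 else x"] by blast
  have spB: "VS.span B = N" using B VS.span_minimal[OF B(1) N(1)] by auto
  \<comment> \<open>Modulo N, f is the identity on C and hence on V, so a vector of V killed by f
    lies in N.\<close>
  have *: "v - f v \<in> N" if "v \<in> VS.span C" for v
  proof -
    have "VS.subspace {v. v - f v \<in> N}"
      unfolding VS.subspace_def
    proof (intro conjI ballI allI)
      show "0 \<in> {v. v - f v \<in> N}" using linD(3)[OF f(1)] VS.subspace_0[OF N(1)] by simp
      fix x y c assume x: "x \<in> {v. v - f v \<in> N}"
      have "vscale c x - vscale c (f x) = vscale c (x - f x)" by (rule VS.scale_right_diff_distrib[symmetric])
      then show "vscale c x \<in> {v. v - f v \<in> N}"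
        using x linD(2)[OF f(1)] VS.subspace_scale[OF N(1)] by auto
      assume y: "y \<in> {v. v - f v \<in> N}"
      have "x + y - f (x + y) = (x - f x) + (y - f y)" using linD(1)[OF f(1)] by (simp add: algebra_simps)
      then show "x + y \<in> {v. v - f v \<in> N}"
        using x y VS.subspace_add[OF N(1), of "x - f x" "y - f y"] by (simp only: mem_Collect_eq)
    qed
    moreover have "C \<subseteq> {v. v - f v \<in> N}"
      using f(2) B(1) VS.subspace_0[OF N(1)] by auto
    ultimately show ?thesis using VS.span_minimal that by blast
  qed
  have "f b = 0" if "b \<in> B" for b
    using f(2) C(1) that by auto
  then have "f v = 0" if "v \<in> N" for v
    using VP.linear_eq_0_on_span[OF f(1), of B v] that spB by blast
  moreover have "v \<in> N" if "v \<in> V" "f v = 0" for v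
    using *[of v] that C(4) by auto
  ultimately have "{v \<in> V. f v = 0} = N" using N(2) by auto
  then show ?thesis using that f(1) by blast
qed

text \<open>General index sets are allowed because charts use arbitrary row sets and their
  complements, and because coding pairs and direct sums of vectors scatters the indices.\<close>

definition coord :: "nat set \<Rightarrow> (nat \<Rightarrow> 'k::field) set" where
  "coord J = {u. \<forall>i. i \<notin> J \<longrightarrow> u i = 0}"

definition unitv :: "nat \<Rightarrow> nat \<Rightarrow> 'k::field" where
  "unitv j = (\<lambda>i. if i = j then 1 else 0)"

lemma subspace_coord: "VS.subspace (coord J)"
  unfolding VS.subspace_def coord_def by (auto simp: vscale_def)

lemma sum_fun_apply: "(\<Sum>x\<in>A. f x) i = (\<Sum>x\<in>A. f x i :: 'k::field)"
  by (induction A rule: infinite_finite_induct) auto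

lemma coord_expand:
  assumes "finite J" "u \<in> coord J"
  shows "u = (\<Sum>j\<in>J. vscale (u j) (unitv j))"
proof
  fix i
  have "(\<Sum>j\<in>J. vscale (u j) (unitv j)) i = (\<Sum>j\<in>J. if i = j then u j else 0)"
    unfolding sum_fun_apply by (rule sum.cong) (auto simp: vscale_def unitv_def)
  then show "u i = (\<Sum>j\<in>J. vscale (u j) (unitv j)) i"
    using assms by (auto simp: coord_def)
qed

lemma unitv_coord: "unitv j \<in> coord J \<longleftrightarrow> j \<in> J"
  unfolding unitv_def coord_def by auto

lemma span_unitv:
  assumes "finite J" shows "VS.span (unitv ` J) = coord J"
proof
  show "VS.span (unitv ` J) \<subseteq> coord J"
    by (rule VS.span_minimal[OF _ subspace_coord]) (auto simp: unitv_coord)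
  show "coord J \<subseteq> VS.span (unitv ` J)"
  proof
    fix u assume "u \<in> coord J"
    then have "u = (\<Sum>j\<in>J. vscale (u j) (unitv j))" by (rule coord_expand[OF assms])
    moreover have "(\<Sum>j\<in>J. vscale (u j) (unitv j)) \<in> VS.span (unitv ` J)"
      by (intro VS.span_sum VS.span_scale VS.span_base imageI)
    ultimately show "u \<in> VS.span (unitv ` J)" by simp
  qed
qed

lemma fin_dim_coord: "finite J \<Longrightarrow> fin_dim (coord J)"
  unfolding fin_dim_def using span_unitv by blast

lemma inj_unitv: "inj (unitv :: nat \<Rightarrow> nat \<Rightarrow> 'k::field)"
proof (rule injI)
  fix a b assume "unitv a = (unitv b :: nat \<Rightarrow> 'k)"
  then have "unitv a a = (unitv b a :: 'k)" by simp
  then show "a = b" by (simp add: unitv_def split: if_splits)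
qed

lemma dim_coord:
  assumes "finite J" shows "VS.dim (coord J :: (nat \<Rightarrow> 'k::field) set) = card J"
proof -
  have "VS.independent (unitv ` J :: (nat \<Rightarrow> 'k) set)"
  proof (rule VS.independent_if_scalars_zero)
    show "finite (unitv ` J)" using assms by simp
    fix f :: "(nat \<Rightarrow> 'k) \<Rightarrow> 'k" and x :: "nat \<Rightarrow> 'k"
    assume s: "(\<Sum>x\<in>unitv ` J. vscale (f x) x) = 0" and x: "x \<in> unitv ` J"
    obtain j where j: "j \<in> J" "x = unitv j" using x by auto
    have "(\<Sum>i\<in>J. vscale (f (unitv i)) (unitv i)) = 0"
      using s by (subst (asm) sum.reindex) (auto intro: inj_on_subset[OF inj_unitv])
    then have "(\<Sum>i\<in>J. vscale (f (unitv i)) (unitv i)) j = 0" by simp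
    then have "(\<Sum>i\<in>J. if j = i then f (unitv i) else 0) = 0"
      unfolding sum_fun_apply by (simp add: vscale_def unitv_def if_distrib cong: if_cong)
    then show "f x = 0" using j assms by simp
  qed
  moreover have "card (unitv ` J :: (nat \<Rightarrow> 'k) set) = card J"
    by (rule card_image) (auto intro: inj_on_subset[OF inj_unitv])
  ultimately show ?thesis
    by (metis VS.dim_span_eq_card_independent span_unitv[OF assms])
qed

lemma std_space_coord: "std_space n = coord {..<n}"
  unfolding std_space_def coord_def by (auto simp: not_less)

section \<open>Families of linear maps over a ring of functions\<close>

text \<open>What the rank computation needs of a chart: X will be the chart, CC its constructible
  subsets and G the quotients of Pluecker forms of equal multidegree. Inversion is not a closure
  property of G, so the elimination of variables has to avoid division by its elements.\<close>

locale function_ring = algebra X CC for X :: "'p set" and CC +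
  fixes G :: "('p \<Rightarrow> 'k::field) set"
  assumes G_const: "(\<lambda>_. c) \<in> G"
    and G_add: "g \<in> G \<Longrightarrow> h \<in> G \<Longrightarrow> (\<lambda>p. g p + h p) \<in> G"
    and G_mult: "g \<in> G \<Longrightarrow> h \<in> G \<Longrightarrow> (\<lambda>p. g p * h p) \<in> G"
    and G_zeros: "g \<in> G \<Longrightarrow> {p \<in> X. g p = 0} \<in> CC"
begin

text \<open>A linear form in v with coefficients in G, where one finite index set J serves all
  points p. Consequently \<open>gmap\<close> describes a row-finite matrix over G, with no bound on
  the number of nonzero rows.\<close>

definition gfun :: "('p \<Rightarrow> (nat \<Rightarrow> 'k) \<Rightarrow> 'k) \<Rightarrow> bool" where
  "gfun g \<longleftrightarrow> (\<exists>J m. finite J \<and> (\<forall>j. m j \<in> G) \<and> (\<forall>p\<in>X. \<forall>v. g p v = (\<Sum>j\<in>J. m j p * v j)))"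

definition gmap :: "('p \<Rightarrow> (nat \<Rightarrow> 'k) \<Rightarrow> nat \<Rightarrow> 'k) \<Rightarrow> bool" where
  "gmap f \<longleftrightarrow> (\<forall>i. gfun (\<lambda>p v. f p v i))"

lemma gfunI:
  "finite J \<Longrightarrow> (\<And>j. m j \<in> G) \<Longrightarrow> (\<And>p v. p \<in> X \<Longrightarrow> g p v = (\<Sum>j\<in>J. m j p * v j)) \<Longrightarrow> gfun g"
  unfolding gfun_def by blast

text \<open>Coefficients outside J are reset to zero, after which the sum may run over any finite
  set containing J, or over any finite set supporting v. The first form aligns two linear forms, the
  second one reads off single coefficients.\<close>

lemma gfunE:
  assumes "gfun g"
  obtains J m where "finite J" "\<And>j. m j \<in> G"
    "\<And>K p v. finite K \<Longrightarrow> J \<subseteq> K \<Longrightarrow> p \<in> X \<Longrightarrow> g p v = (\<Sum>j\<in>K. m j p * v j)"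
    "\<And>K p v. finite K \<Longrightarrow> v \<in> coord K \<Longrightarrow> p \<in> X \<Longrightarrow> g p v = (\<Sum>j\<in>K. m j p * v j)"
proof -
  obtain J m where J: "finite J" "\<And>j. m j \<in> G"
    "\<And>p v. p \<in> X \<Longrightarrow> g p v = (\<Sum>j\<in>J. m j p * v j)"
    using assms unfolding gfun_def by blast
  define m' where "m' j = (if j \<in> J then m j else (\<lambda>_. 0))" for j
  have 1: "g p v = (\<Sum>j\<in>K. m' j p * v j)" if "finite K" "J \<subseteq> K" "p \<in> X" for K p v
    unfolding J(3)[OF that(3)] using that
    by (intro sum.mono_neutral_cong_left) (auto simp: m'_def)
  have 2: "g p v = (\<Sum>j\<in>K. m' j p * v j)" if "finite K" "v \<in> coord K" "p \<in> X" for K p v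
    unfolding 1[of "J \<union> K", OF finite_UnI[OF J(1) that(1)] Un_upper1 that(3)]
    using that J(1) by (intro sum.mono_neutral_right) (auto simp: coord_def)
  have 3: "m' j \<in> G" for j using J(2) G_const by (auto simp: m'_def)
  show ?thesis using that[of J m', OF J(1) 3 1 2] by blast
qed

lemma gfun_cong: "(\<And>p v. p \<in> X \<Longrightarrow> g p v = g' p v) \<Longrightarrow> gfun g \<Longrightarrow> gfun g'"
  unfolding gfun_def by metis

lemma gfun_coord: "gfun (\<lambda>p v. v j)"
  by (rule gfunI[of "{j}" "\<lambda>_ _. 1"]) (auto simp: G_const)

lemma gfun_zero: "gfun (\<lambda>p v. 0)"
  by (rule gfunI[of "{}" "\<lambda>_ _. 1"]) (auto simp: G_const)

lemma gfun_add:
  assumes "gfun g" "gfun h" shows "gfun (\<lambda>p v. g p v + h p v)"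
proof -
  obtain J m where J: "finite J" "\<And>j. m j \<in> G"
    "\<And>K p v. finite K \<Longrightarrow> J \<subseteq> K \<Longrightarrow> p \<in> X \<Longrightarrow> g p v = (\<Sum>j\<in>K. m j p * v j)"
    using assms(1) by (elim gfunE) blast
  obtain I n where I: "finite I" "\<And>j. n j \<in> G"
    "\<And>K p v. finite K \<Longrightarrow> I \<subseteq> K \<Longrightarrow> p \<in> X \<Longrightarrow> h p v = (\<Sum>j\<in>K. n j p * v j)"
    using assms(2) by (elim gfunE) blast
  show ?thesis
  proof (rule gfunI[of "J \<union> I" "\<lambda>j p. m j p + n j p"])
    fix p v assume "p \<in> X"
    then show "g p v + h p v = (\<Sum>j\<in>J \<union> I. (m j p + n j p) * v j)"
      using J(1) I(1) J(3)[of "J \<union> I" p v] I(3)[of "J \<union> I" p v]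
      by (simp add: sum.distrib algebra_simps)
  qed (use J I G_add in auto)
qed

lemma gfun_mult:
  assumes "h \<in> G" "gfun g" shows "gfun (\<lambda>p v. h p * g p v)"
proof -
  obtain J m where J: "finite J" "\<And>j. m j \<in> G"
    "\<And>K p v. finite K \<Longrightarrow> J \<subseteq> K \<Longrightarrow> p \<in> X \<Longrightarrow> g p v = (\<Sum>j\<in>K. m j p * v j)"
    using assms(2) by (elim gfunE) blast
  show ?thesis
  proof (rule gfunI[of J "\<lambda>j p. h p * m j p"])
    fix p v assume "p \<in> X"
    then show "h p * g p v = (\<Sum>j\<in>J. h p * m j p * v j)"
      using J(3)[OF J(1) subset_refl, of p v] by (simp add: sum_distrib_left mult.assoc)
  qed (use J assms G_mult in auto)
qed

lemma gfun_scale: "gfun g \<Longrightarrow> gfun (\<lambda>p v. c * g p v)"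
  using gfun_mult[OF G_const] .

lemma gfun_diff: "gfun g \<Longrightarrow> gfun h \<Longrightarrow> gfun (\<lambda>p v. g p v - h p v)"
  using gfun_add[of g "\<lambda>p v. (-1) * h p v"] gfun_scale[of h "-1"] by simp

lemma gfun_sum: "(\<And>j. j \<in> J \<Longrightarrow> gfun (g j)) \<Longrightarrow> gfun (\<lambda>p v. \<Sum>j\<in>J. g j p v)"
  by (induction J rule: infinite_finite_induct) (auto simp: gfun_zero gfun_add)

lemma gfun_comp:
  assumes "gfun g" "gmap f" shows "gfun (\<lambda>p v. g p (f p v))"
proof -
  obtain J m where J: "finite J" "\<And>j. m j \<in> G"
    "\<And>K p v. finite K \<Longrightarrow> J \<subseteq> K \<Longrightarrow> p \<in> X \<Longrightarrow> g p v = (\<Sum>j\<in>K. m j p * v j)"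
    using assms(1) by (elim gfunE) blast
  have "gfun (\<lambda>p v. \<Sum>j\<in>J. m j p * f p v j)"
    using assms(2) J(2) by (intro gfun_sum gfun_mult) (auto simp: gmap_def)
  then show ?thesis
    by (rule gfun_cong[rotated]) (simp add: J(1) J(3)[OF J(1) subset_refl])
qed

lemma gfun_linear:
  assumes "gfun g" "p \<in> X"
  shows "g p (u + v) = g p u + g p v" "g p (vscale c u) = c * g p u"
proof -
  obtain J m where "g p v = (\<Sum>j\<in>J. m j p * v j)" for v
    using assms unfolding gfun_def by blast
  then show "g p (u + v) = g p u + g p v" "g p (vscale c u) = c * g p u"
    by (simp_all add: sum.distrib algebra_simps sum_distrib_left vscale_def)
qed

lemma gmap_lin: "gmap f \<Longrightarrow> p \<in> X \<Longrightarrow> lin (f p)"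
  unfolding lin_iff gmap_def
  by (auto simp: fun_eq_iff vscale_def gfun_linear[unfolded vscale_def, of "\<lambda>p v. f p v i" for i])

lemma gmap_id: "gmap (\<lambda>p v. v)"
  unfolding gmap_def using gfun_coord by simp

lemma gmap_comp: "gmap f \<Longrightarrow> gmap h \<Longrightarrow> gmap (\<lambda>p v. f p (h p v))"
  unfolding gmap_def[of "\<lambda>p v. f p (h p v)"]
  using gfun_comp[of "\<lambda>p v. f p v i" h for i] unfolding gmap_def by blast

lemma gmap_add: "gmap f \<Longrightarrow> gmap h \<Longrightarrow> gmap (\<lambda>p v. f p v + h p v)"
  unfolding gmap_def by (auto intro: gfun_add)

lemma gmap_sum: "(\<And>j. j \<in> J \<Longrightarrow> gmap (g j)) \<Longrightarrow> gmap (\<lambda>p v. \<Sum>j\<in>J. g j p v)"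
  unfolding gmap_def sum_fun_apply by (auto intro: gfun_sum)

section \<open>Solution spaces of linear systems over the ring, and the level sets of their
  dimension\<close>

definition zeros :: "nat set \<Rightarrow> ('p \<Rightarrow> (nat \<Rightarrow> 'k) \<Rightarrow> 'k) list \<Rightarrow> 'p \<Rightarrow> (nat \<Rightarrow> 'k) set" where
  "zeros J Es p = {w \<in> coord J. \<forall>e\<in>set Es. e p w = 0}"

lemma zeros_subspace: "p \<in> X \<Longrightarrow> \<forall>e\<in>set Es. gfun e \<Longrightarrow> VS.subspace (zeros J Es p)"
  using subspace_coord[of J] gfun_linear
  unfolding VS.subspace_def zeros_def
  by (auto simp: gfun_linear) (metis VS.scale_zero_left gfun_linear(2) mult_zero_left)

lemma zeros_fin_dim: "p \<in> X \<Longrightarrow> finite J \<Longrightarrow> \<forall>e\<in>set Es. gfun e \<Longrightarrow> fin_dim (zeros J Es p)"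
  using fin_dim_mono[OF fin_dim_coord zeros_subspace] by (auto simp: zeros_def)

text \<open>Gaussian elimination of one variable, without division so that it stays within \<open>G\<close>.\<close>

lemma dim_zeros_eliminate:
  assumes J: "finite J" "j \<in> J" and e: "gfun e"
    and c: "c \<in> G" and cj: "\<And>p. p \<in> X \<Longrightarrow> c p = e p (unitv j)" and Es: "\<forall>e\<in>set Es. gfun e"
  obtains Es' where "length Es' = length Es" "\<forall>e\<in>set Es'. gfun e"
    "\<And>p. p \<in> X \<Longrightarrow> c p \<noteq> 0 \<Longrightarrow> VS.dim (zeros J (e # Es) p) = VS.dim (zeros (J - {j}) Es' p)"
proof -
  \<comment> \<open>Up to the factor \<open>c p\<close> this is the projection onto the kernel of
    \<open>e p\<close> along \<open>unitv j\<close>: since \<open>e p (unitv j) = c p\<close>, the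
    form \<open>e p\<close> vanishes on its values. Where \<open>c p\<close> is nonzero it maps the
    vectors without j-th coordinate bijectively onto the kernel.\<close>
  define T where "T p w = vscale (c p) w + vscale (- e p w) (unitv j)" for p w
  have T: "gmap T"
    unfolding gmap_def T_def vscale_def plus_fun_def
  proof
    fix i
    have "gfun (\<lambda>p w. c p * w i + (- unitv j i) * e p w)"
      by (intro gfun_add gfun_mult[OF c] gfun_scale gfun_coord e)
    then show "gfun (\<lambda>p v. c p * v i + - e p v * unitv j i)" by (simp add: mult.commute)
  qed
  define Es' where "Es' = map (\<lambda>e p w. e p (T p w)) Es"
  have "VS.dim (zeros J (e # Es) p) = VS.dim (zeros (J - {j}) Es' p)" if p: "p \<in> X" and nz: "c p \<noteq> 0" for p
  proof -
    note lT = gmap_lin[OF T p]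
    have "T p ` zeros (J - {j}) Es' p = zeros J (e # Es) p"
    proof (intro equalityI subsetI)
      fix u assume "u \<in> T p ` zeros (J - {j}) Es' p"
      then obtain w where w: "w \<in> zeros (J - {j}) Es' p" "u = T p w" by auto
      have "e p (T p w) = 0"
        unfolding T_def gfun_linear[OF e p] using cj[OF p] by simp
      moreover have "T p w \<in> coord J"
        using w J(2) by (auto simp: T_def coord_def zeros_def vscale_def unitv_def)
      ultimately show "u \<in> zeros J (e # Es) p"
        using w by (auto simp: zeros_def Es'_def)
    next
      fix u assume u: "u \<in> zeros J (e # Es) p"
      \<comment> \<open>The inverse of \<open>T p\<close>: the j-th coordinate is removed and the
        factor \<open>c p\<close> divided out. Division happens only pointwise here, not in the
        equations that are passed on.\<close>
      define w where "w = vscale (inverse (c p)) (u + vscale (- u j) (unitv j))"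
      have eu: "e p u = 0" and uJ: "u \<in> coord J" using u by (auto simp: zeros_def)
      have "e p w = - u j"
        unfolding w_def gfun_linear[OF e p] using eu cj[OF p] nz by simp
      then have Tw: "T p w = u"
        using nz by (auto simp: T_def w_def vscale_def fun_eq_iff unitv_def field_simps)
      have "w \<in> coord (J - {j})" using uJ by (auto simp: w_def coord_def vscale_def unitv_def)
      then have "w \<in> zeros (J - {j}) Es' p"
        using u Tw by (auto simp: zeros_def Es'_def)
      then show "u \<in> T p ` zeros (J - {j}) Es' p" using Tw by auto
    qed
    moreover have "inj_on (T p) (zeros (J - {j}) Es' p)"
    proof (rule inj_onI)
      fix u v assume u: "u \<in> zeros (J - {j}) Es' p" and v: "v \<in> zeros (J - {j}) Es' p"
        and eq: "T p u = T p v"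
      show "u = v"
      proof
        fix i
        show "u i = v i"
        proof (cases "i = j")
          case True
          then show ?thesis using u v by (auto simp: zeros_def coord_def)
        next
          case False
          have "T p u i = T p v i" using eq by simp
          then show ?thesis using False nz by (simp add: T_def vscale_def unitv_def)
        qed
      qed
    qed
    moreover have "fin_dim (zeros (J - {j}) Es' p)"
      using J Es T by (intro zeros_fin_dim[OF p]) (auto simp: Es'_def intro: gfun_comp)
    ultimately show ?thesis using dim_image_inj[OF _ lT] by metis
  qed
  moreover have "length Es' = length Es" "\<forall>e\<in>set Es'. gfun e"
    using Es T by (auto simp: Es'_def intro: gfun_comp)
  ultimately show ?thesis using that by blast
qed

lemma zeros_dim_sets:
  assumes "\<forall>e\<in>set Es. gfun e" "finite J"
  shows "{p \<in> X. VS.dim (zeros J Es p) = k} \<in> CC"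
  using assms
proof (induction "length Es" arbitrary: Es J)
  case 0
  then have "VS.dim (zeros J Es p) = card J" for p
    by (simp add: zeros_def dim_coord)
  then have "{p \<in> X. VS.dim (zeros J Es p) = k} = (if card J = k then X else {})" by auto
  then show ?case by simp
next
  case (Suc n)
  then obtain e Es1 where Es: "Es = e # Es1" by (metis length_Suc_conv)
  then have e: "gfun e" and Es1: "\<forall>e\<in>set Es1. gfun e" and n: "n = length Es1"
    using Suc by auto
  obtain m where m: "\<And>j. m j \<in> G"
    "\<And>K p v. finite K \<Longrightarrow> v \<in> coord K \<Longrightarrow> p \<in> X \<Longrightarrow> e p v = (\<Sum>j\<in>K. m j p * v j)"
    using e by (elim gfunE) blast
  have mj: "m j p = e p (unitv j)" if "p \<in> X" for j p
    using m(2)[of "{j}" "unitv j" p] that by (simp add: unitv_coord) (simp add: unitv_def)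
  have "\<exists>Es'. length Es' = length Es1 \<and> (\<forall>e\<in>set Es'. gfun e) \<and> (\<forall>p\<in>X. m j p \<noteq> 0 \<longrightarrow>
     VS.dim (zeros J (e # Es1) p) = VS.dim (zeros (J - {j}) Es' p))" if "j \<in> J" for j
    using dim_zeros_eliminate[OF Suc.prems(2) that e m(1)[of j] mj Es1] by metis
  then obtain F where F: "\<And>j. j \<in> J \<Longrightarrow> length (F j) = length Es1"
    "\<And>j. j \<in> J \<Longrightarrow> \<forall>e\<in>set (F j). gfun e"
    "\<And>j p. j \<in> J \<Longrightarrow> p \<in> X \<Longrightarrow> m j p \<noteq> 0 \<Longrightarrow>
       VS.dim (zeros J (e # Es1) p) = VS.dim (zeros (J - {j}) (F j) p)"
    by metis
  have z: "zeros J (e # Es1) p = zeros J Es1 p" if "p \<in> X" "\<forall>j\<in>J. m j p = 0" for p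
    using m(2)[OF Suc.prems(2) _ that(1)] that(2) by (auto simp: zeros_def)
  \<comment> \<open>The pieces overlap where several coefficients are nonzero; this is harmless,
    since each of these eliminations computes the same dimension.\<close>
  have "{p \<in> X. VS.dim (zeros J Es p) = k} =
    (X - (\<Union>j\<in>J. X - {p \<in> X. m j p = 0})) \<inter> {p \<in> X. VS.dim (zeros J Es1 p) = k} \<union>
    (\<Union>j\<in>J. (X - {p \<in> X. m j p = 0}) \<inter> {p \<in> X. VS.dim (zeros (J - {j}) (F j) p) = k})"
    unfolding Es by (auto simp: F(3) z) (metis F(3) z)+
  also have "\<dots> \<in> CC"
  proof (intro Un Int finite_UN compl_sets ballI)
    show "{p \<in> X. VS.dim (zeros J Es1 p) = k} \<in> CC"
      using Suc.hyps(1)[OF n Es1 Suc.prems(2)] .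
    show "{p \<in> X. VS.dim (zeros (J - {j}) (F j) p) = k} \<in> CC" if "j \<in> J" for j
      using Suc.hyps(1)[of "F j" "J - {j}"] F(1,2)[OF that] n Suc.prems(2) by auto
  qed (use Suc.prems m(1) G_zeros in auto)
  finally show ?case .
qed

text \<open>Finite range is part of the notion because CC is closed only under finite unions. The
  value type is arbitrary, so that tuples of dimensions can be treated as one function.\<close>

definition simple :: "('p \<Rightarrow> 'c) \<Rightarrow> bool" where
  "simple h \<longleftrightarrow> finite (h ` X) \<and> (\<forall>k. {p \<in> X. h p = k} \<in> CC)"

lemma simple_cong: "(\<And>p. p \<in> X \<Longrightarrow> h p = h' p) \<Longrightarrow> simple h \<longleftrightarrow> simple h'"
  unfolding simple_def by (auto cong: image_cong conj_cong)

lemma simple_pred: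
  assumes "simple h" shows "{p \<in> X. P (h p)} \<in> CC"
proof -
  have "{p \<in> X. P (h p)} = (\<Union>k\<in>{k \<in> h ` X. P k}. {p \<in> X. h p = k})" by auto
  also have "\<dots> \<in> CC" using assms by (intro finite_UN) (auto simp: simple_def)
  finally show ?thesis .
qed

lemma simple_compose: "simple h \<Longrightarrow> simple (\<lambda>p. f (h p))"
  using simple_pred[of h] finite_imageI[of "h ` X" f] unfolding simple_def
  by (auto simp: image_image)

lemma simple_Pair:
  assumes "simple g" "simple h" shows "simple (\<lambda>p. (g p, h p))"
proof -
  have "(\<lambda>p. (g p, h p)) ` X \<subseteq> g ` X \<times> h ` X" by auto
  moreover have "{p \<in> X. (g p, h p) = k} = {p \<in> X. g p = fst k} \<inter> {p \<in> X. h p = snd k}" for k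
    by auto
  ultimately show ?thesis
    using assms finite_subset[of _ "g ` X \<times> h ` X"] unfolding simple_def by (auto intro: Int)
qed

lemma simple_const: "simple (\<lambda>p. c)"
proof -
  have "{p \<in> X. c = k} = (if c = k then X else {})" for k by auto
  then show ?thesis
    using finite_subset[of "(\<lambda>p. c) ` X" "{c}"] by (auto simp: simple_def)
qed

lemma simple_binop: "simple g \<Longrightarrow> simple h \<Longrightarrow> simple (\<lambda>p. f (g p) (h p))"
  using simple_compose[OF simple_Pair, of g h "\<lambda>(a, b). f a b"] by simp

text \<open>Bundles the data at all vertices into a single function of p, as needed for the
  description operator in the global rank. The fixed default c off V keeps the range finite; the
  induction adds one vertex by a function update.\<close>

lemma simple_family:
  "finite V \<Longrightarrow> (\<And>x. x \<in> V \<Longrightarrow> simple (h x)) \<Longrightarrow> simple (\<lambda>p x. if x \<in> V then h x p else c)"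
proof (induction V rule: finite_induct)
  case empty
  then show ?case by (simp add: simple_const)
next
  case (insert a V)
  have "simple (\<lambda>p. (\<lambda>x. if x \<in> V then h x p else c)(a := h a p))"
    using insert by (intro simple_binop[of "\<lambda>p x. if x \<in> V then h x p else c" _ "\<lambda>u v. u(a := v)"]) auto
  then show ?case
    by (rule simple_cong[THEN iffD1, rotated]) auto
qed

end

section \<open>Parametrised families of subspaces\<close>

definition evens :: "(nat \<Rightarrow> 'k) \<Rightarrow> nat \<Rightarrow> 'k" where "evens w = (\<lambda>i. w (2 * i))"

definition odds :: "(nat \<Rightarrow> 'k) \<Rightarrow> nat \<Rightarrow> 'k" where "odds w = (\<lambda>i. w (2 * i + 1))"

text \<open>Codes a pair of vectors as one vector, so that a linear system in two unknown vectors is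
  again of the form \<open>zeros\<close>.\<close>

definition interleave :: "(nat \<Rightarrow> 'k) \<Rightarrow> (nat \<Rightarrow> 'k) \<Rightarrow> nat \<Rightarrow> 'k" where
  "interleave u v = (\<lambda>n. if even n then u (n div 2) else v (n div 2))"

definition interleave_set :: "nat set \<Rightarrow> nat set \<Rightarrow> nat set" where
  "interleave_set I J = {n. if even n then n div 2 \<in> I else n div 2 \<in> J}"

lemma evens_interleave [simp]: "evens (interleave u v) = u"
  and odds_interleave [simp]: "odds (interleave u v) = v"
  unfolding evens_def odds_def interleave_def by auto

lemma interleave_coord:
  "u \<in> coord I \<Longrightarrow> v \<in> coord J \<Longrightarrow> interleave u v \<in> coord (interleave_set I J)"
  unfolding interleave_def coord_def interleave_set_def by auto

lemma evens_coord: "w \<in> coord (interleave_set I J) \<Longrightarrow> evens w \<in> coord I"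
  and odds_coord: "w \<in> coord (interleave_set I J) \<Longrightarrow> odds w \<in> coord J"
  unfolding evens_def odds_def coord_def interleave_set_def by auto

lemma finite_interleave_set: "finite I \<Longrightarrow> finite J \<Longrightarrow> finite (interleave_set I J)"
proof (rule finite_subset)
  show "interleave_set I J \<subseteq> (\<lambda>i. 2 * i) ` I \<union> (\<lambda>i. 2 * i + 1) ` J"
  proof
    fix n assume n: "n \<in> interleave_set I J"
    show "n \<in> (\<lambda>i. 2 * i) ` I \<union> (\<lambda>i. 2 * i + 1) ` J"
    proof (cases "even n")
      case True
      then show ?thesis using n by (auto simp: interleave_set_def intro!: image_eqI[of _ _ "n div 2"])
    next
      case False
      then have "n = 2 * (n div 2) + 1" by presburger
      moreover have "n div 2 \<in> J" using n False by (auto simp: interleave_set_def)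
      ultimately show ?thesis by blast
    qed
  qed
qed auto

context function_ring
begin

text \<open>The subspaces \<open>S p\<close> are given as images of solution spaces of linear systems over \<open>G\<close>.
  In this form, no rank has to be constant in \<open>p\<close>.\<close>

definition subspace_family :: "('p \<Rightarrow> (nat \<Rightarrow> 'k) set) \<Rightarrow> bool" where
  "subspace_family S \<longleftrightarrow> (\<exists>J K Es A. finite J \<and> finite K \<and> (\<forall>e\<in>set Es. gfun e) \<and> gmap A \<and>
     (\<forall>p\<in>X. S p = A p ` zeros J Es p \<and> S p \<subseteq> coord K))"

lemma subspace_familyI:
  assumes "finite J" "finite K" "\<forall>e\<in>set Es. gfun e" "gmap A"
    "\<And>p. p \<in> X \<Longrightarrow> S p = A p ` zeros J Es p" "\<And>p. p \<in> X \<Longrightarrow> S p \<subseteq> coord K"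
  shows "subspace_family S"
  unfolding subspace_family_def using assms
  by (intro exI[of _ J] exI[of _ K] exI[of _ Es] exI[of _ A] conjI ballI) auto

lemma subspace_familyE:
  assumes "subspace_family S"
  obtains J K Es A where "finite J" "finite K" "\<forall>e\<in>set Es. gfun e" "gmap A"
    "\<And>p. p \<in> X \<Longrightarrow> S p = A p ` zeros J Es p" "\<And>p. p \<in> X \<Longrightarrow> S p \<subseteq> coord K"
proof -
  obtain J K Es A where *: "finite J \<and> finite K \<and> (\<forall>e\<in>set Es. gfun e) \<and> gmap A \<and>
     (\<forall>p\<in>X. S p = A p ` zeros J Es p \<and> S p \<subseteq> coord K)"
    using assms unfolding subspace_family_def by (elim exE)
  show ?thesis by (rule that[of J K Es A]) (use * in auto)
qed

lemma subspace_family_cong: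
  "(\<And>p. p \<in> X \<Longrightarrow> S p = S' p) \<Longrightarrow> subspace_family S \<longleftrightarrow> subspace_family S'"
  unfolding subspace_family_def by simp

lemma subspace_family_fin_dim:
  assumes "subspace_family S" "p \<in> X" shows "fin_dim (S p)"
proof -
  obtain J K Es A where "finite J" "finite K" "\<forall>e\<in>set Es. gfun e" "gmap A"
    "\<And>p. p \<in> X \<Longrightarrow> S p = A p ` zeros J Es p"
    using assms(1) by (elim subspace_familyE) blast
  then show ?thesis using assms(2) by (simp add: fin_dim_image gmap_lin zeros_fin_dim)
qed

lemmas subspace_family_subspace = fin_dim_subspace[OF subspace_family_fin_dim]

lemma subspace_family_coord: "finite J \<Longrightarrow> subspace_family (\<lambda>p. coord J)"
  by (rule subspace_familyI[of J J "[]" "\<lambda>p v. v"]) (auto simp: gmap_id zeros_def)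

lemma subspace_family_zero: "subspace_family (\<lambda>p. {0})"
proof -
  have "coord {} = {0 :: nat \<Rightarrow> 'k}" by (auto simp: coord_def fun_eq_iff)
  then show ?thesis using subspace_family_coord[of "{}"] by simp
qed

lemma subspace_family_image:
  assumes "subspace_family S" "gmap f" "finite L" "\<And>p. p \<in> X \<Longrightarrow> f p ` S p \<subseteq> coord L"
  shows "subspace_family (\<lambda>p. f p ` S p)"
proof -
  obtain J K Es A where "finite J" "finite K" "\<forall>e\<in>set Es. gfun e" "gmap A"
    "\<And>p. p \<in> X \<Longrightarrow> S p = A p ` zeros J Es p"
    using assms(1) by (elim subspace_familyE) blast
  then show ?thesis
    using assms(2-4)
    by (intro subspace_familyI[of J L Es "\<lambda>p v. f p (A p v)"]) (auto simp: gmap_comp image_image)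
qed

section \<open>Preimages, sums and dimensions of families of subspaces\<close>

lemma gmap_evens: "gmap (\<lambda>p. evens)" and gmap_odds: "gmap (\<lambda>p. odds)"
  unfolding gmap_def evens_def odds_def using gfun_coord by auto

lemma zeros_interleave:
  assumes "w \<in> zeros (interleave_set J1 J2)
    (map (\<lambda>e p w. e p (evens w)) Es1 @ map (\<lambda>e p w. e p (odds w)) Es2 @ Es) p"
  shows "evens w \<in> zeros J1 Es1 p" "odds w \<in> zeros J2 Es2 p"
  using assms evens_coord[of w] odds_coord[of w] unfolding zeros_def by auto

lemma interleave_zeros:
  assumes "u \<in> zeros J1 Es1 p" "v \<in> zeros J2 Es2 p" "\<forall>e\<in>set Es. e p (interleave u v) = 0"
  shows "interleave u v \<in> zeros (interleave_set J1 J2)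
    (map (\<lambda>e p w. e p (evens w)) Es1 @ map (\<lambda>e p w. e p (odds w)) Es2 @ Es) p"
  using assms interleave_coord unfolding zeros_def by auto

text \<open>The new parameter space is the fibre product: pairs (a, b) of parameters of S and T with
  f(A1 a) = A2 b. Its image under A1 of the first component is the preimage. The existential
  quantifier over b is absorbed by the image in the definition of a family. Intersections are the
  case where f is the identity.\<close>

lemma subspace_family_preimage:
  assumes S: "subspace_family S" and T: "subspace_family T"
    and f: "gmap f" "finite L" "\<And>p. p \<in> X \<Longrightarrow> f p ` S p \<subseteq> coord L"
  shows "subspace_family (\<lambda>p. {v \<in> S p. f p v \<in> T p})"
proof -
  obtain J1 K1 Es1 A1 where 1: "finite J1" "finite K1" "\<forall>e\<in>set Es1. gfun e" "gmap A1"
    "\<And>p. p \<in> X \<Longrightarrow> S p = A1 p ` zeros J1 Es1 p" "\<And>p. p \<in> X \<Longrightarrow> S p \<subseteq> coord K1"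
    using S by (elim subspace_familyE) blast
  obtain J2 K2 Es2 A2 where 2: "finite J2" "finite K2" "\<forall>e\<in>set Es2. gfun e" "gmap A2"
    "\<And>p. p \<in> X \<Longrightarrow> T p = A2 p ` zeros J2 Es2 p" "\<And>p. p \<in> X \<Longrightarrow> T p \<subseteq> coord K2"
    using T by (elim subspace_familyE) blast
  \<comment> \<open>Both sides of f(A1 a) = A2 b vanish outside L \<union> K2, so this equality of
    vectors amounts to finitely many linear equations. This is the purpose of the coordinate bounds
    carried along with every family.\<close>
  define Es where "Es = map (\<lambda>i p w. f p (A1 p (evens w)) i - A2 p (odds w) i) (sorted_list_of_set (L \<union> K2))"
  have g: "gmap (\<lambda>p w. A1 p (evens w))" "gmap (\<lambda>p w. A2 p (odds w))"
    using gmap_comp[OF 1(4) gmap_evens] gmap_comp[OF 2(4) gmap_odds] .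
  have Es: "\<forall>e\<in>set Es. gfun e"
    using gmap_comp[OF f(1) g(1)] g(2) f(2) 2(2) unfolding Es_def gmap_def
    by (auto intro!: gfun_diff)
  have EsD: "(\<forall>e\<in>set Es. e p w = 0) \<longleftrightarrow> f p (A1 p (evens w)) = A2 p (odds w)"
    if p: "p \<in> X" and w: "evens w \<in> zeros J1 Es1 p" "odds w \<in> zeros J2 Es2 p" for p w
  proof -
    have "f p (A1 p (evens w)) \<in> coord L" using f(3)[OF p] 1(5)[OF p] w by auto
    moreover have "A2 p (odds w) \<in> coord K2" using 2(5,6)[OF p] w by auto
    ultimately have "f p (A1 p (evens w)) i = A2 p (odds w) i" if "i \<notin> L \<union> K2" for i
      using that by (auto simp: coord_def)
    then show ?thesis using f(2) 2(2) unfolding Es_def by (auto simp: fun_eq_iff)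
  qed
  let ?Es = "map (\<lambda>e p w. e p (evens w)) Es1 @ map (\<lambda>e p w. e p (odds w)) Es2 @ Es"
  show ?thesis
  proof (rule subspace_familyI[of "interleave_set J1 J2" K1 ?Es "\<lambda>p w. A1 p (evens w)"])
    show "\<forall>e\<in>set ?Es. gfun e"
      using 1(3) 2(3) Es gfun_comp[OF _ gmap_evens] gfun_comp[OF _ gmap_odds] by auto
    fix p assume p: "p \<in> X"
    show "{v \<in> S p. f p v \<in> T p} \<subseteq> coord K1" using 1(6)[OF p] by auto
    show "{v \<in> S p. f p v \<in> T p} = (\<lambda>w. A1 p (evens w)) ` zeros (interleave_set J1 J2) ?Es p"
    proof (intro equalityI subsetI)
      fix v assume "v \<in> {v \<in> S p. f p v \<in> T p}"
      then obtain a b where ab: "a \<in> zeros J1 Es1 p" "v = A1 p a" "b \<in> zeros J2 Es2 p" "f p v = A2 p b"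
        using 1(5)[OF p] 2(5)[OF p] by auto
      then have "interleave a b \<in> zeros (interleave_set J1 J2) ?Es p"
        using EsD[OF p, of "interleave a b"] by (intro interleave_zeros) auto
      then show "v \<in> (\<lambda>w. A1 p (evens w)) ` zeros (interleave_set J1 J2) ?Es p"
        using ab(2) by (auto intro!: image_eqI[of _ _ "interleave a b"])
    next
      fix v assume "v \<in> (\<lambda>w. A1 p (evens w)) ` zeros (interleave_set J1 J2) ?Es p"
      then obtain w where w: "w \<in> zeros (interleave_set J1 J2) ?Es p" "v = A1 p (evens w)" by auto
      note z = zeros_interleave[OF w(1)]
      have "f p (A1 p (evens w)) = A2 p (odds w)"
        using w(1) by (subst EsD[OF p z, symmetric]) (auto simp: zeros_def)
      then show "v \<in> {v \<in> S p. f p v \<in> T p}"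
        using 1(5)[OF p] 2(5)[OF p] z w(2) by auto
    qed
  qed (use 1 2 g finite_interleave_set in auto)
qed

text \<open>The parameter space is the product of the two parameter spaces, mapped by A1 on the
  first component plus A2 on the second.\<close>

lemma subspace_family_span_Un:
  assumes S: "subspace_family S" and T: "subspace_family T"
  shows "subspace_family (\<lambda>p. VS.span (S p \<union> T p))"
proof -
  obtain J1 K1 Es1 A1 where 1: "finite J1" "finite K1" "\<forall>e\<in>set Es1. gfun e" "gmap A1"
    "\<And>p. p \<in> X \<Longrightarrow> S p = A1 p ` zeros J1 Es1 p" "\<And>p. p \<in> X \<Longrightarrow> S p \<subseteq> coord K1"
    using S by (elim subspace_familyE) blast
  obtain J2 K2 Es2 A2 where 2: "finite J2" "finite K2" "\<forall>e\<in>set Es2. gfun e" "gmap A2"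
    "\<And>p. p \<in> X \<Longrightarrow> T p = A2 p ` zeros J2 Es2 p" "\<And>p. p \<in> X \<Longrightarrow> T p \<subseteq> coord K2"
    using T by (elim subspace_familyE) blast
  let ?Es = "map (\<lambda>e p w. e p (evens w)) Es1 @ map (\<lambda>e p w. e p (odds w)) Es2 @ []"
  show ?thesis
  proof (rule subspace_familyI[of "interleave_set J1 J2" "K1 \<union> K2" ?Es "\<lambda>p w. A1 p (evens w) + A2 p (odds w)"])
    show "\<forall>e\<in>set ?Es. gfun e"
      using 1(3) 2(3) gfun_comp[OF _ gmap_evens] gfun_comp[OF _ gmap_odds] by auto
    show "gmap (\<lambda>p w. A1 p (evens w) + A2 p (odds w))"
      by (intro gmap_add gmap_comp[OF 1(4) gmap_evens] gmap_comp[OF 2(4) gmap_odds])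
    fix p assume p: "p \<in> X"
    have "S p \<subseteq> coord (K1 \<union> K2)" "T p \<subseteq> coord (K1 \<union> K2)"
      using 1(6)[OF p] 2(6)[OF p] by (auto simp: coord_def)
    then show "VS.span (S p \<union> T p) \<subseteq> coord (K1 \<union> K2)"
      by (intro VS.span_minimal subspace_coord) auto
    have sp: "VS.span (S p) = S p" "VS.span (T p) = T p"
      using subspace_family_subspace[OF S p] subspace_family_subspace[OF T p] VS.span_eq_iff by blast+
    show "VS.span (S p \<union> T p) =
      (\<lambda>w. A1 p (evens w) + A2 p (odds w)) ` zeros (interleave_set J1 J2) ?Es p"
    proof (intro equalityI subsetI)
      fix v assume "v \<in> VS.span (S p \<union> T p)"
      then obtain a b where ab: "a \<in> zeros J1 Es1 p" "b \<in> zeros J2 Es2 p" "v = A1 p a + A2 p b"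
        unfolding VS.span_Un sp using 1(5)[OF p] 2(5)[OF p] by auto
      then have "interleave a b \<in> zeros (interleave_set J1 J2) ?Es p"
        by (intro interleave_zeros) auto
      then show "v \<in> (\<lambda>w. A1 p (evens w) + A2 p (odds w)) ` zeros (interleave_set J1 J2) ?Es p"
        using ab(3) by (auto intro!: image_eqI[of _ _ "interleave a b"])
    next
      fix v assume "v \<in> (\<lambda>w. A1 p (evens w) + A2 p (odds w)) ` zeros (interleave_set J1 J2) ?Es p"
      then obtain w where w: "w \<in> zeros (interleave_set J1 J2) ?Es p"
        "v = A1 p (evens w) + A2 p (odds w)" by auto
      note z = zeros_interleave[OF w(1)]
      show "v \<in> VS.span (S p \<union> T p)"
        unfolding VS.span_Un sp using 1(5)[OF p] 2(5)[OF p] z w(2) by auto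
    qed
  qed (use 1 2 finite_interleave_set in auto)
qed

lemma subspace_family_preimages:
  assumes "finite F" "subspace_family S" "\<And>a. a \<in> F \<Longrightarrow> subspace_family (T a)"
    "\<And>a. a \<in> F \<Longrightarrow> gmap (f a)" "\<And>a. a \<in> F \<Longrightarrow> finite (L a)"
    "\<And>a p. a \<in> F \<Longrightarrow> p \<in> X \<Longrightarrow> f a p ` S p \<subseteq> coord (L a)"
  shows "subspace_family (\<lambda>p. {v \<in> S p. \<forall>a\<in>F. f a p v \<in> T a p})"
  using assms
proof (induction F rule: finite_induct)
  case empty
  then show ?case by simp
next
  case (insert a F)
  have "subspace_family (\<lambda>p. {v \<in> {v \<in> S p. \<forall>a\<in>F. f a p v \<in> T a p}. f a p v \<in> T a p})"
    using insert.prems by (intro subspace_family_preimage[where L = "L a"] insert.IH) (auto simp: image_subset_iff)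
  then show ?case by (rule subspace_family_cong[THEN iffD1, rotated]) auto
qed

lemma subspace_family_span_UN:
  assumes "finite F" "\<And>a. a \<in> F \<Longrightarrow> subspace_family (T a)"
  shows "subspace_family (\<lambda>p. VS.span (\<Union>a\<in>F. T a p))"
  using assms
proof (induction F rule: finite_induct)
  case empty
  then show ?case using subspace_family_zero by simp
next
  case (insert a F)
  have "subspace_family (\<lambda>p. VS.span (T a p \<union> VS.span (\<Union>a\<in>F. T a p)))"
    using insert by (intro subspace_family_span_Un) auto
  moreover have "VS.span (T a p \<union> VS.span (\<Union>a\<in>F. T a p)) = VS.span (\<Union>a\<in>insert a F. T a p)" for p
    unfolding VS.span_Un VS.span_span by (simp add: VS.span_Un)
  ultimately show ?case by simp
qed

text \<open>Rank-nullity for \<open>A p\<close>: its kernel inside the solution space is again a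
  solution space, with the coordinates of A in K as additional equations; the other coordinates
  vanish because \<open>S p\<close> lies in \<open>coord K\<close>.\<close>

lemma simple_dim:
  assumes "subspace_family S" shows "simple (\<lambda>p. VS.dim (S p))"
proof -
  obtain J K Es A where a: "finite J" "finite K" "\<forall>e\<in>set Es. gfun e" "gmap A"
    "\<And>p. p \<in> X \<Longrightarrow> S p = A p ` zeros J Es p" "\<And>p. p \<in> X \<Longrightarrow> S p \<subseteq> coord K"
    using assms by (elim subspace_familyE) blast
  have simple_zeros: "simple (\<lambda>p. VS.dim (zeros J Es p))" if "\<forall>e\<in>set Es. gfun e" for Es
    unfolding simple_def
  proof
    have "VS.dim (zeros J Es p) \<le> card J" for p
      using dim_mono[OF fin_dim_coord[OF a(1)], of "zeros J Es p"] dim_coord[OF a(1), where 'k = 'k]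
      by (auto simp: zeros_def)
    then have "(\<lambda>p. VS.dim (zeros J Es p)) ` X \<subseteq> {..card J}" by auto
    then show "finite ((\<lambda>p. VS.dim (zeros J Es p)) ` X)" by (rule finite_subset) simp
    show "\<forall>k. {p \<in> X. VS.dim (zeros J Es p) = k} \<in> CC" using zeros_dim_sets[OF that a(1)] by simp
  qed
  define Es' where "Es' = Es @ map (\<lambda>i p w. A p w i) (sorted_list_of_set K)"
  have Es': "\<forall>e\<in>set Es'. gfun e" using a(2-4) by (auto simp: Es'_def gmap_def)
  \<comment> \<open>The subtraction of natural numbers is exact, since rank-nullity gives the
    corresponding sum.\<close>
  have "VS.dim (S p) = VS.dim (zeros J Es p) - VS.dim (zeros J Es' p)" if p: "p \<in> X" for p
  proof -
    have "{w \<in> zeros J Es p. A p w = 0} = zeros J Es' p"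
    proof -
      have "A p w i = 0" if "w \<in> zeros J Es p" "i \<notin> K" for w i
        using a(5,6)[OF p] that by (auto simp: coord_def)
      then have "A p w = 0 \<longleftrightarrow> (\<forall>i\<in>K. A p w i = 0)" if "w \<in> zeros J Es p" for w
        using that by (auto simp: fun_eq_iff)
      then have "{w \<in> zeros J Es p. A p w = 0} = {w \<in> zeros J Es p. \<forall>i\<in>K. A p w i = 0}" by auto
      also have "\<dots> = zeros J Es' p"
        using a(2) unfolding zeros_def Es'_def by auto
      finally show ?thesis .
    qed
    then show ?thesis
      using rank_nullity[OF zeros_fin_dim[OF p a(1,3)] gmap_lin[OF a(4) p]] a(5)[OF p] by simp
  qed
  then show ?thesis
    using simple_binop[OF simple_zeros[OF a(3)] simple_zeros[OF Es'], of "(-)"]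
    by (simp cong: simple_cong)
qed

end

section \<open>Isomorphisms and quotients of representations\<close>

lemma quiverD:
  assumes "quiver Q"
  shows "finite (verts Q)" "finite (arcs Q)" "a \<in> arcs Q \<Longrightarrow> tail Q a \<in> verts Q"
    "a \<in> arcs Q \<Longrightarrow> head Q a \<in> verts Q"
proof -
  interpret fin_digraph Q using assms unfolding quiver_def by blast
  show "finite (verts Q)" "finite (arcs Q)" "a \<in> arcs Q \<Longrightarrow> tail Q a \<in> verts Q"
    "a \<in> arcs Q \<Longrightarrow> head Q a \<in> verts Q" by auto
qed

lemma linear_betweenD:
  assumes "linear_between V U f"
  shows "v \<in> V \<Longrightarrow> f v \<in> U" "u \<in> V \<Longrightarrow> v \<in> V \<Longrightarrow> f (u + v) = f u + f v"
    "u \<in> V \<Longrightarrow> f (vscale c u) = vscale c (f u)"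
  using assms unfolding linear_between_def by auto

lemma linear_between_diff:
  assumes "linear_between V U f" "VS.subspace V" "u \<in> V" "v \<in> V" shows "f (u - v) = f u - f v"
proof -
  obtain g where "lin g" "\<forall>v\<in>V. g v = f v" using linear_between_extend[OF assms(2,1)] .
  then show ?thesis using assms(3,4) VS.subspace_diff[OF assms(2)] linD(4)[of g u v] by auto
qed

lemma lin_linear_between: "lin f \<Longrightarrow> f ` V \<subseteq> U \<Longrightarrow> linear_between V U f"
  unfolding linear_between_def by (auto simp: linD)

lemma lin_comp: "lin f \<Longrightarrow> lin g \<Longrightarrow> lin (\<lambda>v. f (g v))"
  by (simp add: lin_iff)

lemma representationD:
  assumes "representation Q \<phi>"
  shows "x \<in> verts Q \<Longrightarrow> fin_dim (vs_at \<phi> x)" "x \<in> verts Q \<Longrightarrow> VS.subspace (vs_at \<phi> x)"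
    "a \<in> arcs Q \<Longrightarrow> linear_between (vs_at \<phi> (tail Q a)) (vs_at \<phi> (head Q a)) (map_at \<phi> a)"
    "a \<in> arcs Q \<Longrightarrow> v \<in> vs_at \<phi> (tail Q a) \<Longrightarrow> map_at \<phi> a v \<in> vs_at \<phi> (head Q a)"
  using assms fin_dim_subspace unfolding representation_def by (auto dest: linear_betweenD)

lemma subrepD:
  assumes "subrep Q \<phi> W"
  shows "x \<in> verts Q \<Longrightarrow> VS.subspace (W x)" "x \<in> verts Q \<Longrightarrow> W x \<subseteq> vs_at \<phi> x"
    "x \<notin> verts Q \<Longrightarrow> W x = {0}"
    "a \<in> arcs Q \<Longrightarrow> v \<in> W (tail Q a) \<Longrightarrow> map_at \<phi> a v \<in> W (head Q a)"
  using assms unfolding subrep_def by blast+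

text \<open>The quotient at x is the image of a linear map with kernel \<open>W x\<close>, and an
  arrow acts by lifting along a linear section, applying the arrow map and projecting.\<close>

lemma is_quotient_exists:
  assumes Q: "quiver Q" and \<phi>: "representation Q \<phi>" and W: "subrep Q \<phi> W"
  shows "\<exists>q. is_quotient Q \<phi> W q"
proof -
  have "\<exists>f. lin f \<and> {v \<in> vs_at \<phi> x. f v = 0} = W x" if "x \<in> verts Q" for x
    using exists_lin_with_kernel[OF representationD(2)[OF \<phi> that] subrepD(1,2)[OF W that]] by metis
  then obtain \<pi> where \<pi>: "\<And>x. x \<in> verts Q \<Longrightarrow> lin (\<pi> x)"
    "\<And>x. x \<in> verts Q \<Longrightarrow> {v \<in> vs_at \<phi> x. \<pi> x v = 0} = W x" by metis
  have "\<exists>s. range s \<subseteq> vs_at \<phi> x \<and> lin s \<and> (\<forall>v\<in>\<pi> x ` vs_at \<phi> x. \<pi> x (s v) = v)" if "x \<in> verts Q" for x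
    using VP.linear_exists_right_inverse_on[OF \<pi>(1) representationD(2)[OF \<phi>]] that by blast
  then obtain s where s: "\<And>x v. x \<in> verts Q \<Longrightarrow> s x v \<in> vs_at \<phi> x" "\<And>x. x \<in> verts Q \<Longrightarrow> lin (s x)"
    "\<And>x v. x \<in> verts Q \<Longrightarrow> v \<in> vs_at \<phi> x \<Longrightarrow> \<pi> x (s x (\<pi> x v)) = \<pi> x v"
    unfolding image_subset_iff by (metis UNIV_I image_eqI)
  define \<psi> where "\<psi> = \<lparr>vs_at = (\<lambda>x. \<pi> x ` vs_at \<phi> x),
    map_at = (\<lambda>a v. \<pi> (head Q a) (map_at \<phi> a (s (tail Q a) v)))\<rparr>"
  have "representation Q \<psi>"
    unfolding representation_def
  proof (intro conjI ballI)
    show "fin_dim (vs_at \<psi> x)" if "x \<in> verts Q" for x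
      using that \<pi>(1) representationD(1)[OF \<phi>] by (simp add: \<psi>_def fin_dim_image)
    fix a assume a: "a \<in> arcs Q"
    note t = quiverD(3)[OF Q a] and h = quiverD(4)[OF Q a]
    note l = linear_betweenD[OF representationD(3)[OF \<phi> a]]
    show "linear_between (vs_at \<psi> (tail Q a)) (vs_at \<psi> (head Q a)) (map_at \<psi> a)"
      unfolding linear_between_def \<psi>_def
      using s(1)[OF t] linD[OF s(2)[OF t]] l linD[OF \<pi>(1)[OF h]] by auto
  qed
  moreover have "\<pi> (head Q a) (map_at \<phi> a v) = map_at \<psi> a (\<pi> (tail Q a) v)"
    if a: "a \<in> arcs Q" and v: "v \<in> vs_at \<phi> (tail Q a)" for a v
  proof -
    note t = quiverD(3)[OF Q a] and h = quiverD(4)[OF Q a]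
    let ?u = "s (tail Q a) (\<pi> (tail Q a) v)"
    have u: "?u \<in> vs_at \<phi> (tail Q a)" by (rule s(1)[OF t])
    \<comment> \<open>The vector v and the lift of its class differ by an element of W, which the
      arrow carries into W; hence the choice of lift disappears after projection.\<close>
    have "\<pi> (tail Q a) (v - ?u) = 0"
      using linD(4)[OF \<pi>(1)[OF t]] s(3)[OF t v] by simp
    moreover have "v - ?u \<in> vs_at \<phi> (tail Q a)"
      using VS.subspace_diff[OF representationD(2)[OF \<phi> t]] u v by simp
    ultimately have "v - ?u \<in> W (tail Q a)" using \<pi>(2)[OF t] by blast
    then have "map_at \<phi> a (v - ?u) \<in> W (head Q a)" by (rule subrepD(4)[OF W a])
    then have "\<pi> (head Q a) (map_at \<phi> a (v - ?u)) = 0" using \<pi>(2)[OF h] by blast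
    then show ?thesis
      using linear_between_diff[OF representationD(3)[OF \<phi> a] representationD(2)[OF \<phi> t] v u]
        linD(4)[OF \<pi>(1)[OF h]] by (simp add: \<psi>_def)
  qed
  ultimately have "is_quotient Q \<phi> W (\<psi>, \<pi>)"
    unfolding is_quotient_def using \<pi> by (auto simp: \<psi>_def intro: lin_linear_between)
  then show ?thesis ..
qed

lemma is_quotient_quotient_rep:
  assumes "quiver Q" "representation Q \<phi>" "subrep Q \<phi> W"
  shows "is_quotient Q \<phi> W (quotient_rep Q \<phi> W, quotient_proj Q \<phi> W)"
  using someI_ex[OF is_quotient_exists[OF assms]] by (simp add: quotient_rep_def quotient_proj_def)

lemma is_quotientD:
  assumes "is_quotient Q \<phi> W (\<psi>, \<pi>)"
  shows "representation Q \<psi>"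
    "x \<in> verts Q \<Longrightarrow> linear_between (vs_at \<phi> x) (vs_at \<psi> x) (\<pi> x)"
    "x \<in> verts Q \<Longrightarrow> \<pi> x ` vs_at \<phi> x = vs_at \<psi> x"
    "x \<in> verts Q \<Longrightarrow> {v \<in> vs_at \<phi> x. \<pi> x v = 0} = W x"
    "a \<in> arcs Q \<Longrightarrow> v \<in> vs_at \<phi> (tail Q a) \<Longrightarrow>
       \<pi> (head Q a) (map_at \<phi> a v) = map_at \<psi> a (\<pi> (tail Q a) v)"
  using assms unfolding is_quotient_def by auto

text \<open>The inverse is carried along as a second globally linear map, so that subspaces can be
  moved in both directions. Compatibility with the arrows is demanded of \<theta> only; for
  \<theta>' it is deduced in \<open>iso_pair_sym\<close>.\<close>

definition iso_pair ::
  "('v,'e) pre_digraph \<Rightarrow> ('v,'e,'k::field) qrep \<Rightarrow> ('v,'e,'k) qrep \<Rightarrow>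
   ('v \<Rightarrow> (nat \<Rightarrow> 'k) \<Rightarrow> nat \<Rightarrow> 'k) \<Rightarrow> ('v \<Rightarrow> (nat \<Rightarrow> 'k) \<Rightarrow> nat \<Rightarrow> 'k) \<Rightarrow> bool" where
  "iso_pair Q \<psi> \<phi> \<theta> \<theta>' \<longleftrightarrow>
     (\<forall>x\<in>verts Q. lin (\<theta> x) \<and> lin (\<theta>' x) \<and>
        (\<forall>v\<in>vs_at \<psi> x. \<theta> x v \<in> vs_at \<phi> x \<and> \<theta>' x (\<theta> x v) = v) \<and>
        (\<forall>v\<in>vs_at \<phi> x. \<theta>' x v \<in> vs_at \<psi> x \<and> \<theta> x (\<theta>' x v) = v)) \<and>
     (\<forall>a\<in>arcs Q. \<forall>v\<in>vs_at \<psi> (tail Q a). \<theta> (head Q a) (map_at \<psi> a v) = map_at \<phi> a (\<theta> (tail Q a) v))"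

definition rep_iso :: "('v,'e) pre_digraph \<Rightarrow> ('v,'e,'k::field) qrep \<Rightarrow> ('v,'e,'k) qrep \<Rightarrow> bool" where
  "rep_iso Q \<psi> \<phi> \<longleftrightarrow> (\<exists>\<theta> \<theta>'. iso_pair Q \<psi> \<phi> \<theta> \<theta>')"

lemma iso_pairD:
  assumes "iso_pair Q \<psi> \<phi> \<theta> \<theta>'"
  shows "x \<in> verts Q \<Longrightarrow> lin (\<theta> x)" "x \<in> verts Q \<Longrightarrow> lin (\<theta>' x)"
    "x \<in> verts Q \<Longrightarrow> v \<in> vs_at \<psi> x \<Longrightarrow> \<theta> x v \<in> vs_at \<phi> x"
    "x \<in> verts Q \<Longrightarrow> v \<in> vs_at \<psi> x \<Longrightarrow> \<theta>' x (\<theta> x v) = v"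
    "x \<in> verts Q \<Longrightarrow> v \<in> vs_at \<phi> x \<Longrightarrow> \<theta>' x v \<in> vs_at \<psi> x"
    "x \<in> verts Q \<Longrightarrow> v \<in> vs_at \<phi> x \<Longrightarrow> \<theta> x (\<theta>' x v) = v"
    "a \<in> arcs Q \<Longrightarrow> v \<in> vs_at \<psi> (tail Q a) \<Longrightarrow>
       \<theta> (head Q a) (map_at \<psi> a v) = map_at \<phi> a (\<theta> (tail Q a) v)"
  using assms unfolding iso_pair_def by auto

lemma iso_pair_sym:
  assumes Q: "quiver Q" and \<psi>: "representation Q \<psi>" and i: "iso_pair Q \<psi> \<phi> \<theta> \<theta>'"
  shows "iso_pair Q \<phi> \<psi> \<theta>' \<theta>"
proof -
  have "\<theta>' (head Q a) (map_at \<phi> a v) = map_at \<psi> a (\<theta>' (tail Q a) v)"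
    if a: "a \<in> arcs Q" and v: "v \<in> vs_at \<phi> (tail Q a)" for a v
  proof -
    let ?u = "\<theta>' (tail Q a) v"
    have u: "?u \<in> vs_at \<psi> (tail Q a)" "\<theta> (tail Q a) ?u = v"
      using iso_pairD(5,6)[OF i quiverD(3)[OF Q a] v] by auto
    have "\<theta> (head Q a) (map_at \<psi> a ?u) = map_at \<phi> a v" using iso_pairD(7)[OF i a u(1)] u(2) by simp
    then show ?thesis
      using iso_pairD(4)[OF i quiverD(4)[OF Q a] representationD(4)[OF \<psi> a u(1)]] by simp
  qed
  then show ?thesis using i unfolding iso_pair_def by auto
qed

text \<open>Since \<theta> x maps onto \<open>vs_at \<phi> x\<close>, finite dimension and linearity
  pass from \<psi> to \<phi>; a comparison with a coordinate model thus makes the other side a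
  representation.\<close>

lemma iso_pair_representation:
  assumes Q: "quiver Q" and \<psi>: "representation Q \<psi>" and i: "iso_pair Q \<psi> \<phi> \<theta> \<theta>'"
  shows "representation Q \<phi>"
  unfolding representation_def
proof (intro conjI ballI)
  have V: "vs_at \<phi> x = \<theta> x ` vs_at \<psi> x" if "x \<in> verts Q" for x
    using iso_pairD(3,5,6)[OF i that] by (auto simp: image_iff) metis
  show "fin_dim (vs_at \<phi> x)" if "x \<in> verts Q" for x
    using V[OF that] fin_dim_image[OF representationD(1)[OF \<psi> that] iso_pairD(1)[OF i that]] by simp
  fix a assume a: "a \<in> arcs Q"
  note t = quiverD(3)[OF Q a] and h = quiverD(4)[OF Q a]
  note l = linear_betweenD[OF representationD(3)[OF \<psi> a]]
  have c: "map_at \<phi> a (\<theta> (tail Q a) v) = \<theta> (head Q a) (map_at \<psi> a v)" if "v \<in> vs_at \<psi> (tail Q a)" for v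
    using iso_pairD(7)[OF i a that] by simp
  note s = VS.subspace_add[OF representationD(2)[OF \<psi> t]] VS.subspace_scale[OF representationD(2)[OF \<psi> t]]
  show "linear_between (vs_at \<phi> (tail Q a)) (vs_at \<phi> (head Q a)) (map_at \<phi> a)"
    unfolding linear_between_def V[OF t] V[OF h]
    using c l s by (auto simp: linD[OF iso_pairD(1)[OF i t], symmetric] linD[OF iso_pairD(1)[OF i h]])
qed

text \<open>Both projections have kernel W, so each factors through the other; the factor is one
  projection composed with a linear section of the other. This connects an explicit quotient with
  the one selected by the choice operator.\<close>

lemma rep_iso_quotients:
  assumes Q: "quiver Q" and \<phi>: "representation Q \<phi>"
    and q: "is_quotient Q \<phi> W (\<psi>, \<pi>)" and q': "is_quotient Q \<phi> W (\<psi>', \<pi>')"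
  shows "rep_iso Q \<psi> \<psi>'"
proof -
  have "\<exists>\<theta> \<theta>'. lin \<theta> \<and> lin \<theta>' \<and> (\<forall>v\<in>vs_at \<phi> x. \<theta> (\<pi> x v) = \<pi>' x v) \<and> (\<forall>v\<in>vs_at \<phi> x. \<theta>' (\<pi>' x v) = \<pi> x v)"
    if x: "x \<in> verts Q" for x
  proof -
    have *: "\<exists>\<theta>. lin \<theta> \<and> (\<forall>v\<in>vs_at \<phi> x. \<theta> (\<pi> x v) = \<pi>' x v)"
      if q: "is_quotient Q \<phi> W (\<psi>, \<pi>)" and q': "is_quotient Q \<phi> W (\<psi>', \<pi>')" for \<psi> \<pi> \<psi>' \<pi>'
    proof -
      note V = representationD(2)[OF \<phi> x]
      obtain f where f: "lin f" "\<forall>v\<in>vs_at \<phi> x. f v = \<pi> x v"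
        using linear_between_extend[OF V is_quotientD(2)[OF q x]] .
      obtain f' where f': "lin f'" "\<forall>v\<in>vs_at \<phi> x. f' v = \<pi>' x v"
        using linear_between_extend[OF V is_quotientD(2)[OF q' x]] .
      obtain s where s: "range s \<subseteq> vs_at \<phi> x" "lin s" "\<forall>v\<in>f ` vs_at \<phi> x. f (s v) = v"
        using VP.linear_exists_right_inverse_on[OF f(1) V] by blast
      have "f' (s (\<pi> x v)) = \<pi>' x v" if v: "v \<in> vs_at \<phi> x" for v
      proof -
        have sv: "s (\<pi> x v) \<in> vs_at \<phi> x" using s(1) by auto
        have "f (s (\<pi> x v)) = \<pi> x v" using s(3) f(2) v by (metis imageI)
        then have "f (v - s (\<pi> x v)) = 0" using linD(4)[OF f(1)] f(2) v by simp
        moreover have m: "v - s (\<pi> x v) \<in> vs_at \<phi> x" using VS.subspace_diff[OF V v sv] .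
        ultimately have "v - s (\<pi> x v) \<in> W x" using is_quotientD(4)[OF q x] f(2) by auto
        then have "\<pi>' x (v - s (\<pi> x v)) = 0" using is_quotientD(4)[OF q' x] by auto
        then show ?thesis using f'(2) m linD(4)[OF f'(1), of v "s (\<pi> x v)"] v by auto
      qed
      then show ?thesis using lin_comp[OF f'(1) s(2)] by blast
    qed
    show ?thesis using *[OF q q'] *[OF q' q] by blast
  qed
  then obtain \<theta> \<theta>' where t: "\<And>x. x \<in> verts Q \<Longrightarrow> lin (\<theta> x) \<and> lin (\<theta>' x) \<and>
    (\<forall>v\<in>vs_at \<phi> x. \<theta> x (\<pi> x v) = \<pi>' x v) \<and> (\<forall>v\<in>vs_at \<phi> x. \<theta>' x (\<pi>' x v) = \<pi> x v)"
    by metis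
  have "iso_pair Q \<psi> \<psi>' \<theta> \<theta>'"
    unfolding iso_pair_def
  proof (rule conjI; rule ballI)
    fix x assume x: "x \<in> verts Q"
    show "lin (\<theta> x) \<and> lin (\<theta>' x) \<and> (\<forall>v\<in>vs_at \<psi> x. \<theta> x v \<in> vs_at \<psi>' x \<and> \<theta>' x (\<theta> x v) = v) \<and>
        (\<forall>v\<in>vs_at \<psi>' x. \<theta>' x v \<in> vs_at \<psi> x \<and> \<theta> x (\<theta>' x v) = v)"
      using t[OF x] unfolding is_quotientD(3)[OF q x, symmetric] is_quotientD(3)[OF q' x, symmetric]
      by auto
  next
    fix a assume a: "a \<in> arcs Q"
    note ta = quiverD(3)[OF Q a] and h = quiverD(4)[OF Q a]
    have "\<theta> (head Q a) (map_at \<psi> a (\<pi> (tail Q a) v)) = map_at \<psi>' a (\<theta> (tail Q a) (\<pi> (tail Q a) v))"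
      if v: "v \<in> vs_at \<phi> (tail Q a)" for v
      using t[OF ta] t[OF h] v representationD(4)[OF \<phi> a v]
      by (simp add: is_quotientD(5)[OF q a v, symmetric] is_quotientD(5)[OF q' a v, symmetric])
    then show "\<forall>v\<in>vs_at \<psi> (tail Q a). \<theta> (head Q a) (map_at \<psi> a v) = map_at \<psi>' a (\<theta> (tail Q a) v)"
      unfolding is_quotientD(3)[OF q ta, symmetric] by auto
  qed
  then show ?thesis unfolding rep_iso_def by blast
qed

section \<open>The global rank\<close>

definition epi_sub :: "('v,'e) pre_digraph \<Rightarrow> ('v,'e,'k::field) qrep \<Rightarrow> ('v \<Rightarrow> (nat \<Rightarrow> 'k) set) \<Rightarrow> bool" where
  "epi_sub Q \<phi> W \<longleftrightarrow> subrep Q \<phi> W \<and> (\<forall>a\<in>arcs Q. map_at \<phi> a ` W (tail Q a) = W (head Q a))"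

text \<open>Injectivity of the arrow maps on the quotient by N, rephrased without the quotient:
  preimages of N along arrows lie in N.\<close>

definition mono_sub :: "('v,'e) pre_digraph \<Rightarrow> ('v,'e,'k::field) qrep \<Rightarrow> ('v \<Rightarrow> (nat \<Rightarrow> 'k) set) \<Rightarrow> bool" where
  "mono_sub Q \<phi> N \<longleftrightarrow> subrep Q \<phi> N \<and>
     (\<forall>a\<in>arcs Q. \<forall>v\<in>vs_at \<phi> (tail Q a). map_at \<phi> a v \<in> N (head Q a) \<longrightarrow> v \<in> N (tail Q a))"

text \<open>An arrow map of the quotient is injective iff its kernel is zero, and a class is zero
  iff its representative lies in N.\<close>

lemma mono_sub_iff:
  assumes Q: "quiver Q" and \<phi>: "representation Q \<phi>"
  shows "(subrep Q \<phi> N \<and> (\<forall>a\<in>arcs Q. inj_on (map_at (quotient_rep Q \<phi> N) a)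
    (vs_at (quotient_rep Q \<phi> N) (tail Q a)))) \<longleftrightarrow> mono_sub Q \<phi> N"
proof -
  have "inj_on (map_at (quotient_rep Q \<phi> N) a) (vs_at (quotient_rep Q \<phi> N) (tail Q a)) \<longleftrightarrow>
    (\<forall>v\<in>vs_at \<phi> (tail Q a). map_at \<phi> a v \<in> N (head Q a) \<longrightarrow> v \<in> N (tail Q a))"
    if N: "subrep Q \<phi> N" and a: "a \<in> arcs Q" for a
  proof -
    note t = quiverD(3)[OF Q a] and h = quiverD(4)[OF Q a]
    define \<psi> \<pi> where "\<psi> = quotient_rep Q \<phi> N" and "\<pi> = quotient_proj Q \<phi> N"
    have q: "is_quotient Q \<phi> N (\<psi>, \<pi>)"
      unfolding \<psi>_def \<pi>_def by (rule is_quotient_quotient_rep[OF Q \<phi> N])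
    obtain g where g: "lin g" "\<forall>v\<in>vs_at \<psi> (tail Q a). g v = map_at \<psi> a v"
      using linear_between_extend[OF representationD(2)[OF is_quotientD(1)[OF q] t] representationD(3)[OF is_quotientD(1)[OF q] a]] .
    have inN: "\<pi> x v = 0 \<longleftrightarrow> v \<in> N x" if "x \<in> verts Q" "v \<in> vs_at \<phi> x" for x v
      using is_quotientD(4)[OF q that(1)] that(2) by auto
    have "inj_on (map_at \<psi> a) (vs_at \<psi> (tail Q a)) \<longleftrightarrow> inj_on g (vs_at \<psi> (tail Q a))"
      using g(2) by (auto simp: inj_on_def)
    also have "\<dots> \<longleftrightarrow> (\<forall>v\<in>vs_at \<psi> (tail Q a). g v = 0 \<longrightarrow> v = 0)"
      by (rule VP.linear_inj_on_iff_eq_0[OF g(1) representationD(2)[OF is_quotientD(1)[OF q] t]])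
    also have "\<dots> \<longleftrightarrow> (\<forall>v\<in>vs_at \<phi> (tail Q a). map_at \<psi> a (\<pi> (tail Q a) v) = 0 \<longrightarrow> \<pi> (tail Q a) v = 0)"
      using g(2) unfolding is_quotientD(3)[OF q t, symmetric] by auto
    also have "\<dots> \<longleftrightarrow> (\<forall>v\<in>vs_at \<phi> (tail Q a). map_at \<phi> a v \<in> N (head Q a) \<longrightarrow> v \<in> N (tail Q a))"
      using is_quotientD(5)[OF q a] inN[OF t] inN[OF h representationD(4)[OF \<phi> a]] by metis
    finally show ?thesis unfolding \<psi>_def .
  qed
  then show ?thesis unfolding mono_sub_def by blast
qed

text \<open>Approximates the largest family from above: a vector survives a step if outgoing arrows
  keep it in the family and it has a preimage in the family along each incoming arrow. The two
  nested set comprehensions have the shape of \<open>subspace_family_preimages\<close>.\<close>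

definition epi_iter ::
  "('v,'e) pre_digraph \<Rightarrow> ('v,'e,'k::field) qrep \<Rightarrow> nat \<Rightarrow> 'v \<Rightarrow> (nat \<Rightarrow> 'k) set" where
  "epi_iter Q \<phi> n = ((\<lambda>W x. {v \<in> {v \<in> W x. \<forall>a\<in>{a \<in> arcs Q. tail Q a = x}. map_at \<phi> a v \<in> W (head Q a)}.
       \<forall>a\<in>{a \<in> arcs Q. head Q a = x}. v \<in> map_at \<phi> a ` W (tail Q a)}) ^^ n)
     (\<lambda>x. if x \<in> verts Q then vs_at \<phi> x else {0})"

text \<open>Approximates the least kernel from below: each step adds preimages along outgoing arrows
  and images along incoming ones. The nested spans have the shape of the closure rules for sums of
  families.\<close>

definition mono_iter ::
  "('v,'e) pre_digraph \<Rightarrow> ('v,'e,'k::field) qrep \<Rightarrow> nat \<Rightarrow> 'v \<Rightarrow> (nat \<Rightarrow> 'k) set" where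
  "mono_iter Q \<phi> n = ((\<lambda>N x. VS.span (N x \<union> VS.span
       (VS.span (\<Union>a\<in>{a \<in> arcs Q. tail Q a = x}. {v \<in> vs_at \<phi> x. map_at \<phi> a v \<in> N (head Q a)}) \<union>
        VS.span (\<Union>a\<in>{a \<in> arcs Q. head Q a = x}. map_at \<phi> a ` N (tail Q a))))) ^^ n) (\<lambda>x. {0})"

lemma epi_iter_0: "epi_iter Q \<phi> 0 x = (if x \<in> verts Q then vs_at \<phi> x else {0})"
  by (simp add: epi_iter_def)

lemma epi_iter_Suc: "epi_iter Q \<phi> (Suc n) x =
  {v \<in> {v \<in> epi_iter Q \<phi> n x. \<forall>a\<in>{a \<in> arcs Q. tail Q a = x}. map_at \<phi> a v \<in> epi_iter Q \<phi> n (head Q a)}.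
       \<forall>a\<in>{a \<in> arcs Q. head Q a = x}. v \<in> map_at \<phi> a ` epi_iter Q \<phi> n (tail Q a)}"
  by (simp add: epi_iter_def)

lemma mono_iter_0: "mono_iter Q \<phi> 0 x = {0}"
  by (simp add: mono_iter_def)

lemma mono_iter_Suc: "mono_iter Q \<phi> (Suc n) x = VS.span (mono_iter Q \<phi> n x \<union> VS.span
       (VS.span (\<Union>a\<in>{a \<in> arcs Q. tail Q a = x}. {v \<in> vs_at \<phi> x. map_at \<phi> a v \<in> mono_iter Q \<phi> n (head Q a)}) \<union>
        VS.span (\<Union>a\<in>{a \<in> arcs Q. head Q a = x}. map_at \<phi> a ` mono_iter Q \<phi> n (tail Q a))))"
  by (simp add: mono_iter_def)

text \<open>A sequence of natural numbers can drop strictly at most \<open>d 0\<close> times. The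
  bound depends only on the initial value, which for the iterations is controlled by the total
  dimension and hence uniform over a family.\<close>

lemma stationary_step:
  fixes d :: "nat \<Rightarrow> nat"
  assumes "\<And>n. d (Suc n) \<le> d n" shows "\<exists>n\<le>d 0. d (Suc n) = d n"
proof (rule ccontr)
  assume "\<not> ?thesis"
  then have less: "d (Suc n) < d n" if "n \<le> d 0" for n using assms[of n] that by (auto simp: less_le)
  have "n \<le> Suc (d 0) \<Longrightarrow> d n + n \<le> d 0" for n
  proof (induction n)
    case (Suc n)
    then show ?case using less[of n] by simp
  qed simp
  from this[of "Suc (d 0)"] show False by simp
qed

lemma funpow_fixed:
  fixes F :: "'a \<Rightarrow> 'a"
  assumes "(F ^^ Suc n) a = (F ^^ n) a" "n \<le> m" shows "(F ^^ Suc m) a = (F ^^ m) a"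
  using assms(2)
proof (induction m rule: dec_induct)
  case (step m)
  from arg_cong[OF this(3), of F] show ?case by simp
qed (use assms(1) in simp)

lemma representation_lin:
  assumes Q: "quiver Q" and \<phi>: "representation Q \<phi>"
  obtains g where "\<And>a. a \<in> arcs Q \<Longrightarrow> lin (g a)"
    "\<And>a v. a \<in> arcs Q \<Longrightarrow> v \<in> vs_at \<phi> (tail Q a) \<Longrightarrow> map_at \<phi> a v = g a v"
proof -
  have "\<exists>g. lin g \<and> (\<forall>v\<in>vs_at \<phi> (tail Q a). map_at \<phi> a v = g v)" if "a \<in> arcs Q" for a
    using linear_between_extend[OF representationD(2)[OF \<phi> quiverD(3)[OF Q that]] representationD(3)[OF \<phi> that]]
    by metis
  then show ?thesis using that by metis
qed

section \<open>The iteration from above and the largest subrepresentation with surjective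
  maps\<close>

lemma epi_iter_Suc_iff:
  "v \<in> epi_iter Q \<phi> (Suc n) x \<longleftrightarrow> v \<in> epi_iter Q \<phi> n x \<and>
    (\<forall>a\<in>arcs Q. tail Q a = x \<longrightarrow> map_at \<phi> a v \<in> epi_iter Q \<phi> n (head Q a)) \<and>
    (\<forall>a\<in>arcs Q. head Q a = x \<longrightarrow> v \<in> map_at \<phi> a ` epi_iter Q \<phi> n (tail Q a))"
  unfolding epi_iter_Suc by auto

lemma epi_iter_off:
  assumes "quiver Q" "x \<notin> verts Q" shows "epi_iter Q \<phi> n x = {0}"
  by (induction n) (use assms quiverD(3,4)[OF assms(1)] in \<open>auto simp: epi_iter_0 epi_iter_Suc\<close>)

lemma epi_iter_antimono: "epi_iter Q \<phi> (Suc n) x \<subseteq> epi_iter Q \<phi> n x"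
  by (auto simp: epi_iter_Suc)

lemma epi_iter_subset: "x \<in> verts Q \<Longrightarrow> epi_iter Q \<phi> n x \<subseteq> vs_at \<phi> x"
  by (induction n) (auto simp: epi_iter_0 epi_iter_Suc_iff)

lemma epi_iter_subspace:
  assumes Q: "quiver Q" and \<phi>: "representation Q \<phi>"
  shows "x \<in> verts Q \<Longrightarrow> VS.subspace (epi_iter Q \<phi> n x)"
proof (induction n arbitrary: x)
  case 0
  then show ?case using representationD(2)[OF \<phi>] by (simp add: epi_iter_0)
next
  case (Suc n)
  obtain g where g: "\<And>a. a \<in> arcs Q \<Longrightarrow> lin (g a)"
    "\<And>a v. a \<in> arcs Q \<Longrightarrow> v \<in> vs_at \<phi> (tail Q a) \<Longrightarrow> map_at \<phi> a v = g a v"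
    using representation_lin[OF Q \<phi>] by blast
  let ?E = "epi_iter Q \<phi> n"
  have 1: "map_at \<phi> a ` ?E (tail Q a) = g a ` ?E (tail Q a)" if "a \<in> arcs Q" for a
    using g(2)[OF that] epi_iter_subset[OF quiverD(3)[OF Q that]] by (intro image_cong) auto
  have 2: "map_at \<phi> a v = g a v" if "a \<in> arcs Q" "v \<in> ?E (tail Q a)" for a v
    using g(2)[OF that(1)] epi_iter_subset[OF quiverD(3)[OF Q that(1)]] that(2) by blast
  \<comment> \<open>With the globally linear maps g in place of the arrow maps, the step is an
    intersection of images and preimages of subspaces.\<close>
  have "epi_iter Q \<phi> (Suc n) x = ?E x \<inter>
    (\<Inter>a\<in>{a \<in> arcs Q. tail Q a = x}. {v. g a v \<in> ?E (head Q a)}) \<inter>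
    (\<Inter>a\<in>{a \<in> arcs Q. head Q a = x}. g a ` ?E (tail Q a))"
    by (auto simp: epi_iter_Suc_iff 1 2)
  moreover have "VS.subspace {v. g a v \<in> ?E (head Q a)}" if "a \<in> arcs Q" for a
    using VP.linear_subspace_vimage[OF g(1)[OF that] Suc.IH[OF quiverD(4)[OF Q that]]]
    by (simp add: vimage_def)
  moreover have "VS.subspace (g a ` ?E (tail Q a))" if "a \<in> arcs Q" for a
    by (rule VP.linear_subspace_image[OF g(1)[OF that] Suc.IH[OF quiverD(3)[OF Q that]]])
  ultimately show ?case
    using Suc.IH[OF Suc.prems] by (auto intro!: VS.subspace_inter VS.subspace_Inter)
qed

lemma epi_iter_stationary:
  assumes Q: "quiver Q" and \<phi>: "representation Q \<phi>"
    and m: "(\<Sum>x\<in>verts Q. VS.dim (vs_at \<phi> x)) \<le> m"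
  shows "epi_iter Q \<phi> (Suc m) = epi_iter Q \<phi> m"
proof -
  define d where "d n = (\<Sum>x\<in>verts Q. VS.dim (epi_iter Q \<phi> n x))" for n
  have fd: "fin_dim (epi_iter Q \<phi> n x)" if "x \<in> verts Q" for n x
    using fin_dim_mono[OF representationD(1)[OF \<phi> that] epi_iter_subspace[OF Q \<phi> that] epi_iter_subset[OF that]] .
  have le: "VS.dim (epi_iter Q \<phi> (Suc n) x) \<le> VS.dim (epi_iter Q \<phi> n x)" if "x \<in> verts Q" for n x
    using dim_mono[OF fd[OF that] epi_iter_antimono] .
  have "d (Suc n) \<le> d n" for n unfolding d_def by (rule sum_mono) (rule le)
  then obtain n where n: "n \<le> d 0" "d (Suc n) = d n" using stationary_step[of d] by blast
  have "VS.dim (epi_iter Q \<phi> (Suc n) x) = VS.dim (epi_iter Q \<phi> n x)" if "x \<in> verts Q" for x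
  proof (rule ccontr)
    assume "\<not> ?thesis"
    then have "VS.dim (epi_iter Q \<phi> (Suc n) x) < VS.dim (epi_iter Q \<phi> n x)" using le[OF that, of n] by simp
    then have "d (Suc n) < d n"
      unfolding d_def using le that quiverD(1)[OF Q] by (intro sum_strict_mono_ex1) auto
    then show False using n(2) by simp
  qed
  note dim_eq = this
  have "epi_iter Q \<phi> (Suc n) x = epi_iter Q \<phi> n x" for x
  proof (cases "x \<in> verts Q")
    case True
    show ?thesis
      by (rule dim_eq_imp_eq[OF fd[OF True] epi_iter_subspace[OF Q \<phi> True] epi_iter_antimono dim_eq[OF True]])
  next
    case False
    then show ?thesis by (simp add: epi_iter_off[OF Q])
  qed
  then have "epi_iter Q \<phi> (Suc n) = epi_iter Q \<phi> n" ..
  moreover have "n \<le> m" using n(1) m by (simp add: d_def epi_iter_0)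
  ultimately show ?thesis unfolding epi_iter_def by (rule funpow_fixed)
qed

text \<open>The stationary iterate is a fixed point of the step, which says exactly that images lie
  in the family and are all of it. Conversely every family with surjective maps is contained in
  every iterate, by induction. So the greatest element exists and is the iterate.\<close>

lemma epi_part_eq:
  assumes Q: "quiver Q" and \<phi>: "representation Q \<phi>"
    and m: "(\<Sum>x\<in>verts Q. VS.dim (vs_at \<phi> x)) \<le> m"
  shows "epi_part Q \<phi> = epi_iter Q \<phi> m" "epi_sub Q \<phi> (epi_part Q \<phi>)"
    "epi_sub Q \<phi> W \<Longrightarrow> W \<le> epi_part Q \<phi>"
proof -
  have eq: "v \<in> epi_iter Q \<phi> m x \<longleftrightarrow> v \<in> epi_iter Q \<phi> m x \<and>
    (\<forall>a\<in>arcs Q. tail Q a = x \<longrightarrow> map_at \<phi> a v \<in> epi_iter Q \<phi> m (head Q a)) \<and>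
    (\<forall>a\<in>arcs Q. head Q a = x \<longrightarrow> v \<in> map_at \<phi> a ` epi_iter Q \<phi> m (tail Q a))" for v x
    using epi_iter_Suc_iff[of v Q \<phi> m x] epi_iter_stationary[OF assms] by simp
  have 1: "epi_sub Q \<phi> (epi_iter Q \<phi> m)"
    unfolding epi_sub_def subrep_def
  proof (intro conjI ballI allI impI equalityI image_subsetI subsetI)
    fix a v assume a: "a \<in> arcs Q"
    show "map_at \<phi> a v \<in> epi_iter Q \<phi> m (head Q a)" "map_at \<phi> a v \<in> epi_iter Q \<phi> m (head Q a)"
      if "v \<in> epi_iter Q \<phi> m (tail Q a)"
      using eq[of v "tail Q a"] a that by simp_all
    show "v \<in> map_at \<phi> a ` epi_iter Q \<phi> m (tail Q a)" if "v \<in> epi_iter Q \<phi> m (head Q a)"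
      using eq[of v "head Q a"] a that by simp
  qed (auto simp: epi_iter_off[OF Q] epi_iter_subspace[OF Q \<phi>] dest: subsetD[OF epi_iter_subset])
  have 2: "W \<le> epi_iter Q \<phi> n" if W: "epi_sub Q \<phi> W" for W n
  proof -
    have s: "subrep Q \<phi> W" and e: "\<And>a. a \<in> arcs Q \<Longrightarrow> map_at \<phi> a ` W (tail Q a) = W (head Q a)"
      using W unfolding epi_sub_def by auto
    have "v \<in> W x \<Longrightarrow> v \<in> epi_iter Q \<phi> n x" for v x
    proof (induction n arbitrary: v x)
      case 0
      then show ?case using subrepD[OF s] by (auto simp: epi_iter_0)
    next
      case (Suc n)
      have "map_at \<phi> a v \<in> epi_iter Q \<phi> n (head Q a)" if "a \<in> arcs Q" "tail Q a = x" for a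
        using Suc subrepD(4)[OF s] that by blast
      moreover have "v \<in> map_at \<phi> a ` epi_iter Q \<phi> n (tail Q a)" if "a \<in> arcs Q" "head Q a = x" for a
      proof -
        have "v \<in> map_at \<phi> a ` W (tail Q a)" using Suc.prems e[OF that(1)] that(2) by simp
        then show ?thesis using Suc.IH by blast
      qed
      ultimately show ?case using Suc by (simp add: epi_iter_Suc_iff)
    qed
    then show ?thesis by (auto simp: le_fun_def)
  qed
  show 3: "epi_part Q \<phi> = epi_iter Q \<phi> m"
    unfolding epi_part_def using 1 2 by (intro Greatest_equality) (auto simp: epi_sub_def)
  show "epi_sub Q \<phi> (epi_part Q \<phi>)" "epi_sub Q \<phi> W \<Longrightarrow> W \<le> epi_part Q \<phi>"
    using 1 2 unfolding 3 by auto
qed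

section \<open>The iteration from below and the least kernel with injective quotient maps\<close>

lemma mono_iter_subspace: "VS.subspace (mono_iter Q \<phi> n x)"
  by (cases n) (simp_all add: mono_iter_0 mono_iter_Suc VS.subspace_single_0)

lemma mono_iter_mono: "mono_iter Q \<phi> n x \<subseteq> mono_iter Q \<phi> (Suc n) x"
  unfolding mono_iter_Suc using VS.span_superset by blast

text \<open>Every family closed under images and preimages along arrows absorbs each step. It is
  applied with S the representation itself, giving containment in \<phi>, and with S a competing
  kernel, giving minimality.\<close>

lemma mono_iter_least:
  assumes S: "\<And>x. x \<in> verts Q \<Longrightarrow> VS.subspace (S x)"
    and 1: "\<And>a v. a \<in> arcs Q \<Longrightarrow> v \<in> S (tail Q a) \<Longrightarrow> map_at \<phi> a v \<in> S (head Q a)"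
    and 2: "\<And>a v. a \<in> arcs Q \<Longrightarrow> v \<in> vs_at \<phi> (tail Q a) \<Longrightarrow> map_at \<phi> a v \<in> S (head Q a) \<Longrightarrow> v \<in> S (tail Q a)"
    and Q: "quiver Q" and x: "x \<in> verts Q"
  shows "mono_iter Q \<phi> n x \<subseteq> S x"
  using x
proof (induction n arbitrary: x)
  case 0
  then show ?case using VS.subspace_0[OF S] by (simp add: mono_iter_0)
next
  case (Suc n)
  note s = S[OF Suc.prems]
  have "(\<Union>a\<in>{a \<in> arcs Q. tail Q a = x}. {v \<in> vs_at \<phi> x. map_at \<phi> a v \<in> mono_iter Q \<phi> n (head Q a)}) \<subseteq> S x"
    using Suc.IH[OF quiverD(4)[OF Q]] 2 by blast
  moreover have "(\<Union>a\<in>{a \<in> arcs Q. head Q a = x}. map_at \<phi> a ` mono_iter Q \<phi> n (tail Q a)) \<subseteq> S x"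
    using Suc.IH[OF quiverD(3)[OF Q]] 1 by blast
  ultimately show ?case
    unfolding mono_iter_Suc using Suc.IH[OF Suc.prems] by (intro VS.span_minimal[OF _ s] Un_least)
qed

lemma mono_iter_subset:
  assumes "quiver Q" "representation Q \<phi>" "x \<in> verts Q"
  shows "mono_iter Q \<phi> n x \<subseteq> vs_at \<phi> x"
  using representationD[OF assms(2)] by (intro mono_iter_least assms(1,3)) auto

lemma mono_iter_off:
  assumes "quiver Q" "x \<notin> verts Q" shows "mono_iter Q \<phi> n x = {0}"
proof -
  have emp: "{a \<in> arcs Q. tail Q a = x} = {}" "{a \<in> arcs Q. head Q a = x} = {}"
    using assms quiverD(3,4)[OF assms(1)] by auto
  show ?thesis
    by (induction n) (simp_all add: mono_iter_0 mono_iter_Suc emp zero_fun_def[symmetric])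
qed

lemma mono_iter_stationary:
  assumes Q: "quiver Q" and \<phi>: "representation Q \<phi>"
    and m: "(\<Sum>x\<in>verts Q. VS.dim (vs_at \<phi> x)) \<le> m"
  shows "mono_iter Q \<phi> (Suc m) = mono_iter Q \<phi> m"
proof -
  \<comment> \<open>Total codimension replaces the total dimension: it is nonincreasing while the
    family grows.\<close>
  define d where "d n = (\<Sum>x\<in>verts Q. VS.dim (vs_at \<phi> x) - VS.dim (mono_iter Q \<phi> n x))" for n
  have fd: "fin_dim (mono_iter Q \<phi> n x)" if "x \<in> verts Q" for n x
    using fin_dim_mono[OF representationD(1)[OF \<phi> that] mono_iter_subspace mono_iter_subset[OF Q \<phi> that]] .
  have le: "VS.dim (mono_iter Q \<phi> n x) \<le> VS.dim (mono_iter Q \<phi> (Suc n) x)" if "x \<in> verts Q" for n x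
    using dim_mono[OF fd[OF that] mono_iter_mono] .
  have bd: "VS.dim (mono_iter Q \<phi> n x) \<le> VS.dim (vs_at \<phi> x)" if "x \<in> verts Q" for n x
    using dim_mono[OF representationD(1)[OF \<phi> that] mono_iter_subset[OF Q \<phi> that]] .
  have "d (Suc n) \<le> d n" for n unfolding d_def by (intro sum_mono diff_le_mono2 le)
  then obtain n where n: "n \<le> d 0" "d (Suc n) = d n" using stationary_step[of d] by blast
  have "VS.dim (mono_iter Q \<phi> n x) = VS.dim (mono_iter Q \<phi> (Suc n) x)" if x: "x \<in> verts Q" for x
  proof (rule ccontr)
    assume "\<not> ?thesis"
    then have "VS.dim (mono_iter Q \<phi> n x) < VS.dim (mono_iter Q \<phi> (Suc n) x)" using le[OF x, of n] by simp
    \<comment> \<open>The bound \<open>bd\<close> prevents the truncated subtraction from hiding a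
      strict increase of the dimension.\<close>
    then have "VS.dim (vs_at \<phi> x) - VS.dim (mono_iter Q \<phi> (Suc n) x) < VS.dim (vs_at \<phi> x) - VS.dim (mono_iter Q \<phi> n x)"
      using bd[OF x, of "Suc n"] by linarith
    then have "d (Suc n) < d n"
      unfolding d_def using le x quiverD(1)[OF Q] by (intro sum_strict_mono_ex1) (auto intro: diff_le_mono2)
    then show False using n(2) by simp
  qed
  note dim_eq = this
  have "mono_iter Q \<phi> n x = mono_iter Q \<phi> (Suc n) x" for x
  proof (cases "x \<in> verts Q")
    case True
    show ?thesis by (rule dim_eq_imp_eq[OF fd[OF True] mono_iter_subspace mono_iter_mono dim_eq[OF True]])
  next
    case False
    then show ?thesis by (simp add: mono_iter_off[OF Q])
  qed
  then have "mono_iter Q \<phi> (Suc n) = mono_iter Q \<phi> n" by (simp add: fun_eq_iff)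
  moreover have "n \<le> m" using n(1) m by (simp add: d_def mono_iter_0 dim_zero)
  ultimately show ?thesis unfolding mono_iter_def by (rule funpow_fixed)
qed

text \<open>At the stationary iterate the spans in the recursion add nothing, so images and
  preimages along arrows stay inside it; \<open>mono_iter_least\<close> makes it the least such
  family.\<close>

lemma mono_kernel_eq:
  assumes Q: "quiver Q" and \<phi>: "representation Q \<phi>"
    and m: "(\<Sum>x\<in>verts Q. VS.dim (vs_at \<phi> x)) \<le> m"
  shows "mono_kernel Q \<phi> = mono_iter Q \<phi> m" "mono_sub Q \<phi> (mono_kernel Q \<phi>)"
    "mono_sub Q \<phi> N \<Longrightarrow> mono_kernel Q \<phi> \<le> N"
proof -
  have eq: "mono_iter Q \<phi> m x = VS.span (mono_iter Q \<phi> m x \<union> VS.span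
       (VS.span (\<Union>a\<in>{a \<in> arcs Q. tail Q a = x}. {v \<in> vs_at \<phi> x. map_at \<phi> a v \<in> mono_iter Q \<phi> m (head Q a)}) \<union>
        VS.span (\<Union>a\<in>{a \<in> arcs Q. head Q a = x}. map_at \<phi> a ` mono_iter Q \<phi> m (tail Q a))))" for x
    using mono_iter_Suc[of Q \<phi> m x] epi_iter_stationary[OF assms] mono_iter_stationary[OF assms] by simp
  have a: "(\<Union>a\<in>{a \<in> arcs Q. tail Q a = x}. {v \<in> vs_at \<phi> x. map_at \<phi> a v \<in> mono_iter Q \<phi> m (head Q a)}) \<subseteq> mono_iter Q \<phi> m x"
    and b: "(\<Union>a\<in>{a \<in> arcs Q. head Q a = x}. map_at \<phi> a ` mono_iter Q \<phi> m (tail Q a)) \<subseteq> mono_iter Q \<phi> m x" for x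
    by (subst (2) eq, meson VS.span_superset le_supI1 le_supI2 order_trans)+
  have 1: "mono_sub Q \<phi> (mono_iter Q \<phi> m)"
    unfolding mono_sub_def subrep_def
  proof (intro conjI ballI allI impI image_subsetI)
    fix c v assume c: "c \<in> arcs Q"
    show "map_at \<phi> c v \<in> mono_iter Q \<phi> m (head Q c)" if "v \<in> mono_iter Q \<phi> m (tail Q c)"
      using b[of "head Q c"] c that by auto
    show "v \<in> mono_iter Q \<phi> m (tail Q c)"
      if "v \<in> vs_at \<phi> (tail Q c)" "map_at \<phi> c v \<in> mono_iter Q \<phi> m (head Q c)"
      using a[of "tail Q c"] c that by auto
  qed (auto simp: mono_iter_off[OF Q] mono_iter_subspace dest: subsetD[OF mono_iter_subset[OF Q \<phi>]])
  have 2: "mono_iter Q \<phi> n \<le> N" if N: "mono_sub Q \<phi> N" for N n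
  proof -
    have s: "subrep Q \<phi> N" using N unfolding mono_sub_def by simp
    have "mono_iter Q \<phi> n x \<subseteq> N x" if "x \<in> verts Q" for x
      using N by (intro mono_iter_least[OF _ _ _ Q that] subrepD[OF s]) (auto simp: mono_sub_def)
    then show ?thesis using mono_iter_off[OF Q] subrepD(3)[OF s] by (metis le_funI order_refl)
  qed
  show 3: "mono_kernel Q \<phi> = mono_iter Q \<phi> m"
    unfolding mono_kernel_def mono_sub_iff[OF Q \<phi>] using 1 2 by (intro Least_equality)
  show "mono_sub Q \<phi> (mono_kernel Q \<phi>)" "mono_sub Q \<phi> N \<Longrightarrow> mono_kernel Q \<phi> \<le> N"
    using 1 2 unfolding 3 by auto
qed

text \<open>Rank-nullity on the epi part, where the projection has the intersection with the mono
  kernel as kernel, removes the chosen quotient. The intersection is written as a comprehension to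
  match \<open>subspace_family_preimage\<close> with the identity map.\<close>

lemma global_rank_eq:
  assumes Q: "quiver Q" and \<phi>: "representation Q \<phi>"
  shows "global_rank Q \<phi> = (THE n. \<forall>x\<in>verts Q.
    VS.dim (epi_part Q \<phi> x) - VS.dim {v \<in> epi_part Q \<phi> x. v \<in> mono_kernel Q \<phi> x} = n)"
proof -
  define N E where "N = mono_kernel Q \<phi>" and "E = epi_part Q \<phi>"
  have N: "subrep Q \<phi> N" using mono_kernel_eq(2)[OF Q \<phi> order_refl] by (simp add: mono_sub_def N_def)
  have E: "subrep Q \<phi> E" using epi_part_eq(2)[OF Q \<phi> order_refl] by (simp add: epi_sub_def E_def)
  note q = is_quotient_quotient_rep[OF Q \<phi> N]
  have "VS.dim (quotient_proj Q \<phi> N x ` E x) = VS.dim (E x) - VS.dim {v \<in> E x. v \<in> N x}"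
    if x: "x \<in> verts Q" for x
  proof -
    obtain g where g: "lin g" "\<forall>v\<in>vs_at \<phi> x. g v = quotient_proj Q \<phi> N x v"
      using linear_between_extend[OF representationD(2)[OF \<phi> x] is_quotientD(2)[OF q x]] .
    have "quotient_proj Q \<phi> N x ` E x = g ` E x"
      using g(2) subrepD(2)[OF E x] by (intro image_cong) auto
    moreover have "{v \<in> E x. g v = 0} = {v \<in> E x. v \<in> N x}"
    proof -
      have "g v = 0 \<longleftrightarrow> v \<in> N x" if "v \<in> vs_at \<phi> x" for v
        using g(2) is_quotientD(4)[OF q x] that by auto
      then show ?thesis using subrepD(2)[OF E x] by blast
    qed
    moreover have "fin_dim (E x)"
      using fin_dim_mono[OF representationD(1)[OF \<phi> x] subrepD(1,2)[OF E x]] .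
    ultimately show ?thesis using rank_nullity[OF _ g(1), of "E x"] by simp
  qed
  then show ?thesis unfolding global_rank_def N_def[symmetric] E_def[symmetric] by (simp cong: ball_cong)
qed

section \<open>Invariance of the global rank under isomorphism\<close>

definition transport :: "('v,'e) pre_digraph \<Rightarrow> ('v \<Rightarrow> (nat \<Rightarrow> 'k::field) \<Rightarrow> nat \<Rightarrow> 'k) \<Rightarrow>
    ('v \<Rightarrow> (nat \<Rightarrow> 'k) set) \<Rightarrow> 'v \<Rightarrow> (nat \<Rightarrow> 'k) set" where
  "transport Q \<theta> W = (\<lambda>x. if x \<in> verts Q then \<theta> x ` W x else {0})"

lemma transport_subrep:
  assumes Q: "quiver Q" and i: "iso_pair Q \<psi> \<phi> \<theta> \<theta>'" and W: "subrep Q \<psi> W"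
  shows "subrep Q \<phi> (transport Q \<theta> W)"
  unfolding subrep_def
proof (intro conjI ballI allI impI)
  fix x assume x: "x \<in> verts Q"
  show "VS.subspace (transport Q \<theta> W x)"
    using VP.linear_subspace_image[OF iso_pairD(1)[OF i x] subrepD(1)[OF W x]] x by (simp add: transport_def)
  show "transport Q \<theta> W x \<subseteq> vs_at \<phi> x"
    using iso_pairD(3)[OF i x] subrepD(2)[OF W x] x by (auto simp: transport_def)
next
  fix a assume a: "a \<in> arcs Q"
  note t = quiverD(3)[OF Q a] and h = quiverD(4)[OF Q a]
  have "map_at \<phi> a (\<theta> (tail Q a) v) \<in> \<theta> (head Q a) ` W (head Q a)" if "v \<in> W (tail Q a)" for v
    using iso_pairD(7)[OF i a, of v] subrepD(2)[OF W t] subrepD(4)[OF W a that] that by (metis image_eqI subsetD)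
  then show "map_at \<phi> a ` transport Q \<theta> W (tail Q a) \<subseteq> transport Q \<theta> W (head Q a)"
    using t h by (auto simp: transport_def)
qed (simp add: transport_def)

lemma transport_epi_sub:
  assumes Q: "quiver Q" and i: "iso_pair Q \<psi> \<phi> \<theta> \<theta>'" and W: "epi_sub Q \<psi> W"
  shows "epi_sub Q \<phi> (transport Q \<theta> W)"
proof -
  have s: "subrep Q \<psi> W" using W by (simp add: epi_sub_def)
  have "map_at \<phi> a ` transport Q \<theta> W (tail Q a) = transport Q \<theta> W (head Q a)" if a: "a \<in> arcs Q" for a
  proof -
    note t = quiverD(3)[OF Q a] and h = quiverD(4)[OF Q a]
    have "map_at \<phi> a ` \<theta> (tail Q a) ` W (tail Q a) = \<theta> (head Q a) ` map_at \<psi> a ` W (tail Q a)"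
      unfolding image_image using iso_pairD(7)[OF i a] subrepD(2)[OF s t] by (intro image_cong) auto
    then show ?thesis using W a t h by (simp add: transport_def epi_sub_def)
  qed
  then show ?thesis using transport_subrep[OF Q i s] by (simp add: epi_sub_def)
qed

text \<open>A vector v whose image lies in the transported family is pulled back by \<theta>';
  injectivity of \<theta> at the head then puts the image of this preimage into W.\<close>

lemma transport_mono_sub:
  assumes Q: "quiver Q" and \<psi>: "representation Q \<psi>" and i: "iso_pair Q \<psi> \<phi> \<theta> \<theta>'"
    and W: "mono_sub Q \<psi> W"
  shows "mono_sub Q \<phi> (transport Q \<theta> W)"
proof -
  have s: "subrep Q \<psi> W" using W by (simp add: mono_sub_def)
  have "v \<in> transport Q \<theta> W (tail Q a)" if a: "a \<in> arcs Q" and v: "v \<in> vs_at \<phi> (tail Q a)"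
    and m: "map_at \<phi> a v \<in> transport Q \<theta> W (head Q a)" for a v
  proof -
    note t = quiverD(3)[OF Q a] and h = quiverD(4)[OF Q a]
    let ?u = "\<theta>' (tail Q a) v"
    have u: "?u \<in> vs_at \<psi> (tail Q a)" "\<theta> (tail Q a) ?u = v" using iso_pairD(5,6)[OF i t v] by auto
    obtain w where w: "w \<in> W (head Q a)" "map_at \<phi> a v = \<theta> (head Q a) w"
      using m h by (auto simp: transport_def)
    have "\<theta> (head Q a) (map_at \<psi> a ?u) = \<theta> (head Q a) w" using iso_pairD(7)[OF i a u(1)] u(2) w(2) by simp
    then have "map_at \<psi> a ?u = w"
      using iso_pairD(4)[OF i h] representationD(4)[OF \<psi> a u(1)] subrepD(2)[OF s h] w(1) by (metis subsetD)
    then have "?u \<in> W (tail Q a)" using W a u(1) w(1) by (auto simp: mono_sub_def)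
    then show ?thesis using u(2) t by (auto simp: transport_def intro!: image_eqI[of v _ ?u])
  qed
  then show ?thesis using transport_subrep[OF Q i s] by (simp add: mono_sub_def)
qed

text \<open>On vertices the two maps cancel; off the vertex set the value \<open>{0}\<close> agrees
  with the normalisation in \<open>subrep\<close>, so the families coincide as functions.\<close>

lemma transport_inverse:
  assumes Q: "quiver Q" and i: "iso_pair Q \<psi> \<phi> \<theta> \<theta>'" and W: "subrep Q \<phi> W"
  shows "transport Q \<theta> (transport Q \<theta>' W) = W"
proof
  fix x
  show "transport Q \<theta> (transport Q \<theta>' W) x = W x"
  proof (cases "x \<in> verts Q")
    case True
    have "\<theta> x ` \<theta>' x ` W x = (\<lambda>v. v) ` W x"
      unfolding image_image using iso_pairD(6)[OF i True] subrepD(2)[OF W True] by (intro image_cong) auto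
    then show ?thesis using True by (simp add: transport_def)
  qed (simp add: transport_def subrepD(3)[OF W])
qed

lemma transport_mono: "W \<le> W' \<Longrightarrow> transport Q \<theta> W \<le> transport Q \<theta> W'"
  unfolding transport_def le_fun_def by auto

text \<open>Transport preserves the defining properties of the epi part and the mono kernel in both
  directions, so extremality matches them up. Since \<theta> is injective, it preserves their
  dimensions and commutes with their intersection.\<close>

lemma global_rank_iso:
  assumes Q: "quiver Q" and \<psi>: "representation Q \<psi>" and i: "rep_iso Q \<psi> \<phi>"
  shows "global_rank Q \<phi> = global_rank Q \<psi>"
proof -
  obtain \<theta> \<theta>' where i: "iso_pair Q \<psi> \<phi> \<theta> \<theta>'" using i unfolding rep_iso_def by blast
  note \<phi> = iso_pair_representation[OF Q \<psi> i]
  note i' = iso_pair_sym[OF Q \<psi> i]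
  note e = epi_part_eq(2,3)[OF Q \<psi> order_refl] epi_part_eq(2,3)[OF Q \<phi> order_refl]
  note m = mono_kernel_eq(2,3)[OF Q \<psi> order_refl] mono_kernel_eq(2,3)[OF Q \<phi> order_refl]
  have se: "subrep Q \<phi> (epi_part Q \<phi>)" "subrep Q \<phi> (mono_kernel Q \<phi>)"
    "subrep Q \<psi> (epi_part Q \<psi>)" "subrep Q \<psi> (mono_kernel Q \<psi>)"
    using e m by (auto simp: epi_sub_def mono_sub_def)
  have E: "epi_part Q \<phi> = transport Q \<theta> (epi_part Q \<psi>)"
  proof (rule antisym)
    have "transport Q \<theta>' (epi_part Q \<phi>) \<le> epi_part Q \<psi>"
      by (rule e(2)[OF transport_epi_sub[OF Q i' e(3)]])
    from transport_mono[OF this, of Q \<theta>] show "epi_part Q \<phi> \<le> transport Q \<theta> (epi_part Q \<psi>)"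
      unfolding transport_inverse[OF Q i se(1)] .
    show "transport Q \<theta> (epi_part Q \<psi>) \<le> epi_part Q \<phi>"
      by (rule e(4)[OF transport_epi_sub[OF Q i e(1)]])
  qed
  have M: "mono_kernel Q \<phi> = transport Q \<theta> (mono_kernel Q \<psi>)"
  proof (rule antisym)
    have "mono_kernel Q \<psi> \<le> transport Q \<theta>' (mono_kernel Q \<phi>)"
      by (rule m(2)[OF transport_mono_sub[OF Q \<phi> i' m(3)]])
    from transport_mono[OF this, of Q \<theta>] show "transport Q \<theta> (mono_kernel Q \<psi>) \<le> mono_kernel Q \<phi>"
      unfolding transport_inverse[OF Q i se(2)] .
    show "mono_kernel Q \<phi> \<le> transport Q \<theta> (mono_kernel Q \<psi>)"
      by (rule m(4)[OF transport_mono_sub[OF Q \<psi> i m(1)]])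
  qed
  have "VS.dim (epi_part Q \<phi> x) - VS.dim {v \<in> epi_part Q \<phi> x. v \<in> mono_kernel Q \<phi> x} =
    VS.dim (epi_part Q \<psi> x) - VS.dim {v \<in> epi_part Q \<psi> x. v \<in> mono_kernel Q \<psi> x}" if x: "x \<in> verts Q" for x
  proof -
    note sE = subrepD(1,2)[OF se(3) x] and sM = subrepD(1,2)[OF se(4) x]
    have inj: "inj_on (\<theta> x) (vs_at \<psi> x)" by (rule inj_on_inverseI[where g = "\<theta>' x"]) (rule iso_pairD(4)[OF i x])
    have *: "VS.dim (\<theta> x ` S) = VS.dim S" if "VS.subspace S" "S \<subseteq> vs_at \<psi> x" for S
      using dim_image_inj[OF fin_dim_mono[OF representationD(1)[OF \<psi> x] that] iso_pairD(1)[OF i x]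
          inj_on_subset[OF inj that(2)]] .
    have eq: "{v \<in> epi_part Q \<psi> x. v \<in> mono_kernel Q \<psi> x} = epi_part Q \<psi> x \<inter> mono_kernel Q \<psi> x" by auto
    have "{v \<in> epi_part Q \<phi> x. v \<in> mono_kernel Q \<phi> x} = \<theta> x ` {v \<in> epi_part Q \<psi> x. v \<in> mono_kernel Q \<psi> x}"
      unfolding eq inj_on_image_Int[OF inj sE(2) sM(2)] using x by (auto simp: E M transport_def)
    moreover have "epi_part Q \<phi> x = \<theta> x ` epi_part Q \<psi> x" using x by (simp add: E transport_def)
    moreover have "VS.subspace {v \<in> epi_part Q \<psi> x. v \<in> mono_kernel Q \<psi> x}"
      unfolding eq by (rule VS.subspace_inter[OF sE(1) sM(1)])
    moreover have "{v \<in> epi_part Q \<psi> x. v \<in> mono_kernel Q \<psi> x} \<subseteq> vs_at \<psi> x"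
      using sE(2) by auto
    ultimately show ?thesis
      using *[OF sE] *[of "{v \<in> epi_part Q \<psi> x. v \<in> mono_kernel Q \<psi> x}"] by simp
  qed
  then show ?thesis unfolding global_rank_eq[OF Q \<psi>] global_rank_eq[OF Q \<phi>] by (simp cong: ball_cong)
qed

section \<open>Rank functions on families of representations\<close>

text \<open>Every index is a value of \<open>prod_encode\<close>, so equations in direct sums can be
  checked one summand at a time.\<close>

lemma summand_ext: "(\<And>y. summand_proj y u = summand_proj y v) \<Longrightarrow> u = v"
proof
  fix j assume *: "\<And>y. summand_proj y u = summand_proj y v"
  obtain y i where "j = prod_encode (y, i)" by (metis prod_decode_inverse surj_pair)
  then show "u j = v j" using *[of y] by (simp add: summand_proj_def fun_eq_iff)
qed

lemma summand_proj_inj: "summand_proj y (summand_inj z v) = (if y = z then v else 0)"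
  by (auto simp: summand_proj_def summand_inj_def)

lemma summand_proj_add: "summand_proj y (u + v) = summand_proj y u + summand_proj y v"
  and summand_proj_scale: "summand_proj y (vscale c u) = vscale c (summand_proj y u)"
  and summand_proj_sum: "summand_proj y (\<Sum>b\<in>B. w b) = (\<Sum>b\<in>B. summand_proj y (w b) :: nat \<Rightarrow> 'k::field)"
  by (auto simp: summand_proj_def vscale_def fun_eq_iff sum_fun_apply)

lemma direct_sum_iff:
  "u \<in> direct_sum I V \<longleftrightarrow> (\<forall>y\<in>I. summand_proj y u \<in> V y) \<and> (\<forall>y. y \<notin> I \<longrightarrow> summand_proj y u = 0)"
  by (simp add: direct_sum_def zero_fun_def)

text \<open>Keeps pushforwards within coordinate spaces: the indices are the encoded pairs of a
  summand and an index of that summand.\<close>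

lemma direct_sum_coord:
  assumes "\<And>y. y \<in> I \<Longrightarrow> V y = coord (J y)"
  shows "direct_sum I V = coord (prod_encode ` Sigma I J)"
proof -
  have mem: "prod_encode (y, i) \<in> prod_encode ` Sigma I J \<longleftrightarrow> y \<in> I \<and> i \<in> J y" for y i
    by (auto simp: prod_encode_eq)
  have "u \<in> coord (prod_encode ` Sigma I J) \<longleftrightarrow>
    (\<forall>y i. \<not> (y \<in> I \<and> i \<in> J y) \<longrightarrow> u (prod_encode (y, i)) = 0)" for u :: "nat \<Rightarrow> 'a"
  proof
    assume "u \<in> coord (prod_encode ` Sigma I J)"
    then show "\<forall>y i. \<not> (y \<in> I \<and> i \<in> J y) \<longrightarrow> u (prod_encode (y, i)) = 0"
      unfolding coord_def mem[symmetric] by simp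
  next
    assume *: "\<forall>y i. \<not> (y \<in> I \<and> i \<in> J y) \<longrightarrow> u (prod_encode (y, i)) = 0"
    have "u j = 0" if j: "j \<notin> prod_encode ` Sigma I J" for j
    proof -
      obtain y i where yi: "j = prod_encode (y, i)" by (metis prod_decode_inverse surj_pair)
      show ?thesis using * j mem[of y i] unfolding yi by simp
    qed
    then show "u \<in> coord (prod_encode ` Sigma I J)" by (simp add: coord_def)
  qed
  moreover have "u \<in> direct_sum I V \<longleftrightarrow>
    (\<forall>y i. \<not> (y \<in> I \<and> i \<in> J y) \<longrightarrow> u (prod_encode (y, i)) = 0)" for u :: "nat \<Rightarrow> 'a"
    unfolding direct_sum_iff using assms by (auto simp: coord_def summand_proj_def fun_eq_iff)
  ultimately show ?thesis by blast
qed

text \<open>Only the arrows over a that end at y contribute to the summand y.\<close>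

lemma summand_proj_pushforward:
  assumes "quiver Q"
  shows "summand_proj y (map_at (pushforward Q f g \<phi>) a u) =
    (\<Sum>b | b \<in> arcs Q \<and> g b = a \<and> head Q b = y. map_at \<phi> b (summand_proj (tail Q b) u))"
proof -
  have "summand_proj y (map_at (pushforward Q f g \<phi>) a u) =
    (\<Sum>b | b \<in> arcs Q \<and> g b = a. if y = head Q b then map_at \<phi> b (summand_proj (tail Q b) u) else 0)"
    by (simp add: pushforward_def summand_proj_sum summand_proj_inj)
  also have "\<dots> = (\<Sum>b | b \<in> arcs Q \<and> g b = a \<and> head Q b = y. map_at \<phi> b (summand_proj (tail Q b) u))"
    using quiverD(2)[OF assms] by (intro sum.mono_neutral_cong_right) auto
  finally show ?thesis .
qed

lemma quiver_homD:
  assumes "quiver_hom Q Q' f g"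
  shows "x \<in> verts Q \<Longrightarrow> f x \<in> verts Q'" "b \<in> arcs Q \<Longrightarrow> g b \<in> arcs Q'"
    "b \<in> arcs Q \<Longrightarrow> tail Q' (g b) = f (tail Q b)" "b \<in> arcs Q \<Longrightarrow> head Q' (g b) = f (head Q b)"
  using assms unfolding quiver_hom_def by auto

lemma pushforward_maps:
  assumes Q: "quiver Q" and h: "quiver_hom Q Q' f g"
    and V: "\<And>x. x \<in> verts Q \<Longrightarrow> VS.subspace (vs_at \<phi> x)"
    and m: "\<And>b v. b \<in> arcs Q \<Longrightarrow> v \<in> vs_at \<phi> (tail Q b) \<Longrightarrow> map_at \<phi> b v \<in> vs_at \<phi> (head Q b)"
    and a: "a \<in> arcs Q'" and u: "u \<in> vs_at (pushforward Q f g \<phi>) (tail Q' a)"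
  shows "map_at (pushforward Q f g \<phi>) a u \<in> vs_at (pushforward Q f g \<phi>) (head Q' a)"
proof -
  have 1: "map_at \<phi> b (summand_proj (tail Q b) u) \<in> vs_at \<phi> (head Q b)" if "b \<in> arcs Q" "g b = a" for b
    using u that quiver_homD(3)[OF h that(1)] quiverD(3)[OF Q that(1)]
    by (intro m) (auto simp: pushforward_def direct_sum_iff)
  have "summand_proj y (map_at (pushforward Q f g \<phi>) a u) \<in> vs_at \<phi> y" if "y \<in> verts Q" for y
    unfolding summand_proj_pushforward[OF Q] using 1 by (intro VS.subspace_sum[OF V[OF that]]) auto
  moreover have "summand_proj y (map_at (pushforward Q f g \<phi>) a u) = 0"
    if "\<not> (y \<in> verts Q \<and> f y = head Q' a)" for y
  proof -
    have "{b. b \<in> arcs Q \<and> g b = a \<and> head Q b = y} = {}"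
      using that quiver_homD(4)[OF h] quiverD(4)[OF Q] by auto
    then show ?thesis unfolding summand_proj_pushforward[OF Q] by (simp only: sum.empty)
  qed
  ultimately show ?thesis by (auto simp: pushforward_def direct_sum_iff)
qed

lemma rep_iso_pullback:
  assumes Q': "quiver Q'" and h: "quiver_hom Q' Q f g" and i: "rep_iso Q \<psi> \<phi>"
  shows "rep_iso Q' (pullback f g \<psi>) (pullback f g \<phi>)"
proof -
  obtain \<theta> \<theta>' where i: "iso_pair Q \<psi> \<phi> \<theta> \<theta>'" using i unfolding rep_iso_def by blast
  have "iso_pair Q' (pullback f g \<psi>) (pullback f g \<phi>) (\<lambda>y. \<theta> (f y)) (\<lambda>y. \<theta>' (f y))"
    unfolding iso_pair_def pullback_def
    using iso_pairD(1-6)[OF i] iso_pairD(7)[OF i quiver_homD(2)[OF h]] quiver_homD[OF h] by simp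
  then show ?thesis unfolding rep_iso_def by blast
qed

definition direct_sum_map :: "nat set \<Rightarrow> (nat \<Rightarrow> (nat \<Rightarrow> 'k::field) \<Rightarrow> nat \<Rightarrow> 'k) \<Rightarrow> (nat \<Rightarrow> 'k) \<Rightarrow> nat \<Rightarrow> 'k" where
  "direct_sum_map I \<theta> u = (\<lambda>j. case prod_decode j of (y, i) \<Rightarrow>
     if y \<in> I then \<theta> y (summand_proj y u) i else 0)"

lemma summand_proj_direct_sum_map:
  "summand_proj y (direct_sum_map I \<theta> u) = (if y \<in> I then \<theta> y (summand_proj y u) else 0)"
  by (auto simp: direct_sum_map_def summand_proj_def)

lemma lin_direct_sum_map:
  assumes "\<And>y. y \<in> I \<Longrightarrow> lin (\<theta> y)" shows "lin (direct_sum_map I \<theta>)"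
  unfolding lin_iff
  by (intro conjI allI; rule summand_ext)
    (auto simp: summand_proj_direct_sum_map summand_proj_add summand_proj_scale linD[OF assms])

text \<open>The isomorphisms act blockwise on the summands over each vertex, and compatibility with
  an arrow is checked on each summand y, where both sides are sums over the arrows above it that end
  at y.\<close>

lemma rep_iso_pushforward:
  fixes \<psi> \<phi> :: "(nat,nat,'k::field) qrep"
  assumes Q: "quiver Q" and h: "quiver_hom Q Q' f g" and \<psi>: "representation Q \<psi>" and i: "rep_iso Q \<psi> \<phi>"
  shows "rep_iso Q' (pushforward Q f g \<psi>) (pushforward Q f g \<phi>)"
proof -
  obtain \<theta> \<theta>' where i: "iso_pair Q \<psi> \<phi> \<theta> \<theta>'" using i unfolding rep_iso_def by blast
  define I where "I x = {y \<in> verts Q. f y = x}" for x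
  define F where "F \<theta> x = direct_sum_map (I x) \<theta>" for \<theta> :: "nat \<Rightarrow> (nat \<Rightarrow> 'k) \<Rightarrow> nat \<Rightarrow> 'k" and x
  have "iso_pair Q' (pushforward Q f g \<psi>) (pushforward Q f g \<phi>) (F \<theta>) (F \<theta>')"
    unfolding iso_pair_def
  proof (rule conjI; rule ballI)
    fix x
    have I: "y \<in> verts Q" if "y \<in> I x" for y using that by (simp add: I_def)
    have vs: "vs_at (pushforward Q f g \<phi>) x = direct_sum (I x) (vs_at \<phi>)" for \<phi> :: "(nat,nat,'k) qrep"
      by (simp add: pushforward_def I_def)
    have 1: "F \<theta>' x (F \<theta> x v) = v" if "v \<in> direct_sum (I x) (vs_at \<psi>)" for v
      by (rule summand_ext)
        (use that iso_pairD(4)[OF i I] in \<open>auto simp: F_def summand_proj_direct_sum_map direct_sum_iff\<close>)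
    have 2: "F \<theta> x (F \<theta>' x v) = v" if "v \<in> direct_sum (I x) (vs_at \<phi>)" for v
      by (rule summand_ext)
        (use that iso_pairD(6)[OF i I] in \<open>auto simp: F_def summand_proj_direct_sum_map direct_sum_iff\<close>)
    show "lin (F \<theta> x) \<and> lin (F \<theta>' x) \<and>
        (\<forall>v\<in>vs_at (pushforward Q f g \<psi>) x. F \<theta> x v \<in> vs_at (pushforward Q f g \<phi>) x \<and> F \<theta>' x (F \<theta> x v) = v) \<and>
        (\<forall>v\<in>vs_at (pushforward Q f g \<phi>) x. F \<theta>' x v \<in> vs_at (pushforward Q f g \<psi>) x \<and> F \<theta> x (F \<theta>' x v) = v)"
      unfolding vs using 1 2 iso_pairD(3,5)[OF i I] iso_pairD(1,2)[OF i I]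
      by (auto simp: F_def direct_sum_iff summand_proj_direct_sum_map intro!: lin_direct_sum_map)
  next
    fix a assume a: "a \<in> arcs Q'"
    show "\<forall>v\<in>vs_at (pushforward Q f g \<psi>) (tail Q' a).
      F \<theta> (head Q' a) (map_at (pushforward Q f g \<psi>) a v) = map_at (pushforward Q f g \<phi>) a (F \<theta> (tail Q' a) v)"
    proof (rule ballI, rule summand_ext)
      fix v y assume "v \<in> vs_at (pushforward Q f g \<psi>) (tail Q' a)"
      then have v: "summand_proj z v \<in> vs_at \<psi> z" if "z \<in> I (tail Q' a)" for z
        using that by (simp add: pushforward_def direct_sum_iff I_def)
      let ?B = "{b. b \<in> arcs Q \<and> g b = a \<and> head Q b = y}"
      have B: "tail Q b \<in> I (tail Q' a)" "head Q b \<in> I (head Q' a)" "head Q b = y" if "b \<in> ?B" for b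
        using that quiver_homD(3,4)[OF h] quiverD(3,4)[OF Q] by (auto simp: I_def)
      have R: "summand_proj y (map_at (pushforward Q f g \<phi>) a (F \<theta> (tail Q' a) v)) =
        (\<Sum>b\<in>?B. \<theta> y (map_at \<psi> b (summand_proj (tail Q b) v)))"
        unfolding summand_proj_pushforward[OF Q]
      proof (rule sum.cong[OF refl])
        fix b assume b: "b \<in> ?B"
        show "map_at \<phi> b (summand_proj (tail Q b) (F \<theta> (tail Q' a) v)) = \<theta> y (map_at \<psi> b (summand_proj (tail Q b) v))"
          using iso_pairD(7)[OF i _ v[OF B(1)[OF b]]] B[OF b] b by (simp add: F_def summand_proj_direct_sum_map)
      qed
      show "summand_proj y (F \<theta> (head Q' a) (map_at (pushforward Q f g \<psi>) a v)) =
         summand_proj y (map_at (pushforward Q f g \<phi>) a (F \<theta> (tail Q' a) v))"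
      proof (cases "y \<in> I (head Q' a)")
        case True
        then have "lin (\<theta> y)" using iso_pairD(1)[OF i] by (simp add: I_def)
        then show ?thesis
          unfolding R using True
          by (simp add: F_def summand_proj_direct_sum_map summand_proj_pushforward[OF Q] VP.linear_sum)
      next
        case False
        then have "?B = {}" using B(2,3) by blast
        then show ?thesis unfolding R using False by (simp only: F_def summand_proj_direct_sum_map if_False sum.empty)
      qed
    qed
  qed
  then show ?thesis unfolding rep_iso_def by blast
qed

context function_ring
begin

text \<open>The coordinate space at each vertex is the same for all p, and the maps are matrices
  over G. That they land in the space at the head is a separate condition, since \<open>gmap\<close>
  bounds the support of rows only.\<close>

definition coord_family :: "('v,'e) pre_digraph \<Rightarrow> ('p \<Rightarrow> ('v,'e,'k) qrep) \<Rightarrow> bool" where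
  "coord_family Q \<Psi> \<longleftrightarrow> (\<exists>J. \<forall>x\<in>verts Q. finite (J x) \<and> (\<forall>p\<in>X. vs_at (\<Psi> p) x = coord (J x))) \<and>
     (\<forall>a\<in>arcs Q. gmap (\<lambda>p. map_at (\<Psi> p) a) \<and>
       (\<forall>p\<in>X. \<forall>v\<in>vs_at (\<Psi> p) (tail Q a). map_at (\<Psi> p) a v \<in> vs_at (\<Psi> p) (head Q a)))"

lemma coord_familyE:
  assumes "coord_family Q \<Psi>"
  obtains J where "\<And>x. x \<in> verts Q \<Longrightarrow> finite (J x)"
    "\<And>x p. x \<in> verts Q \<Longrightarrow> p \<in> X \<Longrightarrow> vs_at (\<Psi> p) x = coord (J x)"
    "\<And>a. a \<in> arcs Q \<Longrightarrow> gmap (\<lambda>p. map_at (\<Psi> p) a)"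
    "\<And>a p v. a \<in> arcs Q \<Longrightarrow> p \<in> X \<Longrightarrow> v \<in> vs_at (\<Psi> p) (tail Q a) \<Longrightarrow> map_at (\<Psi> p) a v \<in> vs_at (\<Psi> p) (head Q a)"
proof -
  obtain J where "\<forall>x\<in>verts Q. finite (J x) \<and> (\<forall>p\<in>X. vs_at (\<Psi> p) x = coord (J x))"
    using assms unfolding coord_family_def by (elim conjE exE)
  then show ?thesis
    using assms unfolding coord_family_def by (intro that[of J]) auto
qed

lemma coord_family_representation:
  assumes "coord_family Q \<Psi>" "p \<in> X" shows "representation Q (\<Psi> p)"
proof -
  obtain J where J: "\<And>x. x \<in> verts Q \<Longrightarrow> finite (J x)"
    "\<And>x p. x \<in> verts Q \<Longrightarrow> p \<in> X \<Longrightarrow> vs_at (\<Psi> p) x = coord (J x)"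
    "\<And>a. a \<in> arcs Q \<Longrightarrow> gmap (\<lambda>p. map_at (\<Psi> p) a)"
    "\<And>a p v. a \<in> arcs Q \<Longrightarrow> p \<in> X \<Longrightarrow> v \<in> vs_at (\<Psi> p) (tail Q a) \<Longrightarrow> map_at (\<Psi> p) a v \<in> vs_at (\<Psi> p) (head Q a)"
    by (rule coord_familyE[OF assms(1)]) blast
  show ?thesis
    unfolding representation_def
    using J(1,2,4) assms(2) gmap_lin[OF J(3) assms(2)]
    by (auto simp: fin_dim_coord intro!: lin_linear_between)
qed

text \<open>Both conditions of a step are preimages in the sense of
  \<open>subspace_family_preimages\<close>: along the arrow maps for outgoing arrows, and along the
  identity into an image family for incoming arrows.\<close>

lemma subspace_family_epi_iter:
  assumes Q: "quiver Q" and \<Psi>: "coord_family Q \<Psi>"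
  shows "subspace_family (\<lambda>p. epi_iter Q (\<Psi> p) n x)"
proof -
  obtain J where J: "\<And>x. x \<in> verts Q \<Longrightarrow> finite (J x)"
    "\<And>x p. x \<in> verts Q \<Longrightarrow> p \<in> X \<Longrightarrow> vs_at (\<Psi> p) x = coord (J x)"
    "\<And>a. a \<in> arcs Q \<Longrightarrow> gmap (\<lambda>p. map_at (\<Psi> p) a)"
    "\<And>a p v. a \<in> arcs Q \<Longrightarrow> p \<in> X \<Longrightarrow> v \<in> vs_at (\<Psi> p) (tail Q a) \<Longrightarrow> map_at (\<Psi> p) a v \<in> vs_at (\<Psi> p) (head Q a)"
    by (rule coord_familyE[OF \<Psi>]) blast
  have sub: "epi_iter Q (\<Psi> p) n x \<subseteq> coord (J x)" if "x \<in> verts Q" "p \<in> X" for p n x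
    using epi_iter_subset[OF that(1), of "\<Psi> p" n] J(2)[OF that] by simp
  have mp: "map_at (\<Psi> p) a ` epi_iter Q (\<Psi> p) n (tail Q a) \<subseteq> coord (J (head Q a))"
    if a: "a \<in> arcs Q" and p: "p \<in> X" for a p n
    using J(4)[OF a p] J(2)[OF quiverD(4)[OF Q a] p] epi_iter_subset[OF quiverD(3)[OF Q a], of "\<Psi> p" n] by blast
  show ?thesis
  proof (cases "x \<in> verts Q")
    case False
    then show ?thesis by (simp add: epi_iter_off[OF Q] subspace_family_zero)
  next
    case True
    then show ?thesis
    proof (induction n arbitrary: x)
      case 0
      have "subspace_family (\<lambda>p. coord (J x))" by (rule subspace_family_coord[OF J(1)[OF 0]])
      then show ?case using J(2)[OF 0] 0 by (simp add: epi_iter_0 cong: subspace_family_cong)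
    next
      case (Suc n)
      show ?case
        unfolding epi_iter_Suc
      proof (rule subspace_family_preimages[where L = "\<lambda>a. J x" and f = "\<lambda>a p v. v"])
        show "subspace_family (\<lambda>p. {v \<in> epi_iter Q (\<Psi> p) n x.
           \<forall>a\<in>{a \<in> arcs Q. tail Q a = x}. map_at (\<Psi> p) a v \<in> epi_iter Q (\<Psi> p) n (head Q a)})"
        proof (rule subspace_family_preimages[where L = "\<lambda>a. J (head Q a)"])
          show "map_at (\<Psi> p) a ` epi_iter Q (\<Psi> p) n x \<subseteq> coord (J (head Q a))"
            if "a \<in> {a \<in> arcs Q. tail Q a = x}" "p \<in> X" for a p
            using mp[of a p n] that by auto
        qed (use quiverD[OF Q] Suc J in auto)
        show "subspace_family (\<lambda>p. map_at (\<Psi> p) a ` epi_iter Q (\<Psi> p) n (tail Q a))"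
          if "a \<in> {a \<in> arcs Q. head Q a = x}" for a
        proof (rule subspace_family_image[where L = "J (head Q a)"])
          show "map_at (\<Psi> p) a ` epi_iter Q (\<Psi> p) n (tail Q a) \<subseteq> coord (J (head Q a))" if "p \<in> X" for p
            using mp \<open>a \<in> {a \<in> arcs Q. head Q a = x}\<close> that by blast
        qed (use that J(1,3) Suc.IH quiverD(3,4)[OF Q] in auto)
        show "(\<lambda>v. v) ` {v \<in> epi_iter Q (\<Psi> p) n x.
            \<forall>a\<in>{a \<in> arcs Q. tail Q a = x}. map_at (\<Psi> p) a v \<in> epi_iter Q (\<Psi> p) n (head Q a)} \<subseteq> coord (J x)"
          if "p \<in> X" for p
          using sub[OF Suc.prems that, of n] by auto
      qed (use quiverD(2)[OF Q] J(1)[OF Suc.prems] gmap_id in auto)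
    qed
  qed
qed

lemma subspace_family_mono_iter:
  assumes Q: "quiver Q" and \<Psi>: "coord_family Q \<Psi>" and x: "x \<in> verts Q"
  shows "subspace_family (\<lambda>p. mono_iter Q (\<Psi> p) n x)"
proof -
  obtain J where J: "\<And>x. x \<in> verts Q \<Longrightarrow> finite (J x)"
    "\<And>x p. x \<in> verts Q \<Longrightarrow> p \<in> X \<Longrightarrow> vs_at (\<Psi> p) x = coord (J x)"
    "\<And>a. a \<in> arcs Q \<Longrightarrow> gmap (\<lambda>p. map_at (\<Psi> p) a)"
    "\<And>a p v. a \<in> arcs Q \<Longrightarrow> p \<in> X \<Longrightarrow> v \<in> vs_at (\<Psi> p) (tail Q a) \<Longrightarrow> map_at (\<Psi> p) a v \<in> vs_at (\<Psi> p) (head Q a)"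
    by (rule coord_familyE[OF \<Psi>]) blast
  show ?thesis
    using x
  proof (induction n arbitrary: x)
    case 0
    then show ?case by (simp add: mono_iter_0 subspace_family_zero)
  next
    case (Suc n)
    have 1: "subspace_family (\<lambda>p. {v \<in> vs_at (\<Psi> p) x. map_at (\<Psi> p) a v \<in> mono_iter Q (\<Psi> p) n (head Q a)})"
      if a: "a \<in> {a \<in> arcs Q. tail Q a = x}" for a
    proof (rule subspace_family_preimage[where L = "J (head Q a)"])
      show "subspace_family (\<lambda>p. vs_at (\<Psi> p) x)"
        using subspace_family_coord[OF J(1)[OF Suc.prems]] J(2)[OF Suc.prems] by (simp cong: subspace_family_cong)
      show "map_at (\<Psi> p) a ` vs_at (\<Psi> p) x \<subseteq> coord (J (head Q a))" if "p \<in> X" for p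
        using J(4)[of a p] J(2)[OF quiverD(4)[OF Q, of a] that] a that by auto
    qed (use a Suc.IH J(1,3) quiverD(4)[OF Q, of a] in auto)
    have 2: "subspace_family (\<lambda>p. map_at (\<Psi> p) a ` mono_iter Q (\<Psi> p) n (tail Q a))"
      if a: "a \<in> {a \<in> arcs Q. head Q a = x}" for a
    proof (rule subspace_family_image[where L = "J x"])
      show "map_at (\<Psi> p) a ` mono_iter Q (\<Psi> p) n (tail Q a) \<subseteq> coord (J x)" if p: "p \<in> X" for p
        using J(4)[of a p] J(2)[OF Suc.prems p] a p
          mono_iter_subset[OF Q coord_family_representation[OF \<Psi> p] quiverD(3)[OF Q, of a], of n] by auto
    qed (use a Suc.IH J(1)[OF Suc.prems] J(3) quiverD(3)[OF Q, of a] in auto)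
    show ?case
      unfolding mono_iter_Suc
      by (intro subspace_family_span_Un subspace_family_span_UN 1 2 Suc.IH[OF Suc.prems]) (use quiverD(2)[OF Q] in auto)
  qed
qed

lemma simple_global_rank:
  assumes Q: "quiver Q" and \<Psi>: "coord_family Q \<Psi>"
  shows "simple (\<lambda>p. global_rank Q (\<Psi> p))"
proof -
  obtain J where J: "\<And>x. x \<in> verts Q \<Longrightarrow> finite (J x)"
    "\<And>x p. x \<in> verts Q \<Longrightarrow> p \<in> X \<Longrightarrow> vs_at (\<Psi> p) x = coord (J x)"
    by (rule coord_familyE[OF \<Psi>]) blast
  \<comment> \<open>The total number of coordinates bounds the total dimension at every point, so
    the same number of iteration steps suffices for all p.\<close>
  define m where "m = (\<Sum>x\<in>verts Q. card (J x))"
  define d where "d x p = VS.dim (epi_iter Q (\<Psi> p) m x) -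
    VS.dim {v \<in> epi_iter Q (\<Psi> p) m x. v \<in> mono_iter Q (\<Psi> p) m x}" for x p
  \<comment> \<open>The conditional agrees with \<open>d x p\<close> on the vertex set; it presents
    the rank as a function of one tuple in the shape of \<open>simple_family\<close>.\<close>
  have eq: "global_rank Q (\<Psi> p) = (THE n. \<forall>x\<in>verts Q. (if x \<in> verts Q then d x p else 0) = n)"
    if p: "p \<in> X" for p
  proof -
    note r = coord_family_representation[OF \<Psi> p]
    have m: "(\<Sum>x\<in>verts Q. VS.dim (vs_at (\<Psi> p) x)) \<le> m"
      unfolding m_def by (rule sum_mono) (simp add: J(2)[OF _ p] dim_coord J(1))
    show ?thesis
      unfolding global_rank_eq[OF Q r] epi_part_eq(1)[OF Q r m] mono_kernel_eq(1)[OF Q r m] d_def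
      by (simp cong: ball_cong)
  qed
  have "simple (d x)" if x: "x \<in> verts Q" for x
  proof -
    note e = subspace_family_epi_iter[OF Q \<Psi>, of m x]
    have "epi_iter Q (\<Psi> p) m x \<subseteq> coord (J x)" if "p \<in> X" for p
      using epi_iter_subset[OF x, of "\<Psi> p" m] J(2)[OF x that] by simp
    then have "subspace_family (\<lambda>p. {v \<in> epi_iter Q (\<Psi> p) m x. v \<in> mono_iter Q (\<Psi> p) m x})"
      by (intro subspace_family_preimage[OF e subspace_family_mono_iter[OF Q \<Psi> x] gmap_id J(1)[OF x]]) auto
    then show ?thesis
      unfolding d_def by (intro simple_binop[where f = "(-)"] simple_dim e)
  qed
  from simple_compose[OF simple_family[OF quiverD(1)[OF Q] this, of "\<lambda>x. x" 0],
      where f = "\<lambda>h. THE n. \<forall>x\<in>verts Q. h x = n"]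
  show ?thesis by (simp add: eq cong: simple_cong)
qed

section \<open>Rank functions on coordinate families\<close>

lemma coord_family_pullback:
  assumes h: "quiver_hom Q' Q f g" and \<Psi>: "coord_family Q \<Psi>"
  shows "coord_family Q' (\<lambda>p. pullback f g (\<Psi> p))"
proof -
  obtain J where J: "\<And>x. x \<in> verts Q \<Longrightarrow> finite (J x)"
    "\<And>x p. x \<in> verts Q \<Longrightarrow> p \<in> X \<Longrightarrow> vs_at (\<Psi> p) x = coord (J x)"
    "\<And>a. a \<in> arcs Q \<Longrightarrow> gmap (\<lambda>p. map_at (\<Psi> p) a)"
    "\<And>a p v. a \<in> arcs Q \<Longrightarrow> p \<in> X \<Longrightarrow> v \<in> vs_at (\<Psi> p) (tail Q a) \<Longrightarrow> map_at (\<Psi> p) a v \<in> vs_at (\<Psi> p) (head Q a)"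
    by (rule coord_familyE[OF \<Psi>]) blast
  show ?thesis
    unfolding coord_family_def
  proof (intro conjI ballI exI[of _ "\<lambda>y. J (f y)"])
    fix a p v assume a: "a \<in> arcs Q'" and "p \<in> X" "v \<in> vs_at (pullback f g (\<Psi> p)) (tail Q' a)"
    then show "map_at (pullback f g (\<Psi> p)) a v \<in> vs_at (pullback f g (\<Psi> p)) (head Q' a)"
      using J(4)[OF quiver_homD(2)[OF h a]] quiver_homD(3,4)[OF h a] by (simp add: pullback_def)
  qed (use J quiver_homD[OF h] in \<open>auto simp: pullback_def\<close>)
qed

lemma gmap_summand_proj: "gmap (\<lambda>p. summand_proj y)"
  unfolding gmap_def summand_proj_def using gfun_coord by simp

lemma gmap_summand_inj: "gmap (\<lambda>p. summand_inj y)"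
  unfolding gmap_def
proof
  fix j
  obtain z i where "prod_decode j = (z, i)" by (metis surj_pair)
  then show "gfun (\<lambda>p v. summand_inj y v j)"
    unfolding summand_inj_def using gfun_coord gfun_zero by (cases "z = y") auto
qed

lemma coord_family_pushforward:
  assumes Q: "quiver Q" and h: "quiver_hom Q Q' f g" and \<Psi>: "coord_family Q \<Psi>"
  shows "coord_family Q' (\<lambda>p. pushforward Q f g (\<Psi> p))"
proof -
  obtain J where J: "\<And>x. x \<in> verts Q \<Longrightarrow> finite (J x)"
    "\<And>x p. x \<in> verts Q \<Longrightarrow> p \<in> X \<Longrightarrow> vs_at (\<Psi> p) x = coord (J x)"
    "\<And>a. a \<in> arcs Q \<Longrightarrow> gmap (\<lambda>p. map_at (\<Psi> p) a)"
    "\<And>a p v. a \<in> arcs Q \<Longrightarrow> p \<in> X \<Longrightarrow> v \<in> vs_at (\<Psi> p) (tail Q a) \<Longrightarrow> map_at (\<Psi> p) a v \<in> vs_at (\<Psi> p) (head Q a)"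
    by (rule coord_familyE[OF \<Psi>]) blast
  show ?thesis
    unfolding coord_family_def
  proof (intro conjI ballI exI[of _ "\<lambda>x. prod_encode ` Sigma {y \<in> verts Q. f y = x} J"])
    show "vs_at (pushforward Q f g (\<Psi> p)) x = coord (prod_encode ` Sigma {y \<in> verts Q. f y = x} J)" if "p \<in> X" for p x
      unfolding pushforward_def qrep.simps by (rule direct_sum_coord) (simp add: J(2) that)
    show "finite (prod_encode ` Sigma {y \<in> verts Q. f y = x} J)" for x
      using J(1) quiverD(1)[OF Q] by (intro finite_imageI finite_SigmaI) auto
    show "gmap (\<lambda>p. map_at (pushforward Q f g (\<Psi> p)) a)" for a
      unfolding pushforward_def qrep.simps
      by (intro gmap_sum gmap_comp[OF gmap_summand_inj] gmap_comp[OF J(3) gmap_summand_proj]) auto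
    fix a p v assume a: "a \<in> arcs Q'" and p: "p \<in> X" and v: "v \<in> vs_at (pushforward Q f g (\<Psi> p)) (tail Q' a)"
    note r = coord_family_representation[OF \<Psi> p]
    show "map_at (pushforward Q f g (\<Psi> p)) a v \<in> vs_at (pushforward Q f g (\<Psi> p)) (head Q' a)"
      by (rule pushforward_maps[OF Q h representationD(2)[OF r] representationD(4)[OF r] a v])
  qed
qed

text \<open>Along a sequence of pushforwards and pullbacks both the coordinate model \<Psi> and the
  isomorphism with \<Phi> are carried to the next quiver; only at the end is a global rank
  evaluated, and there \<Phi> is replaced by \<Psi>. The family \<Phi> itself may consist of
  arbitrary choices.\<close>

lemma simple_nat_rank_function:
  assumes "nat_rank_function Q r" "coord_family Q \<Psi>" "\<And>p. p \<in> X \<Longrightarrow> rep_iso Q (\<Psi> p) (\<Phi> p)"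
  shows "simple (\<lambda>p. r (\<Phi> p))"
  using assms
proof (induction arbitrary: \<Psi> \<Phi>)
  case (global Q)
  have "global_rank Q (\<Phi> p) = global_rank Q (\<Psi> p)" if "p \<in> X" for p
    using global_rank_iso[OF global(1) coord_family_representation[OF global(2) that] global(3)[OF that]] .
  then show ?case using simple_global_rank[OF global(1,2)] by (simp cong: simple_cong)
next
  case (push Q Q' f g r)
  show ?case
    by (rule push.IH[OF coord_family_pushforward[OF push.hyps(1,3) push.prems(1)]])
      (rule rep_iso_pushforward[OF push.hyps(1,3) coord_family_representation[OF push.prems(1)] push.prems(2)])
next
  case (pull Q Q' f g r)
  show ?case
    by (rule pull.IH[OF coord_family_pullback[OF pull.hyps(3) pull.prems(1)]])
      (rule rep_iso_pullback[OF pull.hyps(2,3) pull.prems(2)])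
qed

text \<open>The relabelling of a quiver by natural numbers is itself a pullback.\<close>

lemma simple_rank_function:
  assumes "rank_function Q r" "coord_family Q \<Psi>" "\<And>p. p \<in> X \<Longrightarrow> rep_iso Q (\<Psi> p) (\<Phi> p)"
  shows "simple (\<lambda>p. r (\<Phi> p))"
proof -
  obtain Q' f g r' where r: "quiver Q'" "quiver_hom Q' Q f g" "nat_rank_function Q' r'"
    "r = (\<lambda>\<phi>. r' (pullback f g \<phi>))"
    using assms(1) unfolding rank_function_def by blast
  show ?thesis
    unfolding r(4)
    by (rule simple_nat_rank_function[OF r(3) coord_family_pullback[OF r(2) assms(2)]])
      (rule rep_iso_pullback[OF r(1,2) assms(3)])
qed

end

section \<open>Pluecker coordinates and affine charts\<close>

definition coord_proj :: "nat set \<Rightarrow> (nat \<Rightarrow> 'k::field) \<Rightarrow> nat \<Rightarrow> 'k" where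
  "coord_proj I u = (\<lambda>i. if i \<in> I then u i else 0)"

lemma lin_coord_proj: "lin (coord_proj I)"
  by (auto simp: lin_iff coord_proj_def vscale_def fun_eq_iff)

lemma coord_proj_coord: "coord_proj I u \<in> coord I"
  by (simp add: coord_proj_def coord_def)

lemma coord_proj_id: "u \<in> coord I \<Longrightarrow> coord_proj I u = u"
  by (auto simp: coord_proj_def coord_def fun_eq_iff)

lemma coord_proj_eq_0: "coord_proj I u = 0 \<longleftrightarrow> (\<forall>i\<in>I. u i = 0)"
  by (auto simp: coord_proj_def fun_eq_iff)

lemma inj_on_coord_proj_iff:
  "VS.subspace W \<Longrightarrow> inj_on (coord_proj I) W \<longleftrightarrow> (\<forall>w\<in>W. (\<forall>i\<in>I. w i = 0) \<longrightarrow> w = 0)"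
  using VP.linear_inj_on_iff_eq_0[OF lin_coord_proj] by (simp add: coord_proj_eq_0)

lemma chosen_basis:
  assumes "fin_dim W"
  shows "distinct (chosen_basis W)" "VS.independent (set (chosen_basis W))"
    "VS.span (set (chosen_basis W)) = W" "length (chosen_basis W) = VS.dim W"
proof -
  obtain B where B: "VS.independent B" "VS.span B = W" "finite B"
    using fin_dim_basis[OF assms fin_dim_subspace[OF assms] order_refl] by metis
  obtain bs where "set bs = B" "distinct bs" using finite_distinct_list[OF B(3)] by metis
  then have "\<exists>bs. distinct bs \<and> VS.independent (set bs) \<and> VS.span (set bs) = W" using B by metis
  from someI_ex[OF this]
  show 1: "distinct (chosen_basis W)" "VS.independent (set (chosen_basis W))"
    "VS.span (set (chosen_basis W)) = W" by (auto simp: chosen_basis_def)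
  show "length (chosen_basis W) = VS.dim W"
    using 1 VS.dim_span_eq_card_independent[OF 1(2)] by (simp add: distinct_card)
qed

text \<open>The Pluecker coordinate with row set I of an explicit basis;
  \<open>pluecker W (x, I)\<close> is the case of the chosen basis of \<open>W x\<close>.\<close>

definition minor :: "(nat \<Rightarrow> 'k::field) list \<Rightarrow> nat set \<Rightarrow> 'k" where
  "minor bs I = det (mat (card I) (card I) (\<lambda>(i, j). (bs ! j) (sorted_list_of_set I ! i)))"

lemma sum_list_basis:
  assumes "distinct bs"
  shows "(\<Sum>b\<in>set bs. f b) = (\<Sum>j<length bs. f (bs ! j))"
  using sum.reindex_bij_betw[OF bij_betw_nth[OF assms refl refl], of f] by simp

lemma span_list:
  assumes "distinct bs" "w \<in> VS.span (set bs)"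
  obtains c where "\<And>i. w i = (\<Sum>j<length bs. c j * (bs ! j) i)"
proof -
  obtain u where u: "w = (\<Sum>b\<in>set bs. vscale (u b) b)"
    using assms(2) VS.span_finite[of "set bs"] by auto
  have "w i = (\<Sum>j<length bs. u (bs ! j) * (bs ! j) i)" for i
    unfolding u sum_list_basis[OF assms(1)] sum_fun_apply by (simp add: vscale_def)
  then show ?thesis by (rule that)
qed

text \<open>A kernel vector of the minor's matrix would give a nontrivial combination of the basis
  vanishing on all coordinates in I. By assumption such a combination is zero, contradicting
  independence.\<close>

lemma minor_nonzero:
  assumes bs: "distinct bs" "VS.independent (set bs)" and I: "finite I" "card I = length bs"
    and inj: "\<And>w. w \<in> VS.span (set bs) \<Longrightarrow> (\<forall>i\<in>I. w i = 0) \<Longrightarrow> w = 0"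
  shows "minor bs I \<noteq> 0"
proof
  let ?d = "card I" let ?s = "sorted_list_of_set I"
  let ?A = "mat ?d ?d (\<lambda>(i, j). (bs ! j) (?s ! i))"
  assume "minor bs I = 0"
  then have "det ?A = 0" by (simp add: minor_def)
  then obtain v where v: "v \<in> carrier_vec ?d" "v \<noteq> 0\<^sub>v ?d" "?A *\<^sub>v v = 0\<^sub>v ?d"
    using det_0_iff_vec_prod_zero_field[of ?A ?d] by auto
  \<comment> \<open>The coefficients are moved from positions in the list to the basis vectors
    themselves, because independence speaks of a set.\<close>
  define u where "u b = v $ (the_inv_into {..<length bs} ((!) bs) b)" for b
  have inj_nth: "inj_on ((!) bs) {..<length bs}" using bs(1) by (auto simp: inj_on_def nth_eq_iff_index_eq)
  have u: "u (bs ! j) = v $ j" if "j < ?d" for j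
    using the_inv_into_f_f[OF inj_nth, of j] that I(2) by (simp add: u_def)
  define w where "w = (\<Sum>b\<in>set bs. vscale (u b) b)"
  have wi: "w i = (\<Sum>j<?d. v $ j * (bs ! j) i)" for i
    unfolding w_def sum_list_basis[OF bs(1)] sum_fun_apply
    by (rule sum.cong) (auto simp: I(2) vscale_def u)
  have "w i = 0" if i: "i \<in> I" for i
  proof -
    obtain r where r: "r < ?d" "?s ! r = i"
      using i I(1) by (metis in_set_conv_nth length_sorted_list_of_set set_sorted_list_of_set)
    have "(?A *\<^sub>v v) $ r = 0" using v(3) r(1) by simp
    moreover have "(?A *\<^sub>v v) $ r = w i"
      unfolding wi using r v(1) by (simp add: scalar_prod_def lessThan_atLeast0 mult.commute)
    ultimately show ?thesis by simp
  qed
  moreover have "w \<in> VS.span (set bs)"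
    unfolding w_def by (intro VS.span_sum VS.span_scale VS.span_base)
  ultimately have "w = 0" using inj by blast
  then have "u b = 0" if "b \<in> set bs" for b
    using VS.independentD[OF bs(2) finite_set order_refl _ that, of u] w_def by simp
  then have "v $ j = 0" if "j < ?d" for j using u[OF that] that I(2) by simp
  then show False using v(1,2) by auto
qed

text \<open>I is chosen of minimal cardinality with injective projection. Minimality makes the
  projection surjective onto \<open>coord I\<close>, and then the cardinality is the
  dimension.\<close>

lemma exists_injective_coord_proj:
  assumes W: "VS.subspace W" "W \<subseteq> coord {..<n}"
  obtains I where "I \<subseteq> {..<n}" "card I = VS.dim W" "inj_on (coord_proj I) W"
proof -
  define P where "P I \<longleftrightarrow> I \<subseteq> {..<n} \<and> inj_on (coord_proj I) W" for I
  have "P {..<n}"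
    unfolding P_def
    by (intro conjI inj_on_subset[OF _ W(2)] inj_onI) (simp_all add: coord_proj_id)
  then obtain I where I: "P I" "\<And>J. P J \<Longrightarrow> card I \<le> card J"
    using ex_has_least_nat[of P "{..<n}" card] by blast
  have fI: "finite I" using I(1) finite_subset by (auto simp: P_def)
  have inj: "inj_on (coord_proj I) W" using I(1) by (simp add: P_def)
  \<comment> \<open>Dropping i destroys injectivity, so some nonzero w in W vanishes on I - {i}; a
    multiple of it projects to the unit vector.\<close>
  have "unitv i \<in> coord_proj I ` W" if i: "i \<in> I" for i
  proof -
    have "card (I - {i}) < card I" using i fI by (meson card_Diff1_less)
    then have "\<not> P (I - {i})" using I(2) by (meson not_le)
    then obtain w where w: "w \<in> W" "\<forall>j\<in>I - {i}. w j = 0" "w \<noteq> 0"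
      using I(1) inj_on_coord_proj_iff[OF W(1), of "I - {i}"] by (auto simp: P_def)
    have "w i \<noteq> 0" using inj_on_coord_proj_iff[OF W(1), of I] inj w by blast
    then have "coord_proj I (vscale (1 / w i) w) = unitv i"
      using w(2) i by (auto simp: coord_proj_def vscale_def unitv_def fun_eq_iff)
    then show ?thesis using VS.subspace_scale[OF W(1) w(1)] by (metis imageI)
  qed
  then have "coord I \<subseteq> coord_proj I ` W"
    unfolding span_unitv[OF fI, symmetric]
    by (intro VS.span_minimal VP.linear_subspace_image[OF lin_coord_proj W(1)]) auto
  then have "coord_proj I ` W = coord I" using coord_proj_coord by blast
  moreover have "fin_dim W" using fin_dim_mono[OF fin_dim_coord W] by simp
  ultimately have "card I = VS.dim W"
    using dim_image_inj[OF _ lin_coord_proj inj] dim_coord[OF fI, where 'k = 'a] by simp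
  then show ?thesis using that[of I] I(1) by (auto simp: P_def)
qed

text \<open>Removing a row index from the set shifts the later positions exactly as
  \<open>mat_delete\<close> renumbers rows.\<close>

lemma sorted_list_of_set_remove_nth:
  assumes "finite S" "r < card S" "i < card S - 1"
  shows "sorted_list_of_set (S - {sorted_list_of_set S ! r}) ! i = sorted_list_of_set S ! (if i < r then i else Suc i)"
proof -
  let ?s = "sorted_list_of_set S"
  have len: "length ?s = card S" by simp
  have s: "?s = take r ?s @ ?s ! r # drop (Suc r) ?s"
    using assms(2) len by (metis id_take_nth_drop)
  have "?s ! r \<notin> set (take r ?s)"
    using distinct_sorted_list_of_set[of S] by (subst (asm) s) auto
  then have "remove1 (?s ! r) ?s = take r ?s @ drop (Suc r) ?s"
    by (subst (2) s) (simp add: remove1_append)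
  moreover have "sorted_list_of_set (S - {?s ! r}) = remove1 (?s ! r) ?s"
    using sorted_list_of_set_remove[OF assms(1)] .
  ultimately show ?thesis
    using assms(2,3) len by (simp add: nth_append)
qed

text \<open>Adjoining a vector of the column space to the basis gives a singular matrix;
  its determinant is expanded along the new column.\<close>

lemma minor_relation:
  assumes bs: "distinct bs" "w \<in> VS.span (set bs)" and S: "finite S" "card S = Suc (length bs)"
  shows "(\<Sum>r<Suc (length bs). (- 1) ^ r * w (sorted_list_of_set S ! r) *
    minor bs (S - {sorted_list_of_set S ! r})) = 0"
proof -
  let ?d = "length bs" let ?s = "sorted_list_of_set S"
  obtain c where c: "\<And>i. w i = (\<Sum>j<length bs. c j * (bs ! j) i)"
    using span_list[OF bs] by blast
  define A where "A = mat (Suc ?d) (Suc ?d) (\<lambda>(i, j). if j = 0 then w (?s ! i) else (bs ! (j - 1)) (?s ! i))"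
  have A: "A \<in> carrier_mat (Suc ?d) (Suc ?d)" by (simp add: A_def)
  \<comment> \<open>The kernel vector of A expresses that w, the column 0, equals its expansion in
    the basis, the remaining columns.\<close>
  define v where "v = vec (Suc ?d) (\<lambda>j. if j = 0 then 1 else - c (j - 1))"
  have "v \<in> carrier_vec (Suc ?d)" by (simp add: v_def)
  moreover have "v \<noteq> 0\<^sub>v (Suc ?d)"
  proof
    assume "v = 0\<^sub>v (Suc ?d)"
    then have "v $ 0 = 0" by simp
    then show False by (simp add: v_def)
  qed
  moreover have "A *\<^sub>v v = 0\<^sub>v (Suc ?d)"
  proof (rule eq_vecI)
    fix i assume i: "i < dim_vec (0\<^sub>v (Suc ?d) :: 'a vec)"
    then have "(A *\<^sub>v v) $ i = (\<Sum>j<Suc ?d. A $$ (i, j) * v $ j)"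
      using A by (simp add: scalar_prod_def v_def lessThan_atLeast0)
    also have "\<dots> = w (?s ! i) + (\<Sum>j<?d. - (c j * (bs ! j) (?s ! i)))"
      using i by (subst sum.lessThan_Suc_shift) (simp add: A_def v_def mult.commute)
    also have "\<dots> = 0" by (simp add: c sum_negf)
    finally show "(A *\<^sub>v v) $ i = 0\<^sub>v (Suc ?d) $ i" using i by simp
  qed (use A in simp)
  ultimately have "det A = 0" using det_0_iff_vec_prod_zero_field[OF A] by blast
  moreover have "det A = (\<Sum>r<Suc ?d. A $$ (r, 0) * cofactor A r 0)"
    by (rule laplace_expansion_column[OF A]) simp
  moreover have "A $$ (r, 0) * cofactor A r 0 = (- 1) ^ r * w (?s ! r) * minor bs (S - {?s ! r})"
    if r: "r < Suc ?d" for r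
  proof -
    have card: "card (S - {?s ! r}) = ?d"
    proof -
      have "?s ! r \<in> S" using r S by (metis nth_mem length_sorted_list_of_set set_sorted_list_of_set)
      then show ?thesis using S by simp
    qed
    have "mat_delete A r 0 = mat ?d ?d (\<lambda>(i, j). (bs ! j) (sorted_list_of_set (S - {?s ! r}) ! i))"
    proof (rule eq_matI)
      fix i j assume ij: "i < dim_row (mat ?d ?d (\<lambda>(i, j). (bs ! j) (sorted_list_of_set (S - {?s ! r}) ! i)))"
        "j < dim_col (mat ?d ?d (\<lambda>(i, j). (bs ! j) (sorted_list_of_set (S - {?s ! r}) ! i)))"
      have "sorted_list_of_set (S - {?s ! r}) ! i = ?s ! (if i < r then i else Suc i)"
        using ij r S by (intro sorted_list_of_set_remove_nth) auto
      then show "mat_delete A r 0 $$ (i, j) = mat ?d ?d (\<lambda>(i, j). (bs ! j) (sorted_list_of_set (S - {?s ! r}) ! i)) $$ (i, j)"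
        using ij r by (simp add: mat_delete_def A_def)
    qed (use A in \<open>simp_all add: mat_delete_def\<close>)
    then have "det (mat_delete A r 0) = minor bs (S - {?s ! r})" unfolding minor_def card by simp
    then show ?thesis using r by (simp add: cofactor_def A_def)
  qed
  ultimately show ?thesis by simp
qed

context function_ring
begin

section \<open>The inverse of the coordinate projection on a chart\<close>

lemma G_scale: "g \<in> G \<Longrightarrow> (\<lambda>p. c * g p) \<in> G"
  using G_mult[OF G_const] .

lemma gmap_coord_proj: "gmap (\<lambda>p. coord_proj I)"
  unfolding gmap_def coord_proj_def
proof
  show "gfun (\<lambda>p v. if i \<in> I then v i else 0)" for i
    using gfun_coord gfun_zero by (cases "i \<in> I") auto
qed

text \<open>For k outside I, \<open>minor_relation\<close> with the row set
  \<open>insert k I\<close> contains the coordinate k with coefficient the minor at I, up to sign,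
  and otherwise only coordinates in I. Solving for the k-th coordinate expresses it by ratios of
  minors, which lie in G.\<close>

lemma chart_section:
  assumes I: "I \<subseteq> {..<n}"
    and W: "\<And>p. p \<in> X \<Longrightarrow> VS.subspace (W p)" "\<And>p. p \<in> X \<Longrightarrow> W p \<subseteq> coord {..<n}"
      "\<And>p. p \<in> X \<Longrightarrow> VS.dim (W p) = card I"
    and nz: "\<And>p. p \<in> X \<Longrightarrow> minor (chosen_basis (W p)) I \<noteq> 0"
    and G: "\<And>J. J \<subseteq> {..<n} \<Longrightarrow> card J = card I \<Longrightarrow>
      (\<lambda>p. minor (chosen_basis (W p)) J / minor (chosen_basis (W p)) I) \<in> G"
  obtains \<sigma> where "gmap \<sigma>" "\<And>p u. p \<in> X \<Longrightarrow> u \<in> coord I \<Longrightarrow> \<sigma> p u \<in> W p"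
    "\<And>p u. p \<in> X \<Longrightarrow> u \<in> coord I \<Longrightarrow> coord_proj I (\<sigma> p u) = u"
    "\<And>p w. p \<in> X \<Longrightarrow> w \<in> W p \<Longrightarrow> \<sigma> p (coord_proj I w) = w"
proof -
  have fI: "finite I" using I finite_subset by blast
  let ?d = "card I"
  define s where "s k = sorted_list_of_set (insert k I)" for k
  have s: "length (s k) = Suc ?d" "distinct (s k)" "set (s k) = insert k I" if "k \<notin> I" for k
    unfolding s_def length_sorted_list_of_set
    using fI that by (auto simp only: card_insert_disjoint set_sorted_list_of_set
        distinct_sorted_list_of_set finite_insert simp_thms)
  \<comment> \<open>The position of k in the sorted row set decides the sign of its term in the
    relation.\<close>
  have "\<exists>r. r < Suc ?d \<and> s k ! r = k" if "k \<notin> I" for k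
    using s[OF that] by (metis in_set_conv_nth insertI1)
  then obtain r0 where r0: "\<And>k. k \<notin> I \<Longrightarrow> r0 k < Suc ?d" "\<And>k. k \<notin> I \<Longrightarrow> s k ! r0 k = k" by metis
  define q where "q J p = minor (chosen_basis (W p)) J / minor (chosen_basis (W p)) I" for J p
  \<comment> \<open>The coefficient after solving for the coordinate k; the sign belonging to k is
    its own inverse and therefore appears as a factor.\<close>
  define c where "c k r p = (- ((- 1) ^ r0 k * (- 1) ^ r)) * q (insert k I - {s k ! r}) p" for k r p
  define \<sigma> where "\<sigma> p u = (\<lambda>k. if k \<in> I then u k else if k < n
     then (\<Sum>r\<in>{..<Suc ?d} - {r0 k}. c k r p * u (s k ! r)) else 0)" for p and u :: "nat \<Rightarrow> 'k"
  have g: "gmap \<sigma>"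
    unfolding gmap_def
  proof
    fix k
    show "gfun (\<lambda>p u. \<sigma> p u k)"
    proof (cases "k \<in> I \<or> \<not> k < n")
      case True
      then show ?thesis by (cases "k \<in> I") (auto simp: \<sigma>_def gfun_coord gfun_zero)
    next
      case False
      have "c k r \<in> G" if r: "r < Suc ?d" for r
      proof -
        have m: "s k ! r \<in> insert k I" using s[of k] r False nth_mem by metis
        have "insert k I - {s k ! r} \<subseteq> {..<n}" using I False by auto
        moreover have "card (insert k I - {s k ! r}) = card I" using m False fI by simp
        ultimately show ?thesis
          unfolding c_def using G[unfolded q_def[symmetric]] by (intro G_scale) auto
      qed
      then have "gfun (\<lambda>p u. \<Sum>r\<in>{..<Suc ?d} - {r0 k}. c k r p * u (s k ! r))"
        by (intro gfun_sum gfun_mult gfun_coord) auto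
      then show ?thesis using False by (simp add: \<sigma>_def)
    qed
  qed
  have key: "\<sigma> p (coord_proj I w) = w" if p: "p \<in> X" and w: "w \<in> W p" for p w
  proof
    fix k
    show "\<sigma> p (coord_proj I w) k = w k"
    proof (cases "k \<in> I \<or> \<not> k < n")
      case True
      then show ?thesis using W(2)[OF p] w by (auto simp: \<sigma>_def coord_proj_def coord_def)
    next
      case False
      then have k: "k \<notin> I" "k < n" by auto
      have fd: "fin_dim (W p)" using fin_dim_mono[OF fin_dim_coord W(1,2)[OF p]] by simp
      let ?b = "chosen_basis (W p)" let ?t = "\<lambda>r. (- 1) ^ r * w (s k ! r) * minor ?b (insert k I - {s k ! r})"
      have "(\<Sum>r<Suc ?d. ?t r) = 0"
        using minor_relation[of ?b w "insert k I"] chosen_basis[OF fd] w fI k(1) W(3)[OF p] by (simp add: s_def)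
      then have "?t (r0 k) + (\<Sum>r\<in>{..<Suc ?d} - {r0 k}. ?t r) = 0"
        using sum.remove[of "{..<Suc ?d}" "r0 k" ?t] r0(1)[OF k(1)] by simp
      moreover have "insert k I - {s k ! r0 k} = I" using r0(2)[OF k(1)] k(1) by auto
      ultimately have "(- 1) ^ r0 k * w k * minor ?b I = - (\<Sum>r\<in>{..<Suc ?d} - {r0 k}. ?t r)"
        using r0(2)[OF k(1)] by (simp add: eq_neg_iff_add_eq_0)
      then have "(- 1) ^ r0 k * ((- 1) ^ r0 k * w k * minor ?b I) =
        (\<Sum>r\<in>{..<Suc ?d} - {r0 k}. - ((- 1) ^ r0 k * ?t r))"
        by (simp add: sum_distrib_left sum_negf)
      moreover have "(- 1) ^ r0 k * ((- 1) ^ r0 k * w k * minor ?b I) = w k * minor ?b I"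
        by (simp add: mult.assoc[symmetric] power_mult_distrib[symmetric])
      ultimately have "w k = (\<Sum>r\<in>{..<Suc ?d} - {r0 k}. - ((- 1) ^ r0 k * ?t r)) / minor ?b I"
        using nz[OF p] by (simp add: field_simps)
      also have "\<dots> = (\<Sum>r\<in>{..<Suc ?d} - {r0 k}. c k r p * coord_proj I w (s k ! r))"
        unfolding sum_divide_distrib
      proof (rule sum.cong[OF refl])
        fix r assume r: "r \<in> {..<Suc ?d} - {r0 k}"
        then have "s k ! r \<noteq> k"
          using s[OF k(1)] r0[OF k(1)] by (metis DiffD1 DiffD2 insertI1 lessThan_iff nth_eq_iff_index_eq)
        moreover have "s k ! r \<in> insert k I" using s[OF k(1)] r nth_mem[of r "s k"] by auto
        ultimately have "coord_proj I w (s k ! r) = w (s k ! r)" by (simp add: coord_proj_def)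
        then show "- ((- 1) ^ r0 k * ?t r) / minor ?b I = c k r p * coord_proj I w (s k ! r)"
          by (simp add: c_def q_def)
      qed
      finally show ?thesis using k by (simp add: \<sigma>_def)
    qed
  qed
  \<comment> \<open>So far \<sigma> is only a left inverse on \<open>W p\<close>. Injectivity and
    equal dimensions make the projection onto \<open>coord I\<close> surjective, and therefore
    \<sigma> takes values in \<open>W p\<close>.\<close>
  have img: "coord_proj I ` W p = coord I" if p: "p \<in> X" for p
  proof -
    have fd: "fin_dim (W p)" using fin_dim_mono[OF fin_dim_coord W(1,2)[OF p]] by simp
    have "inj_on (coord_proj I) (W p)" by (rule inj_on_inverseI[where g = "\<sigma> p"]) (rule key[OF p])
    then have "VS.dim (coord_proj I ` W p) = card I" using dim_image_inj[OF fd lin_coord_proj] W(3)[OF p] by simp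
    then show ?thesis
      using dim_eq_imp_eq[OF fin_dim_coord[OF fI] VP.linear_subspace_image[OF lin_coord_proj W(1)[OF p]]]
        coord_proj_coord dim_coord[OF fI, where 'k = 'k] by (metis image_subsetI)
  qed
  have "\<sigma> p u \<in> W p \<and> coord_proj I (\<sigma> p u) = u" if p: "p \<in> X" and u: "u \<in> coord I" for p u
  proof -
    obtain w where "w \<in> W p" "u = coord_proj I w" using img[OF p] u by blast
    then show ?thesis using key[OF p] by simp
  qed
  then show ?thesis using that g key by blast
qed

end

section \<open>Coordinate models of the subrepresentation and the quotient on a chart\<close>

context function_ring
begin

text \<open>The subrepresentation is conjugated by \<sigma> and the projection to
  \<open>I x\<close>. For the quotient, subtracting the element of W with the same coordinates in
  \<open>I x\<close> leaves a vector supported on the complementary coordinates.\<close>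

lemma coord_family_subrep_quotient:
  assumes Q: "quiver Q" and \<phi>: "\<phi> \<in> rep_space Q \<alpha>"
    and W: "\<And>p. p \<in> X \<Longrightarrow> W p \<in> quiver_grassmannian Q \<alpha> \<beta> \<phi>"
    and I: "\<And>x. x \<in> verts Q \<Longrightarrow> I x \<subseteq> {..<\<alpha> x}" "\<And>x. x \<in> verts Q \<Longrightarrow> card (I x) = \<beta> x"
    and nz: "\<And>x p. x \<in> verts Q \<Longrightarrow> p \<in> X \<Longrightarrow> pluecker (W p) (x, I x) \<noteq> 0"
    and G: "\<And>x J. x \<in> verts Q \<Longrightarrow> J \<subseteq> {..<\<alpha> x} \<Longrightarrow> card J = \<beta> x \<Longrightarrow>
      (\<lambda>p. pluecker (W p) (x, J) / pluecker (W p) (x, I x)) \<in> G"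
  shows "\<exists>\<Psi>. coord_family Q \<Psi> \<and> (\<forall>p\<in>X. rep_iso Q (\<Psi> p) (restrict_rep \<phi> (W p)))"
    and "\<exists>\<Psi>. coord_family Q \<Psi> \<and> (\<forall>p\<in>X. rep_iso Q (\<Psi> p) (quotient_rep Q \<phi> (W p)))"
proof -
  have r: "representation Q \<phi>" and vs: "vs_at \<phi> x = coord {..<\<alpha> x}" if "x \<in> verts Q" for x
    using \<phi> that by (auto simp: rep_space_def std_space_coord)
  have Wx: "VS.subspace (W p x)" "W p x \<subseteq> coord {..<\<alpha> x}" "VS.dim (W p x) = card (I x)"
    if "p \<in> X" "x \<in> verts Q" for p x
    using W[OF that(1)] that(2) I(2)[OF that(2)]
    by (auto simp: quiver_grassmannian_def subrep_bundle_def grassmannian_def std_space_coord)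
  have Woff: "W p x = {0}" if "p \<in> X" "x \<notin> verts Q" for p x
    using W[OF that(1)] that(2) by (auto simp: quiver_grassmannian_def subrep_bundle_def grassmannian_def)
  have Wmap: "map_at \<phi> a v \<in> W p (head Q a)" if "p \<in> X" "a \<in> arcs Q" "v \<in> W p (tail Q a)" for p a v
    using W[OF that(1)] that(2,3) by (auto simp: quiver_grassmannian_def subrep_bundle_def)
  have "\<exists>\<sigma>. gmap \<sigma> \<and> (\<forall>p\<in>X. \<forall>u\<in>coord (I x). \<sigma> p u \<in> W p x) \<and>
    (\<forall>p\<in>X. \<forall>u\<in>coord (I x). coord_proj (I x) (\<sigma> p u) = u) \<and>
    (\<forall>p\<in>X. \<forall>w\<in>W p x. \<sigma> p (coord_proj (I x) w) = w)" if x: "x \<in> verts Q" for x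
  proof -
    have nz': "minor (chosen_basis (W p x)) (I x) \<noteq> 0" if "p \<in> X" for p
      using nz[OF x that] by (simp add: pluecker_def minor_def)
    have G': "(\<lambda>p. minor (chosen_basis (W p x)) J / minor (chosen_basis (W p x)) (I x)) \<in> G"
      if "J \<subseteq> {..<\<alpha> x}" "card J = card (I x)" for J
      using G[OF x that(1)] that(2) I(2)[OF x] by (simp add: pluecker_def minor_def)
    show ?thesis
    proof (rule chart_section[of "I x" "\<alpha> x" "\<lambda>p. W p x"])
      fix \<sigma> assume "gmap \<sigma>" "\<And>p u. p \<in> X \<Longrightarrow> u \<in> coord (I x) \<Longrightarrow> \<sigma> p u \<in> W p x"
        "\<And>p u. p \<in> X \<Longrightarrow> u \<in> coord (I x) \<Longrightarrow> coord_proj (I x) (\<sigma> p u) = u"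
        "\<And>p w. p \<in> X \<Longrightarrow> w \<in> W p x \<Longrightarrow> \<sigma> p (coord_proj (I x) w) = w"
      then show ?thesis by (intro exI[of _ \<sigma>]) simp
    qed (use I(1)[OF x] Wx(1)[OF _ x] Wx(2)[OF _ x] Wx(3)[OF _ x] nz' G' in \<open>simp_all\<close>)
  qed
  then have "\<exists>\<sigma>. \<forall>x\<in>verts Q. gmap (\<sigma> x) \<and> (\<forall>p\<in>X. \<forall>u\<in>coord (I x). \<sigma> x p u \<in> W p x) \<and>
    (\<forall>p\<in>X. \<forall>u\<in>coord (I x). coord_proj (I x) (\<sigma> x p u) = u) \<and>
    (\<forall>p\<in>X. \<forall>w\<in>W p x. \<sigma> x p (coord_proj (I x) w) = w)" by (intro bchoice ballI)
  then obtain \<sigma> where *: "\<forall>x\<in>verts Q. gmap (\<sigma> x) \<and> (\<forall>p\<in>X. \<forall>u\<in>coord (I x). \<sigma> x p u \<in> W p x) \<and>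
    (\<forall>p\<in>X. \<forall>u\<in>coord (I x). coord_proj (I x) (\<sigma> x p u) = u) \<and>
    (\<forall>p\<in>X. \<forall>w\<in>W p x. \<sigma> x p (coord_proj (I x) w) = w)" by (rule exE)
  have \<sigma>: "\<And>x. x \<in> verts Q \<Longrightarrow> gmap (\<sigma> x)"
    "\<And>x p u. x \<in> verts Q \<Longrightarrow> p \<in> X \<Longrightarrow> u \<in> coord (I x) \<Longrightarrow> \<sigma> x p u \<in> W p x"
    "\<And>x p u. x \<in> verts Q \<Longrightarrow> p \<in> X \<Longrightarrow> u \<in> coord (I x) \<Longrightarrow> coord_proj (I x) (\<sigma> x p u) = u"
    "\<And>x p w. x \<in> verts Q \<Longrightarrow> p \<in> X \<Longrightarrow> w \<in> W p x \<Longrightarrow> \<sigma> x p (coord_proj (I x) w) = w"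
    using * by simp_all
  \<comment> \<open>The arrow maps are fixed but constrained only on their domain; F is the matrix
    in unit vectors, cut off at the dimension of the head, hence a \<open>gmap\<close> with constant
    coefficients.\<close>
  define F where "F a v = (\<lambda>i. if i < \<alpha> (head Q a) then
    (\<Sum>j<\<alpha> (tail Q a). map_at \<phi> a (unitv j) i * v j) else 0)" for a and v :: "nat \<Rightarrow> 'k"
  have gF: "gmap (\<lambda>p. F a)" for a
    unfolding gmap_def
  proof
    fix i
    have "gfun (\<lambda>p v. \<Sum>j<\<alpha> (tail Q a). map_at \<phi> a (unitv j) i * v j)"
      by (intro gfun_sum gfun_scale gfun_coord)
    then show "gfun (\<lambda>p v. F a v i)" by (cases "i < \<alpha> (head Q a)") (simp_all add: F_def gfun_zero)
  qed
  have F: "F a v = map_at \<phi> a v" if a: "a \<in> arcs Q" and v: "v \<in> coord {..<\<alpha> (tail Q a)}" for a v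
  proof -
    note t = quiverD(3)[OF Q a] and h = quiverD(4)[OF Q a]
    obtain g where g: "lin g" "\<forall>v\<in>coord {..<\<alpha> (tail Q a)}. g v = map_at \<phi> a v"
      using linear_between_extend[OF subspace_coord] representationD(3)[OF r[OF t] a] vs[OF t] by metis
    have "g v = (\<Sum>j<\<alpha> (tail Q a). vscale (v j) (g (unitv j)))"
      by (subst coord_expand[OF finite_lessThan v]) (simp add: VP.linear_sum[OF g(1)] linD[OF g(1)])
    then have "map_at \<phi> a v i = (\<Sum>j<\<alpha> (tail Q a). map_at \<phi> a (unitv j) i * v j)" for i
      using g(2) v by (simp add: sum_fun_apply vscale_def unitv_coord mult.commute)
    moreover have "map_at \<phi> a v i = 0" if "\<not> i < \<alpha> (head Q a)" for i
      using representationD(4)[OF r[OF t] a, of v] v vs[OF t] vs[OF h] that by (simp add: coord_def)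
    ultimately show ?thesis by (auto simp: F_def)
  qed
  have Fin: "F a v \<in> coord {..<\<alpha> (head Q a)}" for a v by (simp add: F_def coord_def)

  define \<Psi> where "\<Psi> p = \<lparr>vs_at = (\<lambda>x. coord (I x)),
    map_at = (\<lambda>a v. coord_proj (I (head Q a)) (F a (\<sigma> (tail Q a) p v)))\<rparr>" for p
  have "coord_family Q \<Psi>"
    unfolding coord_family_def
  proof (intro conjI ballI exI[of _ I])
    show "gmap (\<lambda>p. map_at (\<Psi> p) a)" if "a \<in> arcs Q" for a
      unfolding \<Psi>_def qrep.simps
      by (intro gmap_comp[OF gmap_coord_proj] gmap_comp[OF gF] \<sigma>(1) quiverD(3)[OF Q that])
  qed (use finite_subset[OF I(1)] in \<open>auto simp: \<Psi>_def coord_proj_coord\<close>)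
  moreover have "rep_iso Q (\<Psi> p) (restrict_rep \<phi> (W p))" if p: "p \<in> X" for p
  proof -
    have "iso_pair Q (\<Psi> p) (restrict_rep \<phi> (W p)) (\<lambda>x. \<sigma> x p) (\<lambda>x. coord_proj (I x))"
      unfolding iso_pair_def
    proof (intro conjI ballI)
      fix a v assume a: "a \<in> arcs Q" and v: "v \<in> vs_at (\<Psi> p) (tail Q a)"
      note t = quiverD(3)[OF Q a] and h = quiverD(4)[OF Q a]
      have w: "\<sigma> (tail Q a) p v \<in> W p (tail Q a)" using \<sigma>(2)[OF t p] v by (simp add: \<Psi>_def)
      then have "F a (\<sigma> (tail Q a) p v) = map_at \<phi> a (\<sigma> (tail Q a) p v)"
        using F[OF a] Wx(2)[OF p t] by blast
      then show "\<sigma> (head Q a) p (map_at (\<Psi> p) a v) = map_at (restrict_rep \<phi> (W p)) a (\<sigma> (tail Q a) p v)"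
        using \<sigma>(4)[OF h p Wmap[OF p a w]] by (simp add: \<Psi>_def restrict_rep_def)
    qed (use \<sigma> p in \<open>auto simp: \<Psi>_def restrict_rep_def lin_coord_proj coord_proj_coord intro: gmap_lin\<close>)
    then show ?thesis unfolding rep_iso_def by blast
  qed
  ultimately show "\<exists>\<Psi>. coord_family Q \<Psi> \<and> (\<forall>p\<in>X. rep_iso Q (\<Psi> p) (restrict_rep \<phi> (W p)))" by blast

  define C where "C x = {..<\<alpha> x} - I x" for x
  \<comment> \<open>Projection along W onto the coordinates outside \<open>I x\<close>. The outer
    \<open>coord_proj\<close> does not change the value on the space at x, as \<open>\<pi>eq\<close>
    shows; it ensures that all values lie in \<open>coord (C x)\<close> for arbitrary
    arguments.\<close>
  define \<pi> where "\<pi> x p v = coord_proj (C x) (v - \<sigma> x p (coord_proj (I x) v))" for x p v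
  define \<Theta> where "\<Theta> p = \<lparr>vs_at = (\<lambda>x. coord (C x)), map_at = (\<lambda>a v. \<pi> (head Q a) p (F a v))\<rparr>" for p
  have g\<pi>: "gmap (\<pi> x)" if x: "x \<in> verts Q" for x
  proof -
    have "gmap (\<lambda>p v. v - \<sigma> x p (coord_proj (I x) v))"
      using gmap_comp[OF \<sigma>(1)[OF x] gmap_coord_proj[of "I x"]] gmap_id
      unfolding gmap_def by (auto intro: gfun_diff)
    from gmap_comp[OF gmap_coord_proj this] show ?thesis unfolding \<pi>_def .
  qed
  have \<pi>C: "\<pi> x p v \<in> coord (C x)" for x p v by (simp add: \<pi>_def coord_proj_coord)
  have fC: "finite (C x)" for x by (simp add: C_def)
  have fam: "coord_family Q \<Theta>"
    unfolding coord_family_def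
  proof (intro conjI ballI exI[of _ C])
    show "gmap (\<lambda>p. map_at (\<Theta> p) a)" if "a \<in> arcs Q" for a
      unfolding \<Theta>_def qrep.simps by (intro gmap_comp[OF g\<pi>] gF quiverD(4)[OF Q that])
  qed (auto simp: \<Theta>_def \<pi>C fC)
  have "rep_iso Q (\<Theta> p) (quotient_rep Q \<phi> (W p))" if p: "p \<in> X" for p
  proof -
    have \<pi>eq: "\<pi> x p v = v - \<sigma> x p (coord_proj (I x) v)" if x: "x \<in> verts Q" and v: "v \<in> coord {..<\<alpha> x}" for x v
    proof -
      have "\<sigma> x p (coord_proj (I x) v) \<in> W p x" using \<sigma>(2)[OF x p coord_proj_coord] .
      then have "\<sigma> x p (coord_proj (I x) v) \<in> coord {..<\<alpha> x}" using Wx(2)[OF p x] by blast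
      moreover have "coord_proj (I x) (\<sigma> x p (coord_proj (I x) v)) = coord_proj (I x) v"
        by (rule \<sigma>(3)[OF x p coord_proj_coord])
      then have "\<sigma> x p (coord_proj (I x) v) i = v i" if "i \<in> I x" for i
        using that unfolding coord_proj_def by (metis (full_types))
      ultimately have "v - \<sigma> x p (coord_proj (I x) v) \<in> coord (C x)"
        using v by (auto simp: coord_def C_def)
      then show ?thesis by (simp add: \<pi>_def coord_proj_id)
    qed
    have s: "subrep Q \<phi> (W p)"
      unfolding subrep_def using Wx[OF p] Woff[OF p] Wmap[OF p] vs by auto
    have "is_quotient Q \<phi> (W p) (\<Theta> p, \<lambda>x. \<pi> x p)"
      unfolding is_quotient_def prod.case
    proof (intro conjI ballI)
      show "representation Q (\<Theta> p)" by (rule coord_family_representation[OF fam p])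
      fix x assume x: "x \<in> verts Q"
      note l = gmap_lin[OF \<sigma>(1)[OF x] p]
      show "linear_between (vs_at \<phi> x) (vs_at (\<Theta> p) x) (\<pi> x p)"
        by (rule lin_linear_between[OF gmap_lin[OF g\<pi>[OF x] p]]) (auto simp: \<Theta>_def \<pi>C)
      have "v \<in> \<pi> x p ` coord {..<\<alpha> x}" if v: "v \<in> coord (C x)" for v
      proof -
        have "coord_proj (I x) v = 0" using v by (auto simp: coord_proj_eq_0 coord_def C_def)
        moreover have "v \<in> coord {..<\<alpha> x}" using v by (auto simp: coord_def C_def)
        ultimately show ?thesis using \<pi>eq[OF x] linD(3)[OF l] by (metis diff_zero image_eqI)
      qed
      then show "\<pi> x p ` vs_at \<phi> x = vs_at (\<Theta> p) x"
        using \<pi>C by (auto simp: \<Theta>_def vs[OF x])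
      show "{v \<in> vs_at \<phi> x. \<pi> x p v = 0} = W p x"
      proof (intro equalityI subsetI)
        fix v assume "v \<in> {v \<in> vs_at \<phi> x. \<pi> x p v = 0}"
        then have "v = \<sigma> x p (coord_proj (I x) v)" using \<pi>eq[OF x, of v] vs[OF x] by simp
        then show "v \<in> W p x" using \<sigma>(2)[OF x p coord_proj_coord] by metis
      next
        fix v assume v: "v \<in> W p x"
        then show "v \<in> {v \<in> vs_at \<phi> x. \<pi> x p v = 0}"
          using \<pi>eq[OF x, of v] vs[OF x] Wx(2)[OF p x] \<sigma>(4)[OF x p v] by auto
      qed
    next
      fix a v assume a: "a \<in> arcs Q" and v: "v \<in> vs_at \<phi> (tail Q a)"
      note t = quiverD(3)[OF Q a] and h = quiverD(4)[OF Q a]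
      \<comment> \<open>Replacing v by its class changes it by ?w in W, whose image under the arrow
        lies in W again and is killed by the projection at the head.\<close>
      let ?w = "\<sigma> (tail Q a) p (coord_proj (I (tail Q a)) v)"
      have w: "?w \<in> W p (tail Q a)" by (rule \<sigma>(2)[OF t p coord_proj_coord])
      then have "F a ?w \<in> W p (head Q a)" using F[OF a] Wx(2)[OF p t] Wmap[OF p a w] by (metis subsetD)
      then have "\<pi> (head Q a) p (F a ?w) = 0"
        using \<pi>eq[OF h Fin] \<sigma>(4)[OF h p] by simp
      moreover have "\<pi> (tail Q a) p v = v - ?w" using \<pi>eq[OF t] v vs[OF t] by simp
      ultimately have "map_at (\<Theta> p) a (\<pi> (tail Q a) p v) = \<pi> (head Q a) p (F a v)"
        using linD(4)[OF gmap_lin[OF gF p]] linD(4)[OF gmap_lin[OF g\<pi>[OF h] p]] by (simp add: \<Theta>_def)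
      then show "\<pi> (head Q a) p (map_at \<phi> a v) = map_at (\<Theta> p) a (\<pi> (tail Q a) p v)"
        using F[OF a] v vs[OF t] by simp
    qed
    \<comment> \<open>The fact \<open>r\<close> was stated relative to a vertex, hence the
      distinction whether there is one.\<close>
    then show ?thesis
    proof (cases "verts Q = {}")
      case True
      then show ?thesis using quiverD(3)[OF Q] by (auto simp: rep_iso_def iso_pair_def)
    next
      case False
      then have r: "representation Q \<phi>" using r by blast
      show ?thesis
        using \<open>is_quotient Q \<phi> (W p) (\<Theta> p, \<lambda>x. \<pi> x p)\<close> is_quotient_quotient_rep[OF Q r s]
        by (rule rep_iso_quotients[OF Q r])
    qed
  qed
  then show "\<exists>\<Psi>. coord_family Q \<Psi> \<and> (\<forall>p\<in>X. rep_iso Q (\<Psi> p) (quotient_rep Q \<phi> (W p)))" using fam by blast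
qed

end

section \<open>Multihomogeneous polynomials in the Pluecker coordinates\<close>

definition monom_eval :: "('x \<Rightarrow> 'k::field) \<Rightarrow> ('x \<Rightarrow>\<^sub>0 nat) \<Rightarrow> 'k" where
  "monom_eval c m = (\<Prod>v\<in>Poly_Mapping.keys m. c v ^ Poly_Mapping.lookup m v)"

text \<open>Allows two monomials to be evaluated over one common index set; the analogous lemmas for
  polynomials and degrees serve the same purpose.\<close>

lemma monom_eval_superset:
  "finite A \<Longrightarrow> Poly_Mapping.keys m \<subseteq> A \<Longrightarrow> monom_eval c m = (\<Prod>v\<in>A. c v ^ Poly_Mapping.lookup m v)"
  unfolding monom_eval_def by (intro prod.mono_neutral_left) (auto simp: in_keys_iff)

lemma monom_eval_add: "monom_eval c (m + n) = monom_eval c m * monom_eval c n"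
proof -
  let ?A = "Poly_Mapping.keys m \<union> Poly_Mapping.keys n"
  have "finite ?A" "Poly_Mapping.keys (m + n) \<subseteq> ?A"
    by (simp, rule Poly_Mapping.keys_add)
  then show ?thesis
    by (simp add: monom_eval_superset[of ?A] lookup_add power_add prod.distrib)
qed

lemma mpoly_eval_superset:
  "finite A \<Longrightarrow> Poly_Mapping.keys F \<subseteq> A \<Longrightarrow> mpoly_eval c F = (\<Sum>m\<in>A. Poly_Mapping.lookup F m * monom_eval c m)"
  unfolding mpoly_eval_def monom_eval_def by (intro sum.mono_neutral_left) (auto simp: in_keys_iff)

lemma mpoly_eval_add: "mpoly_eval c (F + H) = mpoly_eval c F + mpoly_eval c H"
proof -
  let ?A = "Poly_Mapping.keys F \<union> Poly_Mapping.keys H"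
  have "finite ?A" "Poly_Mapping.keys (F + H) \<subseteq> ?A"
    by (simp, rule Poly_Mapping.keys_add)
  then show ?thesis
    by (simp add: mpoly_eval_superset[of ?A] lookup_add distrib_right sum.distrib)
qed

lemma mpoly_eval_sum: "mpoly_eval c (\<Sum>i\<in>J. F i) = (\<Sum>i\<in>J. mpoly_eval c (F i))"
  by (induction J rule: infinite_finite_induct) (simp_all add: mpoly_eval_add, simp_all add: mpoly_eval_def)

lemma mpoly_eval_single: "mpoly_eval c (Poly_Mapping.single m a) = a * monom_eval c m"
  by (subst mpoly_eval_superset[of "{m}"]) auto

section \<open>Multidegrees and the functions given by multihomogeneous polynomials\<close>

definition monom_degree :: "'v \<Rightarrow> ('v \<times> 'i \<Rightarrow>\<^sub>0 nat) \<Rightarrow> nat" where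
  "monom_degree x m = (\<Sum>v | v \<in> Poly_Mapping.keys m \<and> fst v = x. Poly_Mapping.lookup m v)"

lemma monom_degree_superset:
  assumes "finite A" "Poly_Mapping.keys m \<subseteq> A"
  shows "monom_degree x m = (\<Sum>v | v \<in> A \<and> fst v = x. Poly_Mapping.lookup m v)"
  unfolding monom_degree_def using assms by (intro sum.mono_neutral_left) (auto simp: in_keys_iff)

lemma monom_degree_add: "monom_degree x (m + n) = monom_degree x m + monom_degree x n"
proof -
  let ?A = "Poly_Mapping.keys m \<union> Poly_Mapping.keys n"
  have "finite ?A" "Poly_Mapping.keys (m + n) \<subseteq> ?A"
    by (simp, rule Poly_Mapping.keys_add)
  then show ?thesis
    by (simp only: monom_degree_superset[of ?A] Un_upper1 Un_upper2 lookup_add sum.distrib)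
qed

text \<open>The degree vector is a parameter, since a sum of multihomogeneous polynomials is
  controlled only when they share it. The zero polynomial has every multidegree.\<close>

definition multidegree ::
  "('v,'e) pre_digraph \<Rightarrow> ('v \<Rightarrow> nat) \<Rightarrow> ('v \<Rightarrow> nat) \<Rightarrow> ('v \<Rightarrow> nat) \<Rightarrow> ('v \<times> nat set, 'k::field) mpoly \<Rightarrow> bool" where
  "multidegree Q \<alpha> \<beta> d F \<longleftrightarrow> (\<forall>m\<in>Poly_Mapping.keys F.
     (\<forall>(x, I)\<in>Poly_Mapping.keys m. x \<in> verts Q \<and> I \<subseteq> {..<\<alpha> x} \<and> card I = \<beta> x) \<and>
     (\<forall>x\<in>verts Q. monom_degree x m = d x))"

lemma multihomogeneous_iff: "multihomogeneous Q \<alpha> \<beta> F \<longleftrightarrow> (\<exists>d. multidegree Q \<alpha> \<beta> d F)"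
  by (simp add: multihomogeneous_def multidegree_def monom_degree_def)

lemma multidegree_sum:
  assumes "\<And>i. i \<in> J \<Longrightarrow> multidegree Q \<alpha> \<beta> d (F i)"
  shows "multidegree Q \<alpha> \<beta> d (\<Sum>i\<in>J. F i)"
  using assms Poly_Mapping.keys_sum[of F J] unfolding multidegree_def by blast

lemma multidegree_add:
  assumes "multidegree Q \<alpha> \<beta> d F" "multidegree Q \<alpha> \<beta> d H"
  shows "multidegree Q \<alpha> \<beta> d (F + H)"
  using assms Poly_Mapping.keys_add[of F H] unfolding multidegree_def by blast

definition pluecker_forms ::
  "('v,'e) pre_digraph \<Rightarrow> ('v \<Rightarrow> nat) \<Rightarrow> ('v \<Rightarrow> nat) \<Rightarrow> ('v \<Rightarrow> nat) \<Rightarrow>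
   (('v \<Rightarrow> (nat \<Rightarrow> 'k::field) set) \<Rightarrow> 'k) set" where
  "pluecker_forms Q \<alpha> \<beta> d = {\<lambda>W. mpoly_eval (pluecker W) F | F. multidegree Q \<alpha> \<beta> d F}"

lemma pluecker_forms_const: "(\<lambda>W. c) \<in> pluecker_forms Q \<alpha> \<beta> (\<lambda>_. 0)"
proof -
  have "multidegree Q \<alpha> \<beta> (\<lambda>_. 0) (Poly_Mapping.single 0 c)"
    by (auto simp: multidegree_def monom_degree_def)
  moreover have "(\<lambda>W. c) = (\<lambda>W. mpoly_eval (pluecker W) (Poly_Mapping.single 0 c))"
    by (simp add: mpoly_eval_single monom_eval_def)
  ultimately show ?thesis unfolding pluecker_forms_def by blast
qed

lemma pluecker_forms_coordinate:
  assumes "x \<in> verts Q" "I \<subseteq> {..<\<alpha> x}" "card I = \<beta> x"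
  shows "(\<lambda>W. pluecker W (x, I)) \<in> pluecker_forms Q \<alpha> \<beta> (\<lambda>y. if y = x then 1 else 0)"
proof -
  let ?m = "Poly_Mapping.single (x, I) (1::nat)"
  have k: "Poly_Mapping.keys ?m = {(x, I)}" by simp
  have "{v. v \<in> {(x, I)} \<and> fst v = y} = (if y = x then {(x, I)} else {})" for y by auto
  then have "monom_degree y ?m = (if y = x then 1 else 0)" for y
    unfolding monom_degree_def k by simp
  then have "multidegree Q \<alpha> \<beta> (\<lambda>y. if y = x then 1 else 0) (Poly_Mapping.single ?m 1)"
    using assms by (auto simp: multidegree_def)
  moreover have "(\<lambda>W. pluecker W (x, I)) = (\<lambda>W. mpoly_eval (pluecker W) (Poly_Mapping.single ?m 1))"
    by (simp add: mpoly_eval_single monom_eval_def)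
  ultimately show ?thesis unfolding pluecker_forms_def by blast
qed

lemma pluecker_forms_add:
  assumes "g \<in> pluecker_forms Q \<alpha> \<beta> d" "h \<in> pluecker_forms Q \<alpha> \<beta> d"
  shows "(\<lambda>W. g W + h W) \<in> pluecker_forms Q \<alpha> \<beta> d"
proof -
  obtain F H where "g = (\<lambda>W. mpoly_eval (pluecker W) F)" "h = (\<lambda>W. mpoly_eval (pluecker W) H)"
    "multidegree Q \<alpha> \<beta> d F" "multidegree Q \<alpha> \<beta> d H"
    using assms unfolding pluecker_forms_def by blast
  then have "(\<lambda>W. g W + h W) = (\<lambda>W. mpoly_eval (pluecker W) (F + H))" "multidegree Q \<alpha> \<beta> d (F + H)"
    by (auto simp: mpoly_eval_add multidegree_add)
  then show ?thesis unfolding pluecker_forms_def by blast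
qed

lemma pluecker_forms_mult:
  assumes "g \<in> pluecker_forms Q \<alpha> \<beta> d" "h \<in> pluecker_forms Q \<alpha> \<beta> e"
  shows "(\<lambda>W. g W * h W) \<in> pluecker_forms Q \<alpha> \<beta> (\<lambda>x. d x + e x)"
proof -
  obtain F H where FH: "g = (\<lambda>W. mpoly_eval (pluecker W) F)" "h = (\<lambda>W. mpoly_eval (pluecker W) H)"
    "multidegree Q \<alpha> \<beta> d F" "multidegree Q \<alpha> \<beta> e H"
    using assms unfolding pluecker_forms_def by blast
  \<comment> \<open>The product is expanded into single monomials, so that value and multidegree can
    be computed term by term.\<close>
  define P where "P = (\<Sum>m\<in>Poly_Mapping.keys F. \<Sum>n\<in>Poly_Mapping.keys H.
    Poly_Mapping.single (m + n) (Poly_Mapping.lookup F m * Poly_Mapping.lookup H n))"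
  have "mpoly_eval c P = mpoly_eval c F * mpoly_eval c H" for c
    unfolding P_def mpoly_eval_sum mpoly_eval_single monom_eval_add
      mpoly_eval_superset[OF finite_keys order_refl, of _ F]
      mpoly_eval_superset[OF finite_keys order_refl, of _ H] sum_product
    by (intro sum.cong refl) (simp add: mult_ac)
  moreover have "multidegree Q \<alpha> \<beta> (\<lambda>x. d x + e x) P"
    unfolding P_def
  proof (intro multidegree_sum)
    fix m n assume mn: "m \<in> Poly_Mapping.keys F" "n \<in> Poly_Mapping.keys H"
    have "\<forall>(x, I)\<in>Poly_Mapping.keys (m + n). x \<in> verts Q \<and> I \<subseteq> {..<\<alpha> x} \<and> card I = \<beta> x"
      using mn FH(3,4) Poly_Mapping.keys_add[of m n] unfolding multidegree_def by blast
    moreover have "\<forall>x\<in>verts Q. monom_degree x (m + n) = d x + e x"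
      using mn FH(3,4) unfolding multidegree_def by (simp add: monom_degree_add)
    ultimately show "multidegree Q \<alpha> \<beta> (\<lambda>x. d x + e x)
      (Poly_Mapping.single (m + n) (Poly_Mapping.lookup F m * Poly_Mapping.lookup H n))"
      unfolding multidegree_def by (auto split: if_splits)
  qed
  ultimately show ?thesis unfolding pluecker_forms_def FH(1,2) by (auto intro!: exI[of _ P])
qed

section \<open>Constructible sets on the charts\<close>

lemma constructible_subset: "constructible T S \<Longrightarrow> S \<subseteq> topspace T"
  by (induction rule: constructible.induct) (auto dest: openin_subset closedin_subset)

text \<open>Complementation exchanges open with closed and, by De Morgan, unions with
  intersections.\<close>

lemma constructible_Diff_topspace: "constructible T S \<Longrightarrow> constructible T (topspace T - S)"
proof (induction rule: constructible.induct)
  case (opn S)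
  then show ?case by (intro constructible.cls closedin_diff) auto
next
  case (cls S)
  then show ?case by (intro constructible.opn openin_diff) auto
next
  case (un S U)
  then show ?case unfolding Diff_Un by (intro constructible.int)
next
  case (int S U)
  then show ?case unfolding Diff_Int by (intro constructible.un)
qed

lemma constructible_empty: "constructible T {}"
  by (rule constructible.opn) simp

lemma constructible_UN: "finite F \<Longrightarrow> (\<And>i. i \<in> F \<Longrightarrow> constructible T (S i)) \<Longrightarrow> constructible T (\<Union>i\<in>F. S i)"
  by (induction F rule: finite_induct) (auto simp: constructible_empty intro: constructible.un)

text \<open>As X itself is constructible, the complement in X is X intersected with the complement
  in the whole space.\<close>

lemma algebra_constructible:
  assumes X: "constructible T X"
  shows "algebra X {S. S \<subseteq> X \<and> constructible T S}"
  unfolding algebra_iff_Un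
proof (intro conjI ballI)
  fix S assume S: "S \<in> {S. S \<subseteq> X \<and> constructible T S}"
  then have "X - S = X \<inter> (topspace T - S)" using constructible_subset[OF X] by auto
  then show "X - S \<in> {S. S \<subseteq> X \<and> constructible T S}"
    using constructible.int[OF X constructible_Diff_topspace] S by auto
qed (auto simp: constructible_empty intro: constructible.un)

lemma quiver_grassmannian_subset: "quiver_grassmannian Q \<alpha> \<beta> \<phi> \<subseteq> grassmannian Q \<alpha> \<beta>"
  by (auto simp: quiver_grassmannian_def subrep_bundle_def)

text \<open>The nonvanishing locus of a form of one multidegree is a generator of the Zariski
  topology, here cut down to the quiver Grassmannian.\<close>

lemma openin_pluecker_form:
  assumes "h \<in> pluecker_forms Q \<alpha> \<beta> d"
  shows "openin (subtopology (zariski Q \<alpha> \<beta>) (quiver_grassmannian Q \<alpha> \<beta> \<phi>))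
    {W \<in> quiver_grassmannian Q \<alpha> \<beta> \<phi>. h W \<noteq> 0}"
proof -
  obtain F where F: "multidegree Q \<alpha> \<beta> d F" "h = (\<lambda>W. mpoly_eval (pluecker W) F)"
    using assms unfolding pluecker_forms_def by blast
  then have "openin (zariski Q \<alpha> \<beta>) {W \<in> grassmannian Q \<alpha> \<beta>. h W \<noteq> 0}"
    unfolding zariski_def multihomogeneous_iff by (intro topology_generated_by_Basis) blast
  moreover have "{W \<in> quiver_grassmannian Q \<alpha> \<beta> \<phi>. h W \<noteq> 0} =
    {W \<in> grassmannian Q \<alpha> \<beta>. h W \<noteq> 0} \<inter> quiver_grassmannian Q \<alpha> \<beta> \<phi>"
    using quiver_grassmannian_subset by blast
  ultimately show ?thesis unfolding openin_subtopology by blast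
qed

section \<open>Charts of the quiver Grassmannian and their regular functions\<close>

definition chart ::
  "('v,'e) pre_digraph \<Rightarrow> ('v \<Rightarrow> nat) \<Rightarrow> ('v \<Rightarrow> nat) \<Rightarrow> ('v,'e,'k::field) qrep \<Rightarrow> ('v \<Rightarrow> nat set) \<Rightarrow>
   ('v \<Rightarrow> (nat \<Rightarrow> 'k) set) set" where
  "chart Q \<alpha> \<beta> \<phi> I = {W \<in> quiver_grassmannian Q \<alpha> \<beta> \<phi>. \<forall>x\<in>verts Q. pluecker W (x, I x) \<noteq> 0}"

text \<open>Fractions of multidegree zero. Over a common denominator both terms of the numerator of
  a sum have multidegree d + e, so the sum is again such a fraction; denominators only have to be
  nonzero on X.\<close>

definition chart_functions ::
  "('v,'e) pre_digraph \<Rightarrow> ('v \<Rightarrow> nat) \<Rightarrow> ('v \<Rightarrow> nat) \<Rightarrow> ('v \<Rightarrow> (nat \<Rightarrow> 'k::field) set) set \<Rightarrow>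
   (('v \<Rightarrow> (nat \<Rightarrow> 'k) set) \<Rightarrow> 'k) set" where
  "chart_functions Q \<alpha> \<beta> X = {g. \<exists>d. \<exists>P\<in>pluecker_forms Q \<alpha> \<beta> d. \<exists>R\<in>pluecker_forms Q \<alpha> \<beta> d.
     \<forall>W\<in>X. R W \<noteq> 0 \<and> g W = P W / R W}"

lemma chart_functionsI:
  "P \<in> pluecker_forms Q \<alpha> \<beta> d \<Longrightarrow> R \<in> pluecker_forms Q \<alpha> \<beta> d \<Longrightarrow>
    (\<And>W. W \<in> X \<Longrightarrow> R W \<noteq> 0) \<Longrightarrow> (\<And>W. W \<in> X \<Longrightarrow> g W = P W / R W) \<Longrightarrow> g \<in> chart_functions Q \<alpha> \<beta> X"
  unfolding chart_functions_def by blast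

lemma chart_functionsE:
  assumes "g \<in> chart_functions Q \<alpha> \<beta> X"
  obtains d P R where "P \<in> pluecker_forms Q \<alpha> \<beta> d" "R \<in> pluecker_forms Q \<alpha> \<beta> d"
    "\<And>W. W \<in> X \<Longrightarrow> R W \<noteq> 0" "\<And>W. W \<in> X \<Longrightarrow> g W = P W / R W"
  using assms unfolding chart_functions_def by blast

lemma openin_chart:
  assumes Q: "quiver Q" and I: "\<And>x. x \<in> verts Q \<Longrightarrow> I x \<subseteq> {..<\<alpha> x}" "\<And>x. x \<in> verts Q \<Longrightarrow> card (I x) = \<beta> x"
  shows "openin (subtopology (zariski Q \<alpha> \<beta>) (quiver_grassmannian Q \<alpha> \<beta> \<phi>)) (chart Q \<alpha> \<beta> \<phi> I)"
    (is "openin ?T _")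
proof -
  let ?QG = "quiver_grassmannian Q \<alpha> \<beta> \<phi>"
  have "openin ?T {W \<in> ?QG. \<forall>x\<in>V. pluecker W (x, I x) \<noteq> 0}" if "finite V" "V \<subseteq> verts Q" for V
    using that
  proof (induction V rule: finite_induct)
    case empty
    \<comment> \<open>The empty intersection is the whole quiver Grassmannian, the nonvanishing
      locus of the constant form 1.\<close>
    then show ?case using openin_pluecker_form[OF pluecker_forms_const[of 1], of Q \<alpha> \<beta> \<phi>] by simp
  next
    case (insert x V)
    have "openin ?T {W \<in> ?QG. pluecker W (x, I x) \<noteq> 0}"
      using insert.prems I by (intro openin_pluecker_form[OF pluecker_forms_coordinate]) auto
    then have "openin ?T ({W \<in> ?QG. pluecker W (x, I x) \<noteq> 0} \<inter> {W \<in> ?QG. \<forall>x\<in>V. pluecker W (x, I x) \<noteq> 0})"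
      using insert by (intro openin_Int) auto
    then show ?case by (rule arg_cong[where f = "openin ?T", THEN iffD1, rotated]) auto
  qed
  from this[OF quiverD(1)[OF Q] order_refl] show ?thesis unfolding chart_def .
qed

text \<open>The zero set of a fraction on X is that of its numerator, the complement in X of the
  open set where the numerator is nonzero.\<close>

lemma chart_function_ring:
  fixes \<phi> :: "('v,'e,'k::field) qrep"
  assumes Q: "quiver Q" and I: "\<And>x. x \<in> verts Q \<Longrightarrow> I x \<subseteq> {..<\<alpha> x}" "\<And>x. x \<in> verts Q \<Longrightarrow> card (I x) = \<beta> x"
  defines "X \<equiv> chart Q \<alpha> \<beta> \<phi> I"
  shows "function_ring X
    {S. S \<subseteq> X \<and> constructible (subtopology (zariski Q \<alpha> \<beta>) (quiver_grassmannian Q \<alpha> \<beta> \<phi>)) S}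
    (chart_functions Q \<alpha> \<beta> X)"
proof -
  let ?T = "subtopology (zariski Q \<alpha> \<beta>) (quiver_grassmannian Q \<alpha> \<beta> \<phi>)"
  have X: "constructible ?T X" unfolding X_def by (rule constructible.opn[OF openin_chart[OF Q I]])
  interpret algebra X "{S. S \<subseteq> X \<and> constructible ?T S}" by (rule algebra_constructible[OF X])
  show ?thesis
  proof unfold_locales
    show "(\<lambda>_. c) \<in> chart_functions Q \<alpha> \<beta> X" for c
      by (rule chart_functionsI[OF pluecker_forms_const[of c] pluecker_forms_const[of 1]]) auto
  next
    fix g h assume "g \<in> chart_functions Q \<alpha> \<beta> X" "h \<in> chart_functions Q \<alpha> \<beta> X"
    then obtain d P R e P' R' where *: "P \<in> pluecker_forms Q \<alpha> \<beta> d" "R \<in> pluecker_forms Q \<alpha> \<beta> d"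
      "\<And>W. W \<in> X \<Longrightarrow> R W \<noteq> 0" "\<And>W. W \<in> X \<Longrightarrow> g W = P W / R W"
      "P' \<in> pluecker_forms Q \<alpha> \<beta> e" "R' \<in> pluecker_forms Q \<alpha> \<beta> e"
      "\<And>W. W \<in> X \<Longrightarrow> R' W \<noteq> 0" "\<And>W. W \<in> X \<Longrightarrow> h W = P' W / R' W"
      by (elim chart_functionsE) blast
    have 1: "(\<lambda>W. R W * P' W) \<in> pluecker_forms Q \<alpha> \<beta> (\<lambda>x. d x + e x)"
      by (rule pluecker_forms_mult[OF *(2,5)])
    have 2: "(\<lambda>W. P W * R' W) \<in> pluecker_forms Q \<alpha> \<beta> (\<lambda>x. d x + e x)"
      by (rule pluecker_forms_mult[OF *(1,6)])
    show "(\<lambda>W. g W + h W) \<in> chart_functions Q \<alpha> \<beta> X"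
      by (rule chart_functionsI[OF pluecker_forms_add[OF 2 1] pluecker_forms_mult[OF *(2,6)]])
        (simp_all add: *(3,4,7,8) field_simps)
    show "(\<lambda>W. g W * h W) \<in> chart_functions Q \<alpha> \<beta> X"
      by (rule chart_functionsI[OF pluecker_forms_mult[OF *(1,5)] pluecker_forms_mult[OF *(2,6)]])
        (simp_all add: *(3,4,7,8))
  next
    fix g assume "g \<in> chart_functions Q \<alpha> \<beta> X"
    then obtain d P R where *: "P \<in> pluecker_forms Q \<alpha> \<beta> d" "R \<in> pluecker_forms Q \<alpha> \<beta> d"
      "\<And>W. W \<in> X \<Longrightarrow> R W \<noteq> 0" "\<And>W. W \<in> X \<Longrightarrow> g W = P W / R W"
      by (elim chart_functionsE) blast
    have "constructible ?T {W \<in> quiver_grassmannian Q \<alpha> \<beta> \<phi>. P W \<noteq> 0}"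
      by (rule constructible.opn[OF openin_pluecker_form[OF *(1)]])
    then have "constructible ?T (X \<inter> (topspace ?T - {W \<in> quiver_grassmannian Q \<alpha> \<beta> \<phi>. P W \<noteq> 0}))"
      by (intro constructible.int X constructible_Diff_topspace)
    moreover have "{W \<in> X. g W = 0} = X \<inter> (topspace ?T - {W \<in> quiver_grassmannian Q \<alpha> \<beta> \<phi>. P W \<noteq> 0})"
      using constructible_subset[OF X] *(3,4) by (auto simp: X_def chart_def)
    ultimately show "{W \<in> X. g W = 0} \<in> {S. S \<subseteq> X \<and> constructible ?T S}" by auto
  qed
qed

text \<open>At each vertex some row set of the right size projects \<open>W x\<close> injectively,
  and its minor is then nonzero.\<close>

lemma charts_cover:
  assumes Q: "quiver Q" and W: "W \<in> quiver_grassmannian Q \<alpha> \<beta> \<phi>"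
  shows "\<exists>I\<in>(\<Pi>\<^sub>E x\<in>verts Q. {J. J \<subseteq> {..<\<alpha> x} \<and> card J = \<beta> x}). W \<in> chart Q \<alpha> \<beta> \<phi> I"
proof -
  have Wx: "VS.subspace (W x)" "W x \<subseteq> coord {..<\<alpha> x}" "VS.dim (W x) = \<beta> x" if "x \<in> verts Q" for x
    using W that by (auto simp: quiver_grassmannian_def subrep_bundle_def grassmannian_def std_space_coord)
  have "\<exists>J. J \<subseteq> {..<\<alpha> x} \<and> card J = \<beta> x \<and> pluecker W (x, J) \<noteq> 0" if x: "x \<in> verts Q" for x
  proof -
    obtain J where J: "J \<subseteq> {..<\<alpha> x}" "card J = VS.dim (W x)" "inj_on (coord_proj J) (W x)"
      using exists_injective_coord_proj[OF Wx(1,2)[OF x]] .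
    have fd: "fin_dim (W x)" using fin_dim_mono[OF fin_dim_coord Wx(1,2)[OF x]] by simp
    have "minor (chosen_basis (W x)) J \<noteq> 0"
      using J inj_on_coord_proj_iff[OF Wx(1)[OF x], of J] chosen_basis[OF fd]
      by (intro minor_nonzero) (auto intro: finite_subset)
    then show ?thesis using J Wx(3)[OF x] by (auto simp: pluecker_def minor_def)
  qed
  then obtain I where I: "\<And>x. x \<in> verts Q \<Longrightarrow> I x \<subseteq> {..<\<alpha> x} \<and> card (I x) = \<beta> x \<and> pluecker W (x, I x) \<noteq> 0"
    by metis
  \<comment> \<open>Values off the vertex set are normalised so that the charts are indexed by a
    finite set.\<close>
  have "restrict I (verts Q) \<in> (\<Pi>\<^sub>E x\<in>verts Q. {J. J \<subseteq> {..<\<alpha> x} \<and> card J = \<beta> x})" using I by auto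
  moreover have "W \<in> chart Q \<alpha> \<beta> \<phi> (restrict I (verts Q))" using W I by (simp add: chart_def)
  ultimately show ?thesis by blast
qed

section \<open>Assembling the rank loci from the charts\<close>

lemma (in function_ring) simple_weighted_sum:
  assumes "\<And>c r. (c, r) \<in> set S \<Longrightarrow> simple (\<lambda>p. r (\<Phi> p))"
  shows "simple (\<lambda>p. \<Sum>(c, r)\<leftarrow>S. c * real (r (\<Phi> p)))"
  using assms
proof (induction S)
  case Nil
  then show ?case by (simp add: simple_const)
next
  case (Cons s S)
  obtain c r where s: "s = (c, r)" by (cases s)
  have "simple (\<lambda>p. r (\<Phi> p))" using Cons.prems[of c r] s by simp
  moreover have "simple (\<lambda>p. \<Sum>(c, r)\<leftarrow>S. c * real (r (\<Phi> p)))"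
  proof (rule Cons.IH)
    show "simple (\<lambda>p. r (\<Phi> p))" if "(c, r) \<in> set S" for c r
      using Cons.prems[of c r] that by simp
  qed
  ultimately show ?case
    unfolding s using simple_binop[where f = "\<lambda>a b. c * real a + b"] by simp
qed

theorem corollary18:
  fixes Q :: "('v,'e) pre_digraph"
    and \<alpha> \<beta> :: "'v \<Rightarrow> nat"
    and \<phi> :: "('v,'e,'k::field) qrep"
    and Y :: "('v \<Rightarrow> (nat \<Rightarrow> 'k) set) set"
  assumes "quiver Q"
    and "\<forall>x\<in>verts Q. \<beta> x \<le> \<alpha> x"
    and "\<phi> \<in> rep_space Q \<alpha>"
    and "rank_locus Q \<alpha> \<beta> \<phi> Y"
  shows "constructible (subtopology (zariski Q \<alpha> \<beta>) (quiver_grassmannian Q \<alpha> \<beta> \<phi>)) Y"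
proof -
  let ?T = "subtopology (zariski Q \<alpha> \<beta>) (quiver_grassmannian Q \<alpha> \<beta> \<phi>)"
  note Q = assms(1)
  obtain \<H> where \<H>: "finite \<H>" "\<And>H. H \<in> \<H> \<Longrightarrow> rank_halfspace Q \<alpha> \<beta> H"
    "Y = {W \<in> quiver_grassmannian Q \<alpha> \<beta> \<phi>. (W, \<phi>) \<in> subrep_bundle Q \<alpha> \<beta> \<inter> \<Inter>\<H>}"
    using assms(4) unfolding rank_locus_def bundle_rank_locus_def by auto
  let ?I = "\<Pi>\<^sub>E x\<in>verts Q. {J. J \<subseteq> {..<\<alpha> x} \<and> card J = \<beta> x}"
  have "constructible ?T (Y \<inter> chart Q \<alpha> \<beta> \<phi> I)" if "I \<in> ?I" for I
  proof -
    have I: "\<And>x. x \<in> verts Q \<Longrightarrow> I x \<subseteq> {..<\<alpha> x}" "\<And>x. x \<in> verts Q \<Longrightarrow> card (I x) = \<beta> x"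
      using that by auto
    define X where "X = chart Q \<alpha> \<beta> \<phi> I"
    have XG: "W \<in> quiver_grassmannian Q \<alpha> \<beta> \<phi>" if "W \<in> X" for W using that by (simp add: X_def chart_def)
    interpret function_ring X "{S. S \<subseteq> X \<and> constructible ?T S}" "chart_functions Q \<alpha> \<beta> X"
      unfolding X_def by (rule chart_function_ring[OF Q I])
    have nz: "pluecker W (x, I x) \<noteq> 0" if "x \<in> verts Q" "W \<in> X" for x W
      using that by (simp add: X_def chart_def)
    have G: "(\<lambda>W. pluecker W (x, J) / pluecker W (x, I x)) \<in> chart_functions Q \<alpha> \<beta> X"
      if "x \<in> verts Q" "J \<subseteq> {..<\<alpha> x}" "card J = \<beta> x" for x J
    proof (rule chart_functionsI)
      show "(\<lambda>W. pluecker W (x, J)) \<in> pluecker_forms Q \<alpha> \<beta> (\<lambda>y. if y = x then 1 else 0)"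
        by (rule pluecker_forms_coordinate) (rule that)+
      show "(\<lambda>W. pluecker W (x, I x)) \<in> pluecker_forms Q \<alpha> \<beta> (\<lambda>y. if y = x then 1 else 0)"
        by (rule pluecker_forms_coordinate) (rule that I)+
    qed (use nz[OF that(1)] in auto)
    obtain \<Psi> where \<Psi>: "coord_family Q \<Psi>" "\<And>W. W \<in> X \<Longrightarrow> rep_iso Q (\<Psi> W) (restrict_rep \<phi> W)"
      using coord_family_subrep_quotient(1)[OF Q assms(3) XG I nz G] by blast
    obtain \<Theta> where \<Theta>: "coord_family Q \<Theta>" "\<And>W. W \<in> X \<Longrightarrow> rep_iso Q (\<Theta> W) (quotient_rep Q \<phi> W)"
      using coord_family_subrep_quotient(2)[OF Q assms(3) XG I nz G] by blast
    have "{W \<in> X. (W, \<phi>) \<in> H} \<in> {S. S \<subseteq> X \<and> constructible ?T S}" if "H \<in> \<H>" for H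
    proof -
      obtain S U d where H: "\<forall>(c, r)\<in>set S \<union> set U. rank_function Q r"
        "H = {p \<in> subrep_bundle Q \<alpha> \<beta>. rank_form Q S U p \<le> d} \<or>
         H = {p \<in> subrep_bundle Q \<alpha> \<beta>. rank_form Q S U p < d}"
        using \<H>(2)[OF \<open>H \<in> \<H>\<close>] unfolding rank_halfspace_def by blast
      have "simple (\<lambda>W. \<Sum>(c, r)\<leftarrow>S. c * real (r (restrict_rep \<phi> W)))"
        using H(1) by (intro simple_weighted_sum simple_rank_function[OF _ \<Psi>]) auto
      moreover have "simple (\<lambda>W. \<Sum>(c, r)\<leftarrow>U. c * real (r (quotient_rep Q \<phi> W)))"
        using H(1) by (intro simple_weighted_sum simple_rank_function[OF _ \<Theta>]) auto
      \<comment> \<open>On the chart each linear form in the ranks takes finitely many values with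
        constructible level sets, so strict and weak inequalities are treated alike.\<close>
      ultimately have form: "simple (\<lambda>W. rank_form Q S U (W, \<phi>))"
        unfolding rank_form_def prod.case by (rule simple_binop)
      have mem: "(W, \<phi>) \<in> subrep_bundle Q \<alpha> \<beta>" if "W \<in> X" for W
        using XG[OF that] by (simp add: quiver_grassmannian_def)
      from H(2) show ?thesis
      proof
        assume "H = {p \<in> subrep_bundle Q \<alpha> \<beta>. rank_form Q S U p \<le> d}"
        then have "{W \<in> X. (W, \<phi>) \<in> H} = {W \<in> X. rank_form Q S U (W, \<phi>) \<le> d}" using mem by auto
        then show ?thesis using simple_pred[OF form, of "\<lambda>t. t \<le> d"] by simp
      next
        assume "H = {p \<in> subrep_bundle Q \<alpha> \<beta>. rank_form Q S U p < d}"
        then have "{W \<in> X. (W, \<phi>) \<in> H} = {W \<in> X. rank_form Q S U (W, \<phi>) < d}" using mem by auto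
        then show ?thesis using simple_pred[OF form, of "\<lambda>t. t < d"] by simp
      qed
    qed
    \<comment> \<open>The finite intersection is written through complements in X, which yields X
      itself when \<H> is empty.\<close>
    then have "X - (\<Union>H\<in>\<H>. X - {W \<in> X. (W, \<phi>) \<in> H}) \<in> {S. S \<subseteq> X \<and> constructible ?T S}"
      using \<H>(1) by (intro compl_sets finite_UN) auto
    moreover have "Y \<inter> X = X - (\<Union>H\<in>\<H>. X - {W \<in> X. (W, \<phi>) \<in> H})"
      using XG unfolding \<H>(3) by (auto simp: quiver_grassmannian_def)
    ultimately show ?thesis by (simp add: X_def)
  qed
  moreover have "finite ?I"
  proof (intro finite_PiE quiverD(1)[OF Q])
    show "finite {J. J \<subseteq> {..<\<alpha> x} \<and> card J = \<beta> x}" for x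
      by (rule finite_subset[of _ "Pow {..<\<alpha> x}"]) auto
  qed
  ultimately have "constructible ?T (\<Union>I\<in>?I. Y \<inter> chart Q \<alpha> \<beta> \<phi> I)" by (intro constructible_UN)
  moreover have "Y = (\<Union>I\<in>?I. Y \<inter> chart Q \<alpha> \<beta> \<phi> I)"
  proof (intro equalityI subsetI)
    fix W assume W: "W \<in> Y"
    then have "W \<in> quiver_grassmannian Q \<alpha> \<beta> \<phi>" by (simp add: \<H>(3))
    from charts_cover[OF Q this] obtain I where "I \<in> ?I" "W \<in> chart Q \<alpha> \<beta> \<phi> I" ..
    with W show "W \<in> (\<Union>I\<in>?I. Y \<inter> chart Q \<alpha> \<beta> \<phi> I)" by (intro UN_I IntI)
  qed (elim UN_E IntD1)
  ultimately show ?thesis by simp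
qed

end
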